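(* Let $d$ be a metric on $\mathbb{R}^n$ and let $B\subset\mathbb{R}^n$ be a metric ball of $d$ which is a bounded domain in $\mathbb{R}^n$. Let $A$ be a bounded measurable nonnegative semidefinite $n\times n$ matrix function on $B$, with associated operator $L=\nabla\cdot A\nabla$. Let $N>1$ and let $\phi$ be a Young function satisfying $\phi(t)\ge t^2$ for all $t\ge 0$ and $\phi(t)\ge t^2(\ln t)^N$ for all $t\ge 1$. Suppose that there is a constant $C_0<\infty$ such that the Orlicz-Sobolev inequality $$\|w\|_{L^{\phi}(B,d\mu)}\le C_0\left(\int_B|\nabla_A w|^2\,d\mu\right)^{1/2}$$ holds for all $w\in (W^{1,2}_A)_0(B)$. Then there is a constant $C$ such that for every $f\in L^\infty(B)$ there exists a unique weak solution $u\in (W^{1,2}_A)_0(B)$ of the Dirichlet problem $\nabla\cdot A\nabla u=f$ in $B$, $u|_{\partial B}=0$, and it satisfies $$\|u\|_{L^\infty(B)}\le C\|f\|_{L^\infty(B)}.$$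
   Context: For the domain $\Omega=B$, it is assumed that $A(x)=S(x)^{\mathrm{tr}}S(x)$, where $S(x)$ is a Lipschitz continuous $n\times n$ real matrix function on $\Omega$. The $A$-gradient is $\nabla_A v=S\nabla v$ (derivatives in the weak sense), so that formally $\nabla u\cdot A\nabla v=\nabla_A u\cdot\nabla_A v$ and $|\nabla_A v|^2=\nabla v^{\mathrm{tr}}A\nabla v$. The space $W^{1,2}_A(\Omega)$ consists of $v\in L^2(\Omega)$ with $\nabla_A v\in L^2(\Omega)$, with norm $\|v\|_{W^{1,2}_A}=\left(\int_\Omega(|v|^2+|\nabla_A v|^2)\,dx\right)^{1/2}$; $(W^{1,2}_A)_0(\Omega)$ is the closure in $W^{1,2}_A(\Omega)$ of the Lipschitz functions with compact support in $\Omega$. Weak solution: $u\in(W^{1,2}_A)_0(\Omega)$ is a weak solution of $\nabla\cdot A\nabla u=f$ in $\Omega$, $u|_{\partial\Omega}=0$, if $\int_\Omega\nabla u\cdot A\nabla\psi=-\int_\Omega f\psi$ for every Lipschitz $\psi$ with compact support in $\Omega$. Measure: $d\mu=dx/|B|$, where $|B|$ is the Lebesgue measure of $B$. A Young function is a convex, lower semicontinuous, even function $\theta:\mathbb{R}\to[0,\infty]$ with $\theta(0)=0$ such that neither $\theta$ nor its convex conjugate $\tilde\theta(t)=\sup_{s\in\mathbb{R}}\{st-\theta(s)\}$ is identically zero. The Luxembourg norm is $\|f\|_{L^\theta(B,d\mu)}=\inf\{k>0:\int_B\theta(f/k)\,d\mu\le 1\}$, with $\inf\emptyset=+\infty$.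 *)

theory Defs
  imports "HOL-Analysis.Analysis" "HOL-Probability.Essential_Supremum"
begin

section \<open>Degenerate Sobolev spaces\<close>

definition L2_space :: "(real^'n) set \<Rightarrow> (real^'n \<Rightarrow> 'b::euclidean_space) set" where
  "L2_space \<Omega> = {f. f \<in> borel_measurable (lebesgue_on \<Omega>) \<and>
     integrable (lebesgue_on \<Omega>) (\<lambda>x. (norm (f x))\<^sup>2)}"

definition Lip_c :: "(real^'n) set \<Rightarrow> (real^'n \<Rightarrow> real) set" where
  "Lip_c \<Omega> = {\<psi>. (\<exists>K. K-lipschitz_on UNIV \<psi>) \<and>
     compact (closure {x. \<psi> x \<noteq> 0}) \<and> closure {x. \<psi> x \<noteq> 0} \<subseteq> \<Omega>}"

text \<open>The classical partial derivative. It is applied only to locally Lipschitz functions, for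
  which it exists almost everywhere; elsewhere \<^const>\<open>deriv\<close> takes an unspecified value.\<close>

definition partial_deriv :: "'n \<Rightarrow> (real^'n \<Rightarrow> real) \<Rightarrow> real^'n \<Rightarrow> real" where
  "partial_deriv j f x = deriv (\<lambda>t. f (x + t *\<^sub>R axis j 1)) 0"

text \<open>\<open>G = S \<nabla>v\<close> in the weak sense, for a Lipschitz matrix function \<open>S\<close>. The vector
  \<open>\<nabla>v\<close> need not be a function, so \<open>S \<nabla>v\<close> is read as a distribution: its \<open>i\<close>-th component
  \<open>\<Sum>j. S\<^sub>i\<^sub>j \<partial>\<^sub>j v\<close> acts on a test function \<open>\<psi>\<close> by \<open>- \<integral> v (\<Sum>j. \<partial>\<^sub>j (S\<^sub>i\<^sub>j \<psi>))\<close>.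
  Lipschitz test functions are the natural class because each \<open>S\<^sub>i\<^sub>j \<psi>\<close> is merely Lipschitz.\<close>

definition has_A_gradient ::
  "(real^'n \<Rightarrow> real^'n^'n) \<Rightarrow> (real^'n) set \<Rightarrow> (real^'n \<Rightarrow> real) \<Rightarrow> (real^'n \<Rightarrow> real^'n) \<Rightarrow> bool" where
  "has_A_gradient S \<Omega> v G \<longleftrightarrow> G \<in> L2_space \<Omega> \<and>
     (\<forall>\<psi>\<in>Lip_c \<Omega>. \<forall>i.
        (\<integral>x. G x $ i * \<psi> x \<partial>lebesgue_on \<Omega>) =
        - (\<integral>x. v x * (\<Sum>j\<in>UNIV. partial_deriv j (\<lambda>y. S y $ i $ j * \<psi> y) x) \<partial>lebesgue_on \<Omega>))"

text \<open>The space \<open>W\<^sup>1\<^sup>,\<^sup>2\<^sub>A(\<Omega>)\<close>, where \<open>A = S\<^sup>t\<^sup>r S\<close>. Its elements are functions, to be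
  identified when they agree almost everywhere in \<open>\<Omega>\<close>.\<close>

definition W12A :: "(real^'n \<Rightarrow> real^'n^'n) \<Rightarrow> (real^'n) set \<Rightarrow> (real^'n \<Rightarrow> real) set" where
  "W12A S \<Omega> = {v \<in> L2_space \<Omega>. \<exists>G. has_A_gradient S \<Omega> v G}"

text \<open>A representative of \<open>\<nabla>\<^sub>A v\<close>, which is determined up to null sets if \<open>v \<in> W12A S \<Omega>\<close>.\<close>

definition A_grad ::
  "(real^'n \<Rightarrow> real^'n^'n) \<Rightarrow> (real^'n) set \<Rightarrow> (real^'n \<Rightarrow> real) \<Rightarrow> real^'n \<Rightarrow> real^'n" where
  "A_grad S \<Omega> v = (SOME G. has_A_gradient S \<Omega> v G)"

definition W12A_norm :: "(real^'n \<Rightarrow> real^'n^'n) \<Rightarrow> (real^'n) set \<Rightarrow> (real^'n \<Rightarrow> real) \<Rightarrow> real" where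
  "W12A_norm S \<Omega> v =
     sqrt (\<integral>x. \<bar>v x\<bar>\<^sup>2 + (norm (A_grad S \<Omega> v x))\<^sup>2 \<partial>lebesgue_on \<Omega>)"

definition W12A_0 :: "(real^'n \<Rightarrow> real^'n^'n) \<Rightarrow> (real^'n) set \<Rightarrow> (real^'n \<Rightarrow> real) set" where
  "W12A_0 S \<Omega> =
     {v \<in> W12A S \<Omega>. \<forall>\<epsilon>>0. \<exists>\<psi>\<in>Lip_c \<Omega>. W12A_norm S \<Omega> (\<lambda>x. v x - \<psi> x) < \<epsilon>}"

text \<open>Weak solutions of \<open>\<nabla>\<cdot>A\<nabla>u = f\<close> in \<open>\<Omega>\<close>, \<open>u = 0\<close> on \<open>\<partial>\<Omega>\<close>, with
  \<open>\<nabla>u\<cdot>A\<nabla>\<psi>\<close> interpreted as \<open>\<nabla>\<^sub>A u\<cdot>\<nabla>\<^sub>A \<psi>\<close>, \<open>A = S\<^sup>t\<^sup>r S\<close>.\<close>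

definition weak_Dirichlet_solution ::
  "(real^'n \<Rightarrow> real^'n^'n) \<Rightarrow> (real^'n) set \<Rightarrow> (real^'n \<Rightarrow> real) \<Rightarrow> (real^'n \<Rightarrow> real) \<Rightarrow> bool" where
  "weak_Dirichlet_solution S \<Omega> f u \<longleftrightarrow> u \<in> W12A_0 S \<Omega> \<and>
     (\<forall>\<psi>\<in>Lip_c \<Omega>.
        (\<integral>x. A_grad S \<Omega> u x \<bullet> A_grad S \<Omega> \<psi> x \<partial>lebesgue_on \<Omega>) =
        - (\<integral>x. f x * \<psi> x \<partial>lebesgue_on \<Omega>))"

section \<open>Orlicz and supremum norms\<close>

definition young_conjugate :: "(real \<Rightarrow> ennreal) \<Rightarrow> real \<Rightarrow> ereal" where
  "young_conjugate \<theta> t = (SUP s. ereal (s * t) - enn2ereal (\<theta> s))"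

text \<open>Convexity is spelled out since \<^const>\<open>convex_on\<close> covers only real-valued functions; lower
  semicontinuity is openness of the strict superlevel sets.\<close>

definition young_function :: "(real \<Rightarrow> ennreal) \<Rightarrow> bool" where
  "young_function \<theta> \<longleftrightarrow>
     (\<forall>x y. \<forall>t\<in>{0..1}.
        \<theta> ((1 - t) * x + t * y) \<le> ennreal (1 - t) * \<theta> x + ennreal t * \<theta> y) \<and>
     (\<forall>a. open {t. a < \<theta> t}) \<and>
     (\<forall>t. \<theta> (- t) = \<theta> t) \<and>
     \<theta> 0 = 0 \<and>
     (\<exists>t. \<theta> t \<noteq> 0) \<and>
     (\<exists>t. young_conjugate \<theta> t \<noteq> 0)"

definition luxemburg_norm :: "'a measure \<Rightarrow> (real \<Rightarrow> ennreal) \<Rightarrow> ('a \<Rightarrow> real) \<Rightarrow> ennreal" where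
  "luxemburg_norm M \<theta> f = Inf {ennreal k | k. k > 0 \<and> (\<integral>\<^sup>+x. \<theta> (f x / k) \<partial>M) \<le> 1}"

text \<open>The normalized Lebesgue measure \<open>d\<mu> = dx/|B|\<close>, with underlying space \<open>B\<close>.\<close>

definition normalized_lebesgue_on :: "(real^'n) set \<Rightarrow> (real^'n) measure" where
  "normalized_lebesgue_on B = uniform_measure (lebesgue_on B) B"

definition Linf_norm :: "(real^'n) set \<Rightarrow> (real^'n \<Rightarrow> real) \<Rightarrow> ereal" where
  "Linf_norm B f = esssup (lebesgue_on B) (\<lambda>x. ereal \<bar>f x\<bar>)"

definition Linf_space :: "(real^'n) set \<Rightarrow> (real^'n \<Rightarrow> real) set" where
  "Linf_space B = {f \<in> borel_measurable (lebesgue_on B). Linf_norm B f < \<infinity>}"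

end

theory Submission
  imports Defs "HOL-Probability.Probability_Measure" "HOL-Real_Asymp.Real_Asymp"
begin

text \<open>The equation \<open>\<nabla>\<cdot>A\<nabla>u = f\<close> is the Euler--Lagrange equation of
  \<open>J(\<psi>) = \<integral> (|\<nabla>\<^sub>A\<psi>|\<^sup>2 / 2 + f \<psi>)\<close>, and everything below is read off from a
  sequence of compactly supported Lipschitz functions \<open>\<psi>\<^sub>m\<close> that minimizes \<open>J\<close> up to \<open>\<epsilon>\<^sub>m \<rightarrow> 0\<close>.

  \<^emph>\<open>Existence and uniqueness.\<close> Since \<open>\<phi>(t) \<ge> t\<^sup>2\<close>, the Orlicz--Sobolev inequality contains the
  Poincare inequality \<open>\<parallel>w\<parallel>\<^sub>2 \<le> \<kappa> \<parallel>\<nabla>\<^sub>A w\<parallel>\<^sub>2\<close>. Hence \<open>J\<close> is bounded below, the parallelogram law makes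
  \<open>\<psi>\<^sub>m\<close> and \<open>\<nabla>\<^sub>A\<psi>\<^sub>m\<close> Cauchy in \<open>L\<^sup>2\<close>, and the limit \<open>u\<close> solves the equation
  (\<open>minimizing_sequence_converges\<close>). The difference of two solutions has gradient zero and so
  vanishes, again by Poincare (\<open>weak_solution_unique\<close>).

  \<^emph>\<open>Boundedness.\<close> Let \<open>|f| \<le> F\<close>. Comparing \<open>\<psi>\<^sub>m\<close> with \<open>min \<psi>\<^sub>m k\<close> gives
  \<open>\<integral> |\<nabla>\<^sub>A(\<psi>\<^sub>m - k)\<^sub>+|\<^sup>2 \<le> 2 \<epsilon>\<^sub>m + 2 F \<integral> (\<psi>\<^sub>m - k)\<^sub>+\<close>. Truncating the minimizing sequence rather than the
  solution means that the chain rule for truncations is only ever used for Lipschitz functions, where it is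
  pointwise (\<open>partial_deriv_truncation\<close>), and that only \<open>L\<^sup>1\<close> convergence is needed in the limit. With the
  bump \<open>\<phi>(t) \<ge> t\<^sup>2 (ln t)\<^sup>N\<close> the Orlicz--Sobolev inequality turns this into
  \<open>a(k) \<le> \<Lambda> (T m(k) + 1 / (T (ln T)\<^sup>N))\<^sup>2\<close> for all \<open>T > 1\<close>, where \<open>a(k) = \<integral> (u - k)\<^sub>+ d\<mu>\<close>,
  \<open>m(k) = \<mu>{u > k}\<close> and \<open>\<Lambda>\<close> is a multiple of \<open>F\<close> (\<open>truncation_estimate\<close>). The best \<open>T\<close> yields
  \<open>a(k) \<lesssim> \<Lambda> m(k) / (ln (1 / m(k)))\<^sup>N\<close>. By Chebyshev \<open>m(k + h) \<le> a(k) / h\<close>, so a step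
  \<open>h \<approx> \<Lambda> j\<^sup>-\<^sup>N\<close> is enough to bring \<open>m\<close> from \<open>e\<^sup>-\<^sup>j\<close> down to \<open>e\<^sup>-\<^sup>j\<^sup>-\<^sup>1\<close>. For \<open>N > 1\<close> these
  steps have a finite sum, of order \<open>\<Lambda>\<close>, beyond which \<open>m\<close> vanishes
  (\<open>log_bump_truncations_imp_bounded\<close>). The same bound for \<open>- u\<close> follows from the symmetry
  \<open>f \<mapsto> - f\<close>.

  \<^emph>\<open>Foundations.\<close> The weak \<open>A\<close>-gradient is tested against classical partial derivatives of Lipschitz
  functions, so these must exist almost everywhere and satisfy integration by parts. In one variable
  this rests on the Vitali covering theorem: a map with arbitrarily short intervals of slope \<open>\<le> p\<close> at each
  point of a set expands its measure by a factor of at most \<open>p\<close>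
  (\<open>emeasure_image_le_small_slopes\<close>), and applying this to a map and to its inverse shows that the
  upper and the lower derivative agree almost everywhere. Fubini's theorem along lines gives the case of
  several variables. Consequently the classical gradient \<open>S\<nabla>\<psi>\<close> of a compactly supported Lipschitz function is its
  weak \<open>A\<close>-gradient (\<open>has_A_gradient_Lip_c\<close>), and since weak gradients are unique and closed under
  \<open>L\<^sup>2\<close> limits, the space \<open>(W\<^sup>1\<^sup>,\<^sup>2\<^sub>A)\<^sub>0\<close> consists of the \<open>L\<^sup>2\<close> limits of such functions with
  convergent gradients (\<open>W12A_0_approx\<close>, \<open>W12A_0_limit\<close>).\<close>

section \<open>Square integrable functions\<close>

definition square_integrable :: "'a measure \<Rightarrow> ('a \<Rightarrow> 'b::euclidean_space) \<Rightarrow> bool" where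
  "square_integrable M f \<longleftrightarrow> f \<in> borel_measurable M \<and> integrable M (\<lambda>x. (norm (f x))\<^sup>2)"

definition l2_dist :: "'a measure \<Rightarrow> ('a \<Rightarrow> 'b::euclidean_space) \<Rightarrow> ('a \<Rightarrow> 'b) \<Rightarrow> real" where
  "l2_dist M f g = (\<integral>x. (norm (f x - g x))\<^sup>2 \<partial>M)"

lemma square_integrable_measurable [measurable_dest]:
  "square_integrable M f \<Longrightarrow> f \<in> borel_measurable M"
  by (simp add: square_integrable_def)

lemma integrable_norm_square:
  "square_integrable M f \<Longrightarrow> integrable M (\<lambda>x. (norm (f x))\<^sup>2)"
  by (simp add: square_integrable_def)

lemma square_integrableI_bound:
  fixes f :: "'a \<Rightarrow> 'b::euclidean_space" and g :: "'a \<Rightarrow> real"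
  assumes "f \<in> borel_measurable M" "integrable M g" "AE x in M. (norm (f x))\<^sup>2 \<le> g x"
  shows "square_integrable M f"
  unfolding square_integrable_def
proof
  show "integrable M (\<lambda>x. (norm (f x))\<^sup>2)"
    using assms by (intro Bochner_Integration.integrable_bound[OF assms(2)]) (auto elim: eventually_mono)
qed fact

lemma norm_add_square_le:
  "(norm (a + b))\<^sup>2 \<le> 2 * (norm a)\<^sup>2 + 2 * (norm b)\<^sup>2" for a b :: "'b::real_normed_vector"
proof -
  have "(norm (a + b))\<^sup>2 \<le> (norm a + norm b)\<^sup>2" by (intro power_mono norm_triangle_ineq) auto
  also have "\<dots> \<le> 2 * (norm a)\<^sup>2 + 2 * (norm b)\<^sup>2"
    using sum_squares_bound[of "norm a" "norm b"] by (simp add: power2_sum)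
  finally show ?thesis .
qed

lemma square_integrable_add:
  assumes "square_integrable M f" "square_integrable M g"
  shows "square_integrable M (\<lambda>x. f x + g x)"
proof (rule square_integrableI_bound)
  show "(\<lambda>x. f x + g x) \<in> borel_measurable M" using assms by measurable
  show "integrable M (\<lambda>x. 2 * (norm (f x))\<^sup>2 + 2 * (norm (g x))\<^sup>2)"
    using assms[THEN integrable_norm_square] by simp
  show "AE x in M. (norm (f x + g x))\<^sup>2 \<le> 2 * (norm (f x))\<^sup>2 + 2 * (norm (g x))\<^sup>2"
    by (simp add: norm_add_square_le)
qed

lemma square_integrable_scaleR:
  assumes "square_integrable M f"
  shows "square_integrable M (\<lambda>x. c *\<^sub>R f x)"
  using assms by (auto simp: square_integrable_def power_mult_distrib)

lemma square_integrable_diff: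
  assumes "square_integrable M f" "square_integrable M g"
  shows "square_integrable M (\<lambda>x. f x - g x)"
  using square_integrable_add[OF assms(1) square_integrable_scaleR[OF assms(2), of "-1"]] by simp

lemma square_integrable_bounded:
  fixes f :: "'a \<Rightarrow> 'b::euclidean_space"
  assumes "finite_measure M" "f \<in> borel_measurable M" "AE x in M. norm (f x) \<le> C"
  shows "square_integrable M f"
proof (rule square_integrableI_bound)
  show "integrable M (\<lambda>x. C\<^sup>2)" using assms(1) finite_measure.integrable_const by blast
  show "AE x in M. (norm (f x))\<^sup>2 \<le> C\<^sup>2" using assms(3) by (auto elim!: eventually_mono intro: power_mono)
qed fact

lemma square_integrable_inner:
  assumes "square_integrable M f" "square_integrable M g"
  shows "integrable M (\<lambda>x. f x \<bullet> g x)"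
proof (rule Bochner_Integration.integrable_bound)
  show "integrable M (\<lambda>x. (norm (f x))\<^sup>2 + (norm (g x))\<^sup>2)"
    using assms[THEN integrable_norm_square] by simp
  show "(\<lambda>x. f x \<bullet> g x) \<in> borel_measurable M" using assms by measurable
  have "\<bar>a \<bullet> b\<bar> \<le> (norm a)\<^sup>2 + (norm b)\<^sup>2" for a b :: 'b
  proof -
    have "2 * (norm a * norm b) \<le> (norm a)\<^sup>2 + (norm b)\<^sup>2"
      using sum_squares_bound[of "norm a" "norm b"] by simp
    moreover have "0 \<le> norm a * norm b" by simp
    ultimately show ?thesis using Cauchy_Schwarz_ineq2[of a b] by linarith
  qed
  then show "AE x in M. norm (f x \<bullet> g x) \<le> norm ((norm (f x))\<^sup>2 + (norm (g x))\<^sup>2)" by simp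
qed

lemma square_integrable_norm:
  "square_integrable M f \<Longrightarrow> square_integrable M (\<lambda>x. norm (f x))"
  by (auto simp: square_integrable_def)

lemma square_integrable_const:
  "finite_measure M \<Longrightarrow> square_integrable M (\<lambda>x. c)"
  by (intro square_integrable_bounded[where C = "norm c"]) auto

lemma square_integrable_integrable:
  fixes f :: "'a \<Rightarrow> 'b::euclidean_space"
  assumes "finite_measure M" "square_integrable M f"
  shows "integrable M f"
proof -
  have "integrable M (\<lambda>x. norm (f x) \<bullet> (1::real))"
    using assms by (intro square_integrable_inner square_integrable_norm square_integrable_const)
  then show ?thesis using assms by (simp add: integrable_norm_iff square_integrable_measurable)
qed

text \<open>The Cauchy--Schwarz inequality, from the discriminant of
  \<open>t \<mapsto> \<integral> \<parallel>t f + g\<parallel>\<^sup>2\<close>.\<close>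
lemma integral_inner_square_le:
  assumes f: "square_integrable M f" and g: "square_integrable M g"
  shows "(\<integral>x. f x \<bullet> g x \<partial>M)\<^sup>2 \<le> (\<integral>x. (norm (f x))\<^sup>2 \<partial>M) * (\<integral>x. (norm (g x))\<^sup>2 \<partial>M)"
proof -
  define a b c where "a = (\<integral>x. (norm (f x))\<^sup>2 \<partial>M)" and "b = (\<integral>x. f x \<bullet> g x \<partial>M)"
    and "c = (\<integral>x. (norm (g x))\<^sup>2 \<partial>M)"
  have quad: "0 \<le> t\<^sup>2 * a + 2 * t * b + c" for t
  proof -
    have "0 \<le> (\<integral>x. (norm (t *\<^sub>R f x + g x))\<^sup>2 \<partial>M)" by simp
    also have "\<dots> = (\<integral>x. t\<^sup>2 * (norm (f x))\<^sup>2 + 2 * t * (f x \<bullet> g x) + (norm (g x))\<^sup>2 \<partial>M)"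
      by (intro Bochner_Integration.integral_cong refl)
        (simp only: power2_norm_eq_inner inner_simps, simp add: inner_commute power2_eq_square algebra_simps)
    also have "\<dots> = t\<^sup>2 * a + 2 * t * b + c"
      using f[THEN integrable_norm_square] g[THEN integrable_norm_square]
        square_integrable_inner[OF f g] by (simp add: a_def b_def c_def)
    finally show ?thesis .
  qed
  have a: "a \<ge> 0" by (simp add: a_def)
  have "b\<^sup>2 \<le> a * c"
  proof (cases "a = 0")
    case True
    have "b = 0"
    proof (rule ccontr)
      assume "b \<noteq> 0"
      then show False using quad[of "- (c + 1) / (2 * b)"] True by (simp add: field_simps)
    qed
    then show ?thesis using True by simp
  next
    case False
    then show ?thesis using quad[of "- b / a"] a by (simp add: field_simps power2_eq_square)
  qed
  then show ?thesis by (simp add: a_def b_def c_def)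
qed

lemma abs_integral_inner_le:
  assumes f: "square_integrable M f" and g: "square_integrable M g"
  shows "\<bar>\<integral>x. f x \<bullet> g x \<partial>M\<bar> \<le> sqrt (\<integral>x. (norm (f x))\<^sup>2 \<partial>M) * sqrt (\<integral>x. (norm (g x))\<^sup>2 \<partial>M)"
  using integral_inner_square_le[OF assms] by (metis real_sqrt_abs real_sqrt_le_iff real_sqrt_mult)

lemma l2_dist_tendsto_inner:
  assumes f: "\<And>n. square_integrable M (f n)" "square_integrable M f'"
    and g: "\<And>n. square_integrable M (g n)" "square_integrable M g'"
    and lim: "(\<lambda>n. l2_dist M (f n) f') \<longlonglongrightarrow> 0" "(\<lambda>n. l2_dist M (g n) g') \<longlonglongrightarrow> 0"
  shows "(\<lambda>n. \<integral>x. f n x \<bullet> g n x \<partial>M) \<longlonglongrightarrow> (\<integral>x. f' x \<bullet> g' x \<partial>M)"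
proof -
  define F where "F n x = f n x - f' x" for n x
  define G where "G n x = g n x - g' x" for n x
  have FG: "square_integrable M (F n)" "square_integrable M (G n)" for n
    unfolding F_def G_def using f g by (auto intro: square_integrable_diff)
  have F0: "(\<lambda>n. \<integral>x. (norm (F n x))\<^sup>2 \<partial>M) \<longlonglongrightarrow> 0" and G0: "(\<lambda>n. \<integral>x. (norm (G n x))\<^sup>2 \<partial>M) \<longlonglongrightarrow> 0"
    using lim by (auto simp: l2_dist_def F_def G_def)
  have sF: "(\<lambda>n. sqrt (\<integral>x. (norm (F n x))\<^sup>2 \<partial>M)) \<longlonglongrightarrow> 0" and sG: "(\<lambda>n. sqrt (\<integral>x. (norm (G n x))\<^sup>2 \<partial>M)) \<longlonglongrightarrow> 0"
    using tendsto_real_sqrt[OF F0] tendsto_real_sqrt[OF G0] by auto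
  have "(\<lambda>n. \<integral>x. F n x \<bullet> g' x \<partial>M) \<longlonglongrightarrow> 0"
  proof (rule Lim_null_comparison)
    show "(\<lambda>n. sqrt (\<integral>x. (norm (F n x))\<^sup>2 \<partial>M) * sqrt (\<integral>x. (norm (g' x))\<^sup>2 \<partial>M)) \<longlonglongrightarrow> 0"
      by (rule tendsto_mult_left_zero[OF sF])
  qed (use abs_integral_inner_le[OF FG(1) g(2)] in \<open>auto intro!: always_eventually\<close>)
  moreover have "(\<lambda>n. \<integral>x. f' x \<bullet> G n x \<partial>M) \<longlonglongrightarrow> 0"
  proof (rule Lim_null_comparison)
    show "(\<lambda>n. sqrt (\<integral>x. (norm (f' x))\<^sup>2 \<partial>M) * sqrt (\<integral>x. (norm (G n x))\<^sup>2 \<partial>M)) \<longlonglongrightarrow> 0"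
      by (rule tendsto_mult_right_zero[OF sG])
  qed (use abs_integral_inner_le[OF f(2) FG(2)] in \<open>auto intro!: always_eventually\<close>)
  moreover have "(\<lambda>n. \<integral>x. F n x \<bullet> G n x \<partial>M) \<longlonglongrightarrow> 0"
  proof (rule Lim_null_comparison)
    show "(\<lambda>n. sqrt (\<integral>x. (norm (F n x))\<^sup>2 \<partial>M) * sqrt (\<integral>x. (norm (G n x))\<^sup>2 \<partial>M)) \<longlonglongrightarrow> 0"
      using tendsto_mult[OF sF sG] by simp
  qed (use abs_integral_inner_le[OF FG] in \<open>auto intro!: always_eventually\<close>)
  ultimately have lim0: "(\<lambda>n. (\<integral>x. f' x \<bullet> g' x \<partial>M) + (\<integral>x. F n x \<bullet> g' x \<partial>M) + (\<integral>x. f' x \<bullet> G n x \<partial>M)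
      + (\<integral>x. F n x \<bullet> G n x \<partial>M)) \<longlonglongrightarrow> (\<integral>x. f' x \<bullet> g' x \<partial>M) + 0 + 0 + 0"
    by (intro tendsto_add tendsto_const)
  have "(\<integral>x. f n x \<bullet> g n x \<partial>M) = (\<integral>x. f' x \<bullet> g' x \<partial>M) + (\<integral>x. F n x \<bullet> g' x \<partial>M) + (\<integral>x. f' x \<bullet> G n x \<partial>M)
      + (\<integral>x. F n x \<bullet> G n x \<partial>M)" for n
  proof -
    have "(\<integral>x. f n x \<bullet> g n x \<partial>M) = (\<integral>x. f' x \<bullet> g' x + F n x \<bullet> g' x + f' x \<bullet> G n x + F n x \<bullet> G n x \<partial>M)"
      by (intro Bochner_Integration.integral_cong refl) (simp add: F_def G_def inner_simps)
    also have "\<dots> = (\<integral>x. f' x \<bullet> g' x \<partial>M) + (\<integral>x. F n x \<bullet> g' x \<partial>M) + (\<integral>x. f' x \<bullet> G n x \<partial>M)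
      + (\<integral>x. F n x \<bullet> G n x \<partial>M)"
      using square_integrable_inner[OF f(2) g(2)] square_integrable_inner[OF FG(1) g(2)]
        square_integrable_inner[OF f(2) FG(2)] square_integrable_inner[OF FG] by simp
    finally show ?thesis .
  qed
  then show ?thesis using lim0 by simp
qed

lemma l2_dist_nonneg: "l2_dist M f g \<ge> 0"
  by (simp add: l2_dist_def)

lemma l2_dist_self [simp]: "l2_dist M f f = 0"
  by (simp add: l2_dist_def)

lemma l2_dist_tendsto_integral_abs:
  fixes f :: "nat \<Rightarrow> 'a \<Rightarrow> real"
  assumes fin: "finite_measure M" and f: "\<And>n. square_integrable M (f n)" "square_integrable M f'"
    and lim: "(\<lambda>n. l2_dist M (f n) f') \<longlonglongrightarrow> 0"
  shows "(\<lambda>n. \<integral>x. \<bar>f n x - f' x\<bar> \<partial>M) \<longlonglongrightarrow> 0"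
proof -
  have "(\<lambda>n. \<integral>x. \<bar>f n x - f' x\<bar> \<bullet> 1 \<partial>M) \<longlonglongrightarrow> (\<integral>x. (0::real) \<bullet> 1 \<partial>M)"
  proof (rule l2_dist_tendsto_inner)
    show "square_integrable M (\<lambda>x. \<bar>f n x - f' x\<bar>)" for n
      using square_integrable_norm[OF square_integrable_diff[OF f(1)[of n] f(2)]] by simp
    show "(\<lambda>n. l2_dist M (\<lambda>x. \<bar>f n x - f' x\<bar>) (\<lambda>x. 0)) \<longlonglongrightarrow> 0"
      using lim by (simp add: l2_dist_def)
  qed (auto intro: square_integrable_const fin)
  then show ?thesis by simp
qed

text \<open>Riesz--Fischer. Along a subsequence with squared distances below \<open>4\<^sup>-\<^sup>k\<close> the weighted sum
  \<open>\<Sum> 2\<^sup>k |f\<^bsub>k+1\<^esub> - f\<^bsub>k\<^esub>|\<^sup>2\<close> has finite integral, and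
  \<open>|f\<^bsub>k+1\<^esub> - f\<^bsub>k\<^esub>| \<le> 2\<^sup>-\<^sup>k + 2\<^sup>k |f\<^bsub>k+1\<^esub> - f\<^bsub>k\<^esub>|\<^sup>2\<close> then gives absolute
  convergence almost everywhere. Fatou's lemma carries the Cauchy estimate over to the limit.\<close>
lemma l2_complete:
  fixes f :: "nat \<Rightarrow> 'a \<Rightarrow> 'b::euclidean_space"
  assumes f: "\<And>n. square_integrable M (f n)"
    and cauchy: "\<And>e. e > 0 \<Longrightarrow> \<exists>N. \<forall>m\<ge>N. \<forall>n\<ge>N. l2_dist M (f m) (f n) < e"
  obtains g where "square_integrable M g" "(\<lambda>n. l2_dist M (f n) g) \<longlonglongrightarrow> 0"
proof -
  note [measurable] = square_integrable_measurable[OF f]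
  have "\<exists>N. \<forall>k. \<forall>m\<ge>N k. \<forall>n\<ge>N k. l2_dist M (f m) (f n) < (1/4) ^ k"
    by (intro choice allI cauchy) simp
  then obtain N where N: "\<And>k m n. m \<ge> N k \<Longrightarrow> n \<ge> N k \<Longrightarrow> l2_dist M (f m) (f n) < (1/4) ^ k"
    by blast
  (* The sum gives N k <= r k and N k <= r (k + 1); the summand k makes r unbounded. *)
  define r where "r k = (\<Sum>i\<le>k. N i) + k" for k :: nat
  have "N k \<le> sum N {..k}" for k by (intro member_le_sum) auto
  then have r: "N k \<le> r k" "N k \<le> r (Suc k)" "k \<le> r k" for k
    by (auto simp: r_def trans_le_add1 le_SucI)
  define D where "D k x = (norm (f (r (Suc k)) x - f (r k) x))\<^sup>2" for k x
  have D_meas [measurable]: "D k \<in> borel_measurable M" for k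
    unfolding D_def by measurable
  have nn_dist: "(\<integral>\<^sup>+x. ennreal ((norm (f m x - f n x))\<^sup>2) \<partial>M) = ennreal (l2_dist M (f m) (f n))" for m n
    unfolding l2_dist_def
    by (rule nn_integral_eq_integral[OF integrable_norm_square[OF square_integrable_diff[OF f f]]]) auto
  have "(\<integral>\<^sup>+x. (\<Sum>k. ennreal (2 ^ k * D k x)) \<partial>M) = (\<Sum>k. \<integral>\<^sup>+x. ennreal (2 ^ k * D k x) \<partial>M)"
    by (intro nn_integral_suminf) measurable
  also have "\<dots> \<le> (\<Sum>k. ennreal ((1/2) ^ k))"
  proof (rule suminf_le)
    fix k
    have "(\<integral>\<^sup>+x. ennreal (2 ^ k * D k x) \<partial>M) = ennreal (2 ^ k) * (\<integral>\<^sup>+x. ennreal (D k x) \<partial>M)"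
      by (subst nn_integral_cmult[symmetric]) (auto simp: ennreal_mult' simp del: ennreal_power)
    also have "(\<integral>\<^sup>+x. ennreal (D k x) \<partial>M) = ennreal (l2_dist M (f (r (Suc k))) (f (r k)))"
      unfolding D_def by (rule nn_dist)
    also have "ennreal (2 ^ k) * \<dots> \<le> ennreal (2 ^ k) * ennreal ((1/4) ^ k)"
      using N[of k "r (Suc k)" "r k"] r by (intro mult_left_mono ennreal_leI) auto
    also have "\<dots> = ennreal ((1/2) ^ k)"
      by (simp add: ennreal_mult'[symmetric] power_mult_distrib[symmetric] del: ennreal_power)
    finally show "(\<integral>\<^sup>+x. ennreal (2 ^ k * D k x) \<partial>M) \<le> ennreal ((1/2) ^ k)" .
  qed auto
  also have "\<dots> = ennreal (\<Sum>k. (1/2) ^ k)"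
    by (intro suminf_ennreal2) (auto intro: summable_geometric)
  also have "\<dots> < \<infinity>" by simp
  finally have "AE x in M. (\<Sum>k. ennreal (2 ^ k * D k x)) \<noteq> \<infinity>"
    by (intro nn_integral_noteq_infinite) auto
  then have conv: "AE x in M. convergent (\<lambda>k. f (r k) x)"
  proof (rule AE_mp, intro AE_I2 impI)
    fix x assume "(\<Sum>k. ennreal (2 ^ k * D k x)) \<noteq> \<infinity>"
    then have s1: "summable (\<lambda>k. 2 ^ k * D k x)"
      by (intro summable_suminf_not_top) (auto simp: D_def)
    have s2: "summable (\<lambda>k. (1/2::real) ^ k)" by (auto intro: summable_geometric)
    have le: "norm (f (r (Suc k)) x - f (r k) x) \<le> (1/2) ^ k + 2 ^ k * D k x" for k
    proof -
      define d where "d = norm (f (r (Suc k)) x - f (r k) x)"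
      (* Arithmetic-geometric mean with weights 2^k, which trades the square for a summable error. *)
      have "0 \<le> 2 ^ k * (d - (1/2) ^ k)\<^sup>2" by simp
      also have "2 ^ k * (d - (1/2) ^ k)\<^sup>2 = 2 ^ k * d\<^sup>2 - 2 * d + (1/2) ^ k"
        by (simp add: power2_eq_square field_simps)
      finally have "2 * d \<le> 2 ^ k * d\<^sup>2 + (1/2) ^ k" by simp
      moreover have "d \<ge> 0" by (simp add: d_def)
      ultimately show ?thesis unfolding D_def d_def[symmetric] by linarith
    qed
    have "summable (\<lambda>k. f (r (Suc k)) x - f (r k) x)"
      by (rule summable_comparison_test'[OF summable_add[OF s2 s1], of 0]) (rule le)
    then have "convergent (\<lambda>n. f (r n) x - f (r 0) x)"
      by (simp only: summable_iff_convergent sum_lessThan_telescope[of "\<lambda>k. f (r k) x"])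
    then show "convergent (\<lambda>k. f (r k) x)"
      using convergent_add[OF _ convergent_const[of "f (r 0) x"]] by force
  qed
  define g where "g x = lim (\<lambda>k. f (r k) x)" for x
  have g_meas [measurable]: "g \<in> borel_measurable M"
    unfolding g_def by (intro borel_measurable_lim_metric) measurable
  have dist_le: "(\<integral>\<^sup>+x. ennreal ((norm (f m x - g x))\<^sup>2) \<partial>M) \<le> ennreal ((1/4) ^ k)" if m: "m \<ge> N k" for m k
  proof -
    have "(\<integral>\<^sup>+x. ennreal ((norm (f m x - g x))\<^sup>2) \<partial>M) =
        (\<integral>\<^sup>+x. liminf (\<lambda>i. ennreal ((norm (f m x - f (r i) x))\<^sup>2)) \<partial>M)"
    proof (rule nn_integral_cong_AE, rule AE_mp[OF conv], intro AE_I2 impI)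
      fix x assume "convergent (\<lambda>k. f (r k) x)"
      then have "(\<lambda>i. f (r i) x) \<longlonglongrightarrow> g x" by (simp add: g_def convergent_LIMSEQ_iff)
      then have "(\<lambda>i. ennreal ((norm (f m x - f (r i) x))\<^sup>2)) \<longlonglongrightarrow> ennreal ((norm (f m x - g x))\<^sup>2)"
        by (intro tendsto_ennrealI tendsto_intros)
      then show "ennreal ((norm (f m x - g x))\<^sup>2) = liminf (\<lambda>i. ennreal ((norm (f m x - f (r i) x))\<^sup>2))"
        by (intro lim_imp_Liminf[symmetric]) auto
    qed
    also have "\<dots> \<le> liminf (\<lambda>i. \<integral>\<^sup>+x. ennreal ((norm (f m x - f (r i) x))\<^sup>2) \<partial>M)"
      by (intro nn_integral_liminf) measurable
    also have "\<dots> \<le> ennreal ((1/4) ^ k)"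
    proof (rule Liminf_le)
      have "\<forall>\<^sub>F i in sequentially. r i \<ge> N k"
        using eventually_ge_at_top[of "N k"] by (rule eventually_mono) (meson r(3) order_trans)
      then show "\<forall>\<^sub>F i in sequentially. (\<integral>\<^sup>+x. ennreal ((norm (f m x - f (r i) x))\<^sup>2) \<partial>M) \<le> ennreal ((1/4) ^ k)"
        unfolding nn_dist using N[OF m] by (auto elim!: eventually_mono intro!: ennreal_leI less_imp_le)
    qed simp
    finally show ?thesis .
  qed
  have fg: "square_integrable M (\<lambda>x. f m x - g x)" if "m \<ge> N k" for m k
    unfolding square_integrable_def
  proof (intro conjI integrableI_bounded)
    have "(\<integral>\<^sup>+x. ennreal (norm ((norm (f m x - g x))\<^sup>2)) \<partial>M) \<le> ennreal ((1/4) ^ k)"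
      using dist_le[OF that] by simp
    also have "\<dots> < \<infinity>" by (rule ennreal_less_top[simplified top.extremum_strict infinity_ennreal_def[symmetric]])
    finally show "(\<integral>\<^sup>+x. ennreal (norm ((norm (f m x - g x))\<^sup>2)) \<partial>M) < \<infinity>" .
  qed measurable
  have g: "square_integrable M g"
    using square_integrable_diff[OF f[of "N 0"] fg[OF order_refl, of 0]] by simp
  moreover have "(\<lambda>n. l2_dist M (f n) g) \<longlonglongrightarrow> 0"
  proof (rule LIMSEQ_I)
    fix e :: real assume "e > 0"
    then obtain k where k: "(1/4::real) ^ k < e" using real_arch_pow_inv[of e "1/4"] by auto
    have "norm (l2_dist M (f n) g - 0) < e" if n: "n \<ge> N k" for n
    proof -
      have "ennreal (l2_dist M (f n) g) = (\<integral>\<^sup>+x. ennreal ((norm (f n x - g x))\<^sup>2) \<partial>M)"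
        unfolding l2_dist_def
        by (rule nn_integral_eq_integral[symmetric, OF integrable_norm_square[OF fg[OF n]]]) auto
      then have "ennreal (l2_dist M (f n) g) \<le> ennreal ((1/4) ^ k)" using dist_le[OF n] by (simp only:)
      then have "l2_dist M (f n) g \<le> (1/4) ^ k" by (subst (asm) ennreal_le_iff) auto
      then show ?thesis using k by (simp add: l2_dist_def)
    qed
    then show "\<exists>no. \<forall>n\<ge>no. norm (l2_dist M (f n) g - 0) < e" by blast
  qed
  ultimately show ?thesis using that by blast
qed

lemma square_integrable_vec:
  fixes G :: "'x \<Rightarrow> real^'n"
  assumes "\<And>i. square_integrable M (\<lambda>x. G x $ i)"
  shows "square_integrable M G"
proof (rule square_integrableI_bound)
  show "G \<in> borel_measurable M"
    using assms by (subst borel_measurable_euclidean_space) (auto simp: Basis_vec_def inner_axis square_integrable_def)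
  show "integrable M (\<lambda>x. \<Sum>i\<in>UNIV. (norm (G x $ i))\<^sup>2)"
    using assms by (auto simp: square_integrable_def)
  show "AE x in M. (norm (G x))\<^sup>2 \<le> (\<Sum>i\<in>UNIV. (norm (G x $ i))\<^sup>2)"
    by (simp add: norm_vec_def L2_set_def sum_nonneg)
qed

lemma square_integrable_vec_nth:
  fixes G :: "'x \<Rightarrow> real^'n"
  assumes "square_integrable M G"
  shows "square_integrable M (\<lambda>x. G x $ i)"
proof (rule square_integrableI_bound[OF _ integrable_norm_square[OF assms]])
  have "(\<lambda>x. G x \<bullet> axis i 1) \<in> borel_measurable M" using assms by measurable
  then show "(\<lambda>x. G x $ i) \<in> borel_measurable M" by (simp add: inner_axis)
  show "AE x in M. (norm (G x $ i))\<^sup>2 \<le> (norm (G x))\<^sup>2"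
    by (intro AE_I2 power_mono Finite_Cartesian_Product.norm_nth_le) auto
qed

lemma square_integrable_sum:
  fixes f :: "'i \<Rightarrow> 'x \<Rightarrow> 'b::euclidean_space"
  assumes "finite I" "\<And>i. i \<in> I \<Longrightarrow> square_integrable M (f i)"
  shows "square_integrable M (\<lambda>x. \<Sum>i\<in>I. f i x)"
  using assms
proof (induction I rule: finite_induct)
  case empty
  then show ?case by (simp add: square_integrable_def)
next
  case (insert i I)
  then show ?case using square_integrable_add[of M "f i" "\<lambda>x. \<Sum>i\<in>I. f i x"] by simp
qed

lemma l2_dist_diff_le:
  assumes "square_integrable M f" "square_integrable M f'" "square_integrable M g" "square_integrable M g'"
  shows "l2_dist M (\<lambda>x. f x - g x) (\<lambda>x. f' x - g' x) \<le> 2 * l2_dist M f f' + 2 * l2_dist M g g'"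
proof -
  have int: "integrable M (\<lambda>x. (norm (f x - f' x))\<^sup>2)" "integrable M (\<lambda>x. (norm (g x - g' x))\<^sup>2)"
    "integrable M (\<lambda>x. (norm (f x - g x - (f' x - g' x)))\<^sup>2)"
    using assms by (auto intro!: integrable_norm_square square_integrable_diff)
  have "(norm (a - b))\<^sup>2 \<le> 2 * (norm a)\<^sup>2 + 2 * (norm b)\<^sup>2" for a b :: 'b
    using norm_add_square_le[of a "- b"] by simp
  from this[of "f x - f' x" "g x - g' x" for x]
  have "l2_dist M (\<lambda>x. f x - g x) (\<lambda>x. f' x - g' x) \<le>
      (\<integral>x. 2 * (norm (f x - f' x))\<^sup>2 + 2 * (norm (g x - g' x))\<^sup>2 \<partial>M)"
    unfolding l2_dist_def using int by (intro integral_mono) (auto simp: algebra_simps)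
  also have "\<dots> = 2 * l2_dist M f f' + 2 * l2_dist M g g'" using int by (simp add: l2_dist_def)
  finally show ?thesis .
qed


section \<open>Differentiability of Lipschitz functions almost everywhere\<close>

text \<open>The intervals on which \<open>g\<close> has slope at most \<open>p\<close>, inside an open set slightly larger than \<open>E\<close>,
  form a Vitali cover of \<open>E\<close>. A disjoint subfamily covers \<open>E\<close> up to a null set, whose image is null since
  \<open>g\<close> is Lipschitz; the images of the chosen intervals are intervals of at most \<open>p\<close> times their length.\<close>
lemma emeasure_image_le_small_slopes:
  fixes g h :: "real \<Rightarrow> real"
  assumes lip: "K-lipschitz_on UNIV g" and mono: "strict_mono g" and surj: "surj g"
    and E: "E \<in> sets lebesgue" and p: "p > 0"
    and small: "\<And>x \<delta>. x \<in> E \<Longrightarrow> \<delta> > 0 \<Longrightarrow>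
      \<exists>y z. y \<le> x \<and> x \<le> z \<and> y < z \<and> z < y + \<delta> \<and> g z - g y \<le> p * (z - y)"
  shows "emeasure lebesgue (g ` E) \<le> ennreal p * emeasure lebesgue E"
proof (rule ennreal_le_epsilon)
  fix e :: real assume e: "e > 0"
  have img: "g ` {y..z} = {g y..g z}" for y z
  proof (intro equalityI subsetI)
    fix w assume w: "w \<in> {g y..g z}"
    obtain t where "w = g t" using surj by auto
    with w mono show "w \<in> g ` {y..z}" by (auto simp: strict_mono_less_eq)
  qed (use mono in \<open>auto simp: strict_mono_less_eq\<close>)
  obtain U where U: "open U" "E \<subseteq> U" "U - E \<in> lmeasurable" "emeasure lebesgue (U - E) < ennreal (e / p)"
    using sets_lebesgue_outer_open[OF E, of "e / p"] e p by auto
  define \<I> where "\<I> = {(y, z). y < z \<and> {y..z} \<subseteq> U \<and> g z - g y \<le> p * (z - y)}"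
  define a where "a = (\<lambda>(y::real, z). (y + z) / 2)"
  define r where "r = (\<lambda>(y::real, z). (z - y) / 2)"
  have ball: "cball (a i) (r i) = {fst i..snd i}" for i
    by (cases i) (auto simp: a_def r_def dist_real_def abs_le_iff field_simps)
  have rpos: "0 < r i" if "i \<in> \<I>" for i
    using that by (auto simp: \<I>_def r_def)
  have cover: "\<exists>i. i \<in> \<I> \<and> x \<in> cball (a i) (r i) \<and> r i < d" if x: "x \<in> E" and d: "0 < d" for x d
  proof -
    obtain \<eta> where \<eta>: "\<eta> > 0" "ball x \<eta> \<subseteq> U"
      using U x by (meson open_contains_ball subsetD)
    obtain y z where yz: "y \<le> x" "x \<le> z" "y < z" "z < y + min d \<eta>" "g z - g y \<le> p * (z - y)"
      using small[OF x, of "min d \<eta>"] d \<eta> by auto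
    have "{y..z} \<subseteq> ball x \<eta>"
      using yz by (auto simp: dist_real_def)
    then have "(y, z) \<in> \<I>" using \<eta> yz by (auto simp: \<I>_def)
    moreover have "x \<in> cball (a (y, z)) (r (y, z))" using yz by (simp add: ball)
    moreover have "r (y, z) < d" using yz d by (auto simp: r_def)
    ultimately show ?thesis by blast
  qed
  obtain C where C: "countable C" "C \<subseteq> \<I>"
    "pairwise (\<lambda>i j. disjnt (cball (a i) (r i)) (cball (a j) (r j))) C"
    "negligible (E - (\<Union>i\<in>C. cball (a i) (r i)))"
    by (rule Vitali_covering_theorem_cballs[of \<I> r E a], erule rpos, erule (1) cover, rule that)
  define N where "N = E - (\<Union>i\<in>C. {fst i..snd i})"
  have Nneg: "negligible (g ` N)"
  proof (rule negligible_locally_Lipschitz_image)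
    show "negligible N" using C(4) by (simp add: N_def ball)
    fix x show "\<exists>T B. open T \<and> x \<in> T \<and> (\<forall>y\<in>N \<inter> T. norm (g y - g x) \<le> B * norm (y - x))"
      using lipschitz_on_normD[OF lip] by (intro exI[of _ UNIV] exI[of _ K]) auto
  qed simp
  have inj: "inj g" using mono by (simp add: strict_mono_imp_inj_on)
  have disj: "disjoint_family_on (\<lambda>i. {fst i..snd i}) C"
    using C(3) by (auto simp: disjoint_family_on_def pairwise_def disjnt_def ball)
  have disj': "disjoint_family_on (\<lambda>i. {g (fst i)..g (snd i)}) C"
    unfolding img[symmetric] disjoint_family_on_def image_Int[OF inj, symmetric]
    using disj by (simp add: disjoint_family_on_def)
  have "emeasure lebesgue (g ` E) \<le> emeasure lebesgue ((\<Union>i\<in>C. {g (fst i)..g (snd i)}) \<union> g ` N)"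
  proof (rule emeasure_mono)
    show "g ` E \<subseteq> (\<Union>i\<in>C. {g (fst i)..g (snd i)}) \<union> g ` N"
      unfolding N_def img[symmetric] by blast
    show "(\<Union>i\<in>C. {g (fst i)..g (snd i)}) \<union> g ` N \<in> sets lebesgue"
      using C(1) negligible_imp_sets[OF Nneg] by (intro sets.Un sets.countable_UN') auto
  qed
  also have "\<dots> = emeasure lebesgue (\<Union>i\<in>C. {g (fst i)..g (snd i)})"
    using C(1) Nneg by (intro emeasure_Un_null_set sets.countable_UN') (auto simp: negligible_iff_null_sets)
  also have "\<dots> = (\<integral>\<^sup>+i. emeasure lebesgue {g (fst i)..g (snd i)} \<partial>count_space C)"
    using C(1) disj' by (intro emeasure_UN_countable) auto
  also have "\<dots> \<le> (\<integral>\<^sup>+i. ennreal p * emeasure lebesgue {fst i..snd i} \<partial>count_space C)"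
  proof (rule nn_integral_mono)
    fix i assume "i \<in> space (count_space C)"
    then have i: "fst i < snd i" "g (snd i) - g (fst i) \<le> p * (snd i - fst i)"
      using C(2) by (auto simp: \<I>_def)
    then have "g (fst i) \<le> g (snd i)" using mono by (simp add: strict_mono_less_eq)
    then show "emeasure lebesgue {g (fst i)..g (snd i)} \<le> ennreal p * emeasure lebesgue {fst i..snd i}"
      using i p by (simp add: ennreal_mult'[symmetric] ennreal_leI)
  qed
  also have "\<dots> = ennreal p * (\<integral>\<^sup>+i. emeasure lebesgue {fst i..snd i} \<partial>count_space C)"
    by (intro nn_integral_cmult) auto
  also have "(\<integral>\<^sup>+i. emeasure lebesgue {fst i..snd i} \<partial>count_space C) = emeasure lebesgue (\<Union>i\<in>C. {fst i..snd i})"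
    using C(1) disj by (intro emeasure_UN_countable[symmetric]) auto
  also have "\<dots> \<le> emeasure lebesgue U"
  proof (rule emeasure_mono)
    show "(\<Union>i\<in>C. {fst i..snd i}) \<subseteq> U"
      using C(2) unfolding \<I>_def by force
  qed (use U in auto)
  also have "emeasure lebesgue U = emeasure lebesgue E + emeasure lebesgue (U - E)"
    using U E by (subst plus_emeasure) (auto simp: Un_absorb1 fmeasurableD)
  also have "\<dots> \<le> emeasure lebesgue E + ennreal (e / p)"
    using U(4) by (intro add_left_mono) auto
  also have "ennreal p * (emeasure lebesgue E + ennreal (e / p)) = ennreal p * emeasure lebesgue E + ennreal e"
    using p e by (simp add: distrib_left ennreal_mult'[symmetric])
  finally show "emeasure lebesgue (g ` E) \<le> ennreal p * emeasure lebesgue E + ennreal e"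
    by (simp add: mult_left_mono)
qed

lemma frequently_at_0_real:
  "(\<exists>\<^sub>F h in at (0::real). P h) \<longleftrightarrow> (\<forall>\<delta>>0. \<exists>h. h \<noteq> 0 \<and> \<bar>h\<bar> < \<delta> \<and> P h)"
  by (auto simp: frequently_def eventually_at dist_real_def)

text \<open>Where slopes below \<open>p\<close> and above \<open>q\<close> both occur at arbitrarily small scale, the previous lemma
  applies to \<open>g\<close> with the constant \<open>p\<close> and to its inverse with the constant \<open>1 / q\<close>. Together they give
  \<open>q |E| \<le> |g(E)| \<le> p |E|\<close>, which forces \<open>|E| = 0\<close>.\<close>
lemma emeasure_oscillating_slopes_eq_0:
  fixes g :: "real \<Rightarrow> real"
  assumes lip: "K-lipschitz_on UNIV g" and pq: "p < q"
    and E: "E \<in> sets borel" "bounded E"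
    and low: "\<And>x. x \<in> E \<Longrightarrow> \<exists>\<^sub>F h in at 0. (g (x + h) - g x) / h < p"
    and high: "\<And>x. x \<in> E \<Longrightarrow> \<exists>\<^sub>F h in at 0. (g (x + h) - g x) / h > q"
  shows "emeasure lebesgue E = 0"
proof (cases "E = {}")
  case False
  have K: "K \<ge> 0" using lip by (rule lipschitz_on_nonneg)
  have lipD: "\<bar>g y - g x\<bar> \<le> K * \<bar>y - x\<bar>" for x y
    using lipschitz_on_normD[OF lip, of y x] by simp
  (* Adding a linear function makes all slopes lie in [1, 2K+1], so that G has a Lipschitz inverse. *)
  define G where "G x = g x + (K + 1) * x" for x
  have G_lower: "G y - G x \<ge> y - x" if "x \<le> y" for x y
    using lipD[of y x] that by (auto simp: G_def algebra_simps abs_if split: if_splits)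
  have G_upper: "\<bar>G y - G x\<bar> \<le> (2 * K + 1) * \<bar>y - x\<bar>" for x y
  proof -
    have "G y - G x = (g y - g x) + (K + 1) * (y - x)" by (simp add: G_def algebra_simps)
    also have "\<bar>\<dots>\<bar> \<le> K * \<bar>y - x\<bar> + (K + 1) * \<bar>y - x\<bar>"
      using lipD[of y x] K abs_triangle_ineq[of "g y - g x" "(K + 1) * (y - x)"] by (simp add: abs_mult)
    finally show ?thesis by (simp add: algebra_simps)
  qed
  have G_mono: "strict_mono G"
  proof (rule strict_monoI)
    fix x y :: real assume "x < y"
    then show "G x < G y" using G_lower[of x y] by linarith
  qed
  have G_lip: "(2 * K + 1)-lipschitz_on UNIV G"
    using G_upper K by (intro lipschitz_onI) (auto simp: dist_real_def)
  have G_surj: "surj G"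
  proof -
    have "\<exists>x. G x = y" for y
    proof -
      define b where "b = \<bar>y - G 0\<bar>"
      have "G (- b) \<le> y" "y \<le> G b"
        using G_lower[of 0 b] G_lower[of "- b" 0] by (auto simp: b_def)
      moreover have "continuous_on {-b..b} G"
        using lipschitz_on_continuous_on[OF G_lip] continuous_on_subset by blast
      ultimately show ?thesis using IVT'[of G "-b" y b] by (auto simp: b_def)
    qed
    then show ?thesis by (metis surj_def)
  qed
  define H where "H = inv G"
  have HG: "H (G x) = x" and GH: "G (H y) = y" for x y
    using G_mono G_surj by (auto simp: H_def strict_mono_imp_inj_on surj_f_inv_f)
  have H_mono: "strict_mono H"
    by (metis GH G_mono strict_mono_less strict_monoI)
  have H_lip: "1-lipschitz_on UNIV H"
  proof (rule lipschitz_on_leI)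
    fix x y :: real assume "x \<le> y"
    then have "H x \<le> H y" using H_mono by (simp add: strict_mono_less_eq)
    then show "dist (H x) (H y) \<le> 1 * dist x y"
      using G_lower[of "H x" "H y"] \<open>x \<le> y\<close> by (simp add: GH dist_real_def)
  qed simp
  have slope: "(G (x + h) - G x) / h = (g (x + h) - g x) / h + (K + 1)" if "h \<noteq> 0" for x h
    using that by (simp add: G_def field_simps)
  have slope_ge: "(G (x + h) - G x) / h \<ge> 1" if "h \<noteq> 0" for x h
    using G_lower[of x "x + h"] G_lower[of "x + h" x] that
    by (cases "h > 0") (auto simp: field_simps)
  define p' q' where "p' = p + (K + 1)" and "q' = q + (K + 1)"
  have p': "p' > 0"
  proof -
    obtain x where "x \<in> E" using False by auto
    then obtain h where "h \<noteq> 0" "(g (x + h) - g x) / h < p"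
      using low[of x] unfolding frequently_at_0_real by (metis zero_less_one)
    then show ?thesis using slope_ge[of h x] slope[of h x] by (simp add: p'_def)
  qed
  have q': "q' > 0" "p' < q'" using p' pq by (auto simp: p'_def q'_def)
  have HGE: "H ` G ` E = E" by (force simp: HG)
  have GE: "G ` E = H -` E" by (force simp: HG GH)
  have GE_le: "emeasure lebesgue (G ` E) \<le> ennreal p' * emeasure lebesgue E"
  proof (rule emeasure_image_le_small_slopes[OF G_lip G_mono G_surj _ p'])
    fix x \<delta> :: real assume "x \<in> E" "\<delta> > 0"
    then obtain h where h: "h \<noteq> 0" "\<bar>h\<bar> < \<delta>" "(g (x + h) - g x) / h < p"
      using low[of x] unfolding frequently_at_0_real by metis
    then have s: "(G (x + h) - G x) / h \<le> p'" using slope[of h x] by (simp add: p'_def)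
    show "\<exists>y z. y \<le> x \<and> x \<le> z \<and> y < z \<and> z < y + \<delta> \<and> G z - G y \<le> p' * (z - y)"
    proof (cases "h > 0")
      case True
      then show ?thesis using s h by (intro exI[of _ x] exI[of _ "x + h"]) (auto simp: field_simps)
    next
      case False
      then show ?thesis using s h by (intro exI[of _ "x + h"] exI[of _ x]) (auto simp: field_simps)
    qed
  qed (use E in auto)
  have fin: "emeasure lebesgue E < \<infinity>"
  proof -
    have "E \<in> lmeasurable" using E by (intro bounded_set_imp_lmeasurable) auto
    then show ?thesis by (auto simp: fmeasurable_def)
  qed
  have GE_sets: "G ` E \<in> sets lebesgue"
    unfolding GE
    using E(1) lipschitz_on_continuous_on[OF H_lip] borel_measurable_continuous_onI[of H]
      measurable_sets_borel[of H borel E] by auto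
  have E_le: "emeasure lebesgue (H ` G ` E) \<le> ennreal (1 / q') * emeasure lebesgue (G ` E)"
  proof (rule emeasure_image_le_small_slopes[OF H_lip H_mono _ GE_sets])
    show "surj H" by (metis HG surj_def)
    show "0 < 1 / q'" using q' by simp
    fix w \<delta> :: real assume "w \<in> G ` E" and d: "\<delta> > 0"
    then obtain x where x: "x \<in> E" "w = G x" by auto
    obtain h where h: "h \<noteq> 0" "\<bar>h\<bar> < \<delta> / (2 * K + 1)" "(g (x + h) - g x) / h > q"
      using high[OF x(1)] d K unfolding frequently_at_0_real
      by (metis add_nonneg_pos divide_pos_pos mult_nonneg_nonneg zero_le_numeral zero_less_one)
    then have s: "(G (x + h) - G x) / h \<ge> q'" using slope[of h x] by (simp add: q'_def)
    have small: "\<bar>G (x + h) - G x\<bar> < \<delta>"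
      using G_upper[of "x + h" x] h(2) K by (simp add: field_simps)
    show "\<exists>y z. y \<le> w \<and> w \<le> z \<and> y < z \<and> z < y + \<delta> \<and> H z - H y \<le> 1 / q' * (z - y)"
    proof (cases "h > 0")
      case True
      then have "G x < G (x + h)" using G_mono by (simp add: strict_mono_less)
      then show ?thesis using s h True small x(2) q'
        by (intro exI[of _ w] exI[of _ "G (x + h)"]) (auto simp: field_simps HG)
    next
      case False
      then have "G (x + h) < G x" using G_mono h(1) by (simp add: strict_mono_less)
      then show ?thesis using s h False small x(2) q'
        by (intro exI[of _ "G (x + h)"] exI[of _ w]) (auto simp: field_simps HG)
    qed
  qed
  define m where "m = measure lebesgue E"
  have m: "emeasure lebesgue E = ennreal m" "m \<ge> 0"
    using fin by (auto simp: m_def emeasure_eq_ennreal_measure)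
  have "ennreal m \<le> ennreal (1 / q') * (ennreal p' * ennreal m)"
    using E_le mult_left_mono[OF GE_le, of "ennreal (1 / q')"] unfolding HGE m by auto
  also have "\<dots> = ennreal (p' / q' * m)"
    using p' q' m(2) by (simp add: ennreal_mult'[symmetric])
  finally have "m \<le> p' / q' * m"
    using m(2) p' q' by (simp add: ennreal_le_iff)
  then have "m * (1 - p' / q') \<le> 0" by (simp add: algebra_simps)
  moreover have "1 - p' / q' > 0" using q' by simp
  ultimately have "m \<le> 0" by (simp add: mult_le_0_iff)
  then show ?thesis using m by (simp add: ennreal_neg)
qed simp

definition oscillation_set :: "('a::euclidean_space \<Rightarrow> real) \<Rightarrow> 'a \<Rightarrow> real \<Rightarrow> real \<Rightarrow> 'a set" where
  "oscillation_set f e p q =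
     {x. (\<exists>\<^sub>F h in at 0. (f (x + h *\<^sub>R e) - f x) / h < p) \<and>
         (\<exists>\<^sub>F h in at 0. (f (x + h *\<^sub>R e) - f x) / h > q)}"

text \<open>Only smallness of \<open>h\<close> has to be quantified over a countable family: the union over all admissible
  \<open>h\<close>, though uncountable, is open.\<close>
lemma borel_frequently_open:
  fixes P :: "real \<Rightarrow> 'a::euclidean_space \<Rightarrow> bool"
  assumes "\<And>h. h \<noteq> 0 \<Longrightarrow> open {x. P h x}"
  shows "{x. \<exists>\<^sub>F h in at 0. P h x} \<in> sets borel"
proof -
  have "{x. \<exists>\<^sub>F h in at 0. P h x} =
      (\<Inter>n. \<Union>h\<in>{h. h \<noteq> 0 \<and> \<bar>h\<bar> < inverse (real (Suc n))}. {x. P h x})" (is "?L = ?R")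
  proof (intro equalityI subsetI)
    fix x assume "x \<in> ?L"
    then have *: "\<And>\<delta>. \<delta> > 0 \<Longrightarrow> \<exists>h. h \<noteq> 0 \<and> \<bar>h\<bar> < \<delta> \<and> P h x"
      by (simp add: frequently_at_0_real)
    show "x \<in> ?R"
    proof
      fix n :: nat
      show "x \<in> (\<Union>h\<in>{h. h \<noteq> 0 \<and> \<bar>h\<bar> < inverse (real (Suc n))}. {x. P h x})"
        using *[of "inverse (real (Suc n))"] by auto
    qed
  next
    fix x assume x: "x \<in> ?R"
    have "\<exists>h. h \<noteq> 0 \<and> \<bar>h\<bar> < \<delta> \<and> P h x" if "\<delta> > 0" for \<delta>
    proof -
      obtain n where n: "inverse (real (Suc n)) < \<delta>" using reals_Archimedean[OF \<open>\<delta> > 0\<close>] by auto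
      obtain h where "h \<noteq> 0" "\<bar>h\<bar> < inverse (real (Suc n))" "P h x" using x by blast
      then show ?thesis using n by (intro exI[of _ h]) auto
    qed
    then show "x \<in> ?L" by (simp add: frequently_at_0_real)
  qed
  moreover have "open (\<Union>h\<in>{h. h \<noteq> 0 \<and> \<bar>h\<bar> < inverse (real (Suc n))}. {x. P h x})" for n
    using assms by (intro open_UN) auto
  ultimately show ?thesis by (auto intro!: sets.countable_INT')
qed

lemma oscillation_set_borel:
  assumes "continuous_on UNIV f"
  shows "oscillation_set f e p q \<in> sets borel"
proof -
  have [continuous_intros]: "continuous_on UNIV (\<lambda>x. f (x + h *\<^sub>R e))" for h
    by (rule continuous_on_compose2[OF assms]) (auto intro!: continuous_intros)
  have [continuous_intros]: "continuous_on UNIV (\<lambda>x. (f (x + h *\<^sub>R e) - f x) / h)" if "h \<noteq> 0" for h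
    using that assms by (intro continuous_intros) auto
  have "oscillation_set f e p q =
     {x. \<exists>\<^sub>F h in at 0. (f (x + h *\<^sub>R e) - f x) / h < p} \<inter>
     {x. \<exists>\<^sub>F h in at 0. (f (x + h *\<^sub>R e) - f x) / h > q}"
    by (auto simp: oscillation_set_def)
  also have "\<dots> \<in> sets borel"
    by (intro sets.Int borel_frequently_open open_Collect_less continuous_intros) auto
  finally show ?thesis .
qed

text \<open>By Tonelli the integral of \<open>\<lambda>(N - t e)\<close> over \<open>t \<in> [0, 1]\<close> is zero, and translation invariance
  makes this integral equal to \<open>\<lambda>(N)\<close>.\<close>
lemma null_sets_of_null_line_sections:
  fixes N :: "'a::euclidean_space set"
  assumes N: "N \<in> sets borel"
    and null: "\<And>x. emeasure lborel {t \<in> {0..1}. x + t *\<^sub>R e \<in> N} = 0"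
  shows "N \<in> null_sets lborel"
proof -
  note [measurable] = N
  have meas: "(\<lambda>(x, t). indicator {0..1} t * indicator N (x + t *\<^sub>R e) :: ennreal)
      \<in> borel_measurable (lborel \<Otimes>\<^sub>M lborel)"
    by measurable
  have shift: "(\<integral>\<^sup>+x. indicator N (x + t *\<^sub>R e) \<partial>lborel) = emeasure lborel N" for t
  proof -
    have "(\<integral>\<^sup>+x. indicator N (x + t *\<^sub>R e) \<partial>lborel) = (\<integral>\<^sup>+x. indicator N x \<partial>distr lborel borel ((+) (t *\<^sub>R e)))"
      by (subst nn_integral_distr) (auto simp: add.commute)
    then show ?thesis by (simp add: lborel_distr_plus)
  qed
  have "0 = (\<integral>\<^sup>+x. (\<integral>\<^sup>+t. indicator {0..1} t * indicator N (x + t *\<^sub>R e) \<partial>lborel) \<partial>lborel)"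
  proof -
    have "(\<integral>\<^sup>+t. indicator {0..1} t * indicator N (x + t *\<^sub>R e) \<partial>lborel) = 0" for x
    proof -
      have "(\<integral>\<^sup>+t. indicator {0..1} t * indicator N (x + t *\<^sub>R e) \<partial>lborel)
          = (\<integral>\<^sup>+t. indicator {t \<in> {0..1}. x + t *\<^sub>R e \<in> N} t \<partial>lborel)"
        by (intro nn_integral_cong) (auto split: split_indicator)
      also have "\<dots> = emeasure lborel {t \<in> {0..1}. x + t *\<^sub>R e \<in> N}"
        by (intro nn_integral_indicator) measurable
      finally show ?thesis using null by simp
    qed
    then show ?thesis by simp
  qed
  also have "\<dots> = (\<integral>\<^sup>+t. (\<integral>\<^sup>+x. indicator {0..1} t * indicator N (x + t *\<^sub>R e) \<partial>lborel) \<partial>lborel)"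
    by (rule lborel_pair.Fubini'[OF meas, symmetric])
  also have "\<dots> = (\<integral>\<^sup>+t. indicator {0..1::real} t * emeasure lborel N \<partial>lborel)"
    by (intro nn_integral_cong) (simp add: nn_integral_cmult shift)
  also have "\<dots> = emeasure lborel N"
    by (simp add: nn_integral_multc)
  finally show ?thesis using N by (simp add: null_sets_def)
qed

lemma oscillation_set_null:
  fixes f :: "'a::euclidean_space \<Rightarrow> real"
  assumes lip: "K-lipschitz_on UNIV f" and pq: "p < q"
  shows "oscillation_set f e p q \<in> null_sets lborel"
proof (rule null_sets_of_null_line_sections)
  show N: "oscillation_set f e p q \<in> sets borel"
    by (rule oscillation_set_borel[OF lipschitz_on_continuous_on[OF lip]])
  note [measurable] = N
  fix x
  let ?E = "{t \<in> {0..1}. x + t *\<^sub>R e \<in> oscillation_set f e p q}"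
  define g where "g t = f (x + t *\<^sub>R e)" for t
  have g_lip: "(K * norm e)-lipschitz_on UNIV g"
  proof (rule lipschitz_onI)
    fix s t :: real
    have "dist (g s) (g t) \<le> K * dist (x + s *\<^sub>R e) (x + t *\<^sub>R e)"
      unfolding g_def by (rule lipschitz_onD[OF lip]) auto
    also have "dist (x + s *\<^sub>R e) (x + t *\<^sub>R e) = norm e * dist s t"
      by (simp add: dist_norm flip: scaleR_diff_left)
    finally show "dist (g s) (g t) \<le> K * norm e * dist s t" by (simp add: mult.assoc)
  qed (use lipschitz_on_nonneg[OF lip] in auto)
  have E: "?E \<in> sets borel" by measurable
  have bdd: "bounded ?E" by (rule bounded_subset[of "{0..1}"]) auto
  have slope: "(g (t + h) - g t) / h = (f (x + t *\<^sub>R e + h *\<^sub>R e) - f (x + t *\<^sub>R e)) / h" for t h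
    by (simp add: g_def algebra_simps)
  have "emeasure lebesgue ?E = 0"
    by (rule emeasure_oscillating_slopes_eq_0[OF g_lip pq E bdd])
      (simp_all only: slope oscillation_set_def mem_Collect_eq)
  then show "emeasure lborel ?E = 0" using E by simp
qed

text \<open>The limit is the lower limit \<open>Sup {p. eventually p \<le> s}\<close>. If \<open>s\<close> frequently exceeded some rational \<open>q\<close>
  above it, then any rational \<open>p\<close> in between would give an oscillation.\<close>
lemma convergent_of_no_rational_oscillation:
  fixes s :: "'b \<Rightarrow> real"
  assumes F: "F \<noteq> bot" and bdd: "\<And>h. \<bar>s h\<bar> \<le> M"
    and no_osc: "\<And>p q. p \<in> \<rat> \<Longrightarrow> q \<in> \<rat> \<Longrightarrow> p < q \<Longrightarrow>
        \<not> ((\<exists>\<^sub>F h in F. s h < p) \<and> (\<exists>\<^sub>F h in F. s h > q))"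
  shows "\<exists>D. (s \<longlongrightarrow> D) F"
proof -
  define L where "L = {p. \<forall>\<^sub>F h in F. p \<le> s h}"
  have "- M \<le> s h" for h using bdd[of h] by linarith
  then have ne: "- M \<in> L" by (simp add: L_def)
  have bd: "bdd_above L"
  proof (rule bdd_aboveI)
    fix p assume "p \<in> L"
    then have "\<forall>\<^sub>F h in F. p \<le> s h" by (simp add: L_def)
    then obtain h where "p \<le> s h" using F eventually_happens by blast
    then show "p \<le> M" using bdd[of h] by linarith
  qed
  have "(s \<longlongrightarrow> Sup L) F"
  proof (rule order_tendstoI)
    fix a assume "a < Sup L"
    then obtain p where "p \<in> L" "a < p" using less_cSup_iff[of L a] ne bd by blast
    then show "\<forall>\<^sub>F h in F. a < s h" by (auto simp: L_def elim: eventually_mono)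
  next
    fix a assume "Sup L < a"
    then obtain q where q: "q \<in> \<rat>" "Sup L < q" "q < a" using Rats_dense_in_real by blast
    then obtain p where p: "p \<in> \<rat>" "Sup L < p" "p < q" using Rats_dense_in_real by blast
    have "p \<notin> L" using p cSup_upper[OF _ bd] by force
    then have "\<exists>\<^sub>F h in F. s h < p"
      by (auto simp: L_def frequently_def not_less)
    then have "\<forall>\<^sub>F h in F. s h \<le> q"
      using no_osc[OF p(1) q(1) p(3)] by (auto simp: frequently_def not_less)
    then show "\<forall>\<^sub>F h in F. s h < a" using q(3) by (auto elim: eventually_mono)
  qed
  then show ?thesis by blast
qed

lemma lipschitz_AE_directional_derivative:
  fixes f :: "'a::euclidean_space \<Rightarrow> real"
  assumes lip: "K-lipschitz_on UNIV f"
  shows "AE x in lborel. \<exists>D. ((\<lambda>t. f (x + t *\<^sub>R e)) has_real_derivative D) (at 0)"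
proof -
  have "AE x in lborel. \<forall>p\<in>\<rat>. \<forall>q\<in>\<rat>. p < q \<longrightarrow> x \<notin> oscillation_set f e p q"
    using oscillation_set_null[OF lip] by (simp add: AE_ball_countable countable_rat AE_not_in)
  then show ?thesis
  proof (rule AE_mp, intro AE_I2 impI)
    fix x assume x: "\<forall>p\<in>\<rat>. \<forall>q\<in>\<rat>. p < q \<longrightarrow> x \<notin> oscillation_set f e p q"
    have "\<exists>D. ((\<lambda>h. (f (x + h *\<^sub>R e) - f x) / h) \<longlongrightarrow> D) (at 0)"
    proof (rule convergent_of_no_rational_oscillation)
      fix h :: real
      show "\<bar>(f (x + h *\<^sub>R e) - f x) / h\<bar> \<le> K * norm e"
        using lipschitz_on_normD[OF lip, of "x + h *\<^sub>R e" x] lipschitz_on_nonneg[OF lip]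
        by (cases "h = 0") (auto simp: field_simps abs_divide)
    qed (use x in \<open>auto simp: oscillation_set_def\<close>)
    then show "\<exists>D. ((\<lambda>t. f (x + t *\<^sub>R e)) has_real_derivative D) (at 0)"
      by (simp add: DERIV_def)
  qed
qed

text \<open>At other points \<^const>\<open>partial_deriv\<close> has an unspecified value.\<close>
definition partially_differentiable_at :: "(real^'n \<Rightarrow> real) \<Rightarrow> real^'n \<Rightarrow> bool" where
  "partially_differentiable_at f x \<longleftrightarrow>
     (\<forall>j. ((\<lambda>t. f (x + t *\<^sub>R axis j 1)) has_real_derivative partial_deriv j f x) (at 0))"

lemma partially_differentiable_atD:
  "partially_differentiable_at f x \<Longrightarrow>
     ((\<lambda>t. f (x + t *\<^sub>R axis j 1)) has_real_derivative partial_deriv j f x) (at 0)"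
  by (simp add: partially_differentiable_at_def)

lemma partial_deriv_eqI:
  "((\<lambda>t. f (x + t *\<^sub>R axis j 1)) has_real_derivative D) (at 0) \<Longrightarrow> partial_deriv j f x = D"
  unfolding partial_deriv_def by (rule DERIV_imp_deriv)

lemma lipschitz_AE_partially_differentiable:
  assumes lip: "K-lipschitz_on UNIV f"
  shows "AE x in lebesgue. partially_differentiable_at f x"
proof -
  have "AE x in lborel. \<forall>j. \<exists>D. ((\<lambda>t. f (x + t *\<^sub>R axis j 1)) has_real_derivative D) (at 0)"
    using lipschitz_AE_directional_derivative[OF lip] by (intro AE_finite_allI[of UNIV, simplified]) auto
  then have "AE x in lborel. partially_differentiable_at f x"
    by (rule AE_mp) (auto simp: partially_differentiable_at_def dest: partial_deriv_eqI)
  then show ?thesis by (rule AE_completion)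
qed

lemma partial_deriv_bounded:
  assumes lip: "K-lipschitz_on UNIV f" and "partially_differentiable_at f x"
  shows "\<bar>partial_deriv j f x\<bar> \<le> K"
proof -
  have "((\<lambda>h. (f (x + h *\<^sub>R axis j 1) - f x) / h) \<longlongrightarrow> partial_deriv j f x) (at 0)"
    using partially_differentiable_atD[OF assms(2), of j] by (simp add: DERIV_def)
  then have "((\<lambda>h. \<bar>(f (x + h *\<^sub>R axis j 1) - f x) / h\<bar>) \<longlongrightarrow> \<bar>partial_deriv j f x\<bar>) (at 0)"
    by (rule tendsto_rabs)
  moreover have "\<bar>(f (x + h *\<^sub>R axis j 1) - f x) / h\<bar> \<le> K" for h
    using lipschitz_on_normD[OF lip, of "x + h *\<^sub>R axis j 1" x] lipschitz_on_nonneg[OF lip]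
    by (cases "h = 0") (auto simp: field_simps abs_divide norm_axis_1)
  ultimately show ?thesis
    by (intro tendsto_upperbound[of "\<lambda>h. \<bar>(f (x + h *\<^sub>R axis j 1) - f x) / h\<bar>" _ "at 0"]) auto
qed

definition diff_quot :: "'n \<Rightarrow> (real^'n \<Rightarrow> real) \<Rightarrow> nat \<Rightarrow> real^'n \<Rightarrow> real" where
  "diff_quot j f n x = (f (x + inverse (real (Suc n)) *\<^sub>R axis j 1) - f x) / inverse (real (Suc n))"

lemma diff_quot_tendsto:
  assumes "partially_differentiable_at f x"
  shows "(\<lambda>n. diff_quot j f n x) \<longlonglongrightarrow> partial_deriv j f x"
proof -
  have "((\<lambda>h. (f (x + h *\<^sub>R axis j 1) - f x) / h) \<longlongrightarrow> partial_deriv j f x) (at 0)"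
    using partially_differentiable_atD[OF assms, of j] by (simp add: DERIV_def)
  moreover have "filterlim (\<lambda>n. inverse (real (Suc n))) (at 0) sequentially"
    using LIMSEQ_inverse_real_of_nat by (auto simp: filterlim_at)
  ultimately show ?thesis unfolding diff_quot_def by (rule filterlim_compose)
qed

lemma diff_quot_borel:
  assumes lip: "K-lipschitz_on UNIV f"
  shows "diff_quot j f n \<in> borel_measurable borel"
proof -
  have c: "continuous_on UNIV f" by (rule lipschitz_on_continuous_on[OF lip])
  have "continuous_on UNIV (\<lambda>x. f (x + inverse (real (Suc n)) *\<^sub>R axis j 1))"
    by (rule continuous_on_compose2[OF c]) (auto intro!: continuous_intros)
  then show ?thesis
    unfolding diff_quot_def using c by (intro borel_measurable_continuous_onI continuous_intros) auto
qed

text \<open>Almost everywhere the partial derivative is a limit of continuous difference quotients.\<close>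
lemma partial_deriv_measurable:
  assumes lip: "K-lipschitz_on UNIV f"
  shows "partial_deriv j f \<in> borel_measurable lebesgue"
proof (rule borel_measurable_AE)
  show "(\<lambda>x. lim (\<lambda>n. diff_quot j f n x)) \<in> borel_measurable lebesgue"
    using diff_quot_borel[OF lip] by (intro borel_measurable_lim_metric measurable_completion) auto
  show "AE x in lebesgue. lim (\<lambda>n. diff_quot j f n x) = partial_deriv j f x"
    using lipschitz_AE_partially_differentiable[OF lip]
    by (rule AE_mp) (auto intro!: AE_I2 limI diff_quot_tendsto)
qed

text \<open>Difference quotients have integral zero by translation invariance, and they converge boundedly to the
  partial derivative, all supported in a common ball.\<close>
lemma integral_partial_deriv_eq_0:
  fixes f :: "real^'n \<Rightarrow> real"
  assumes lip: "K-lipschitz_on UNIV f" and bdd: "bounded {x. f x \<noteq> 0}"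
  shows "(\<integral>x. partial_deriv j f x \<partial>lebesgue) = 0"
proof -
  obtain R where R: "\<And>x. f x \<noteq> 0 \<Longrightarrow> norm x \<le> R" using bdd by (auto simp: bounded_iff)
  have K: "K \<ge> 0" by (rule lipschitz_on_nonneg[OF lip])
  have cont: "continuous_on UNIV f" by (rule lipschitz_on_continuous_on[OF lip])
  have "integrable lborel (\<lambda>x. indicator (cball 0 R) x *\<^sub>R f x)"
    using continuous_on_subset[OF cont] by (intro borel_integrable_compact) auto
  moreover have "(\<lambda>x. indicator (cball 0 R) x *\<^sub>R f x) = f"
    using R by (auto simp: fun_eq_iff split: split_indicator)
  ultimately have int: "integrable lborel f" by simp
  have shift: "integrable lborel (\<lambda>x. f (x + c))" "(\<integral>x. f (x + c) \<partial>lborel) = (\<integral>x. f x \<partial>lborel)" for c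
  proof -
    have "integrable (distr lborel borel ((+) c)) f" using int by (simp add: lborel_distr_plus)
    then show "integrable lborel (\<lambda>x. f (x + c))"
      by (subst (asm) integrable_distr_eq) (use int in \<open>auto simp: add.commute\<close>)
    have "(\<integral>x. f x \<partial>lborel) = (\<integral>x. f x \<partial>distr lborel borel ((+) c))" by (simp add: lborel_distr_plus)
    also have "\<dots> = (\<integral>x. f (c + x) \<partial>lborel)"
      using int by (subst integral_distr) auto
    finally show "(\<integral>x. f (x + c) \<partial>lborel) = (\<integral>x. f x \<partial>lborel)" by (simp add: add.commute)
  qed
  have zero: "(\<integral>x. diff_quot j f n x \<partial>lebesgue) = 0" for n
  proof -
    have "(\<integral>x. diff_quot j f n x \<partial>lebesgue) = (\<integral>x. diff_quot j f n x \<partial>lborel)"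
      using diff_quot_borel[OF lip] by (intro integral_completion) auto
    also have "\<dots> = 0"
      unfolding diff_quot_def integral_divide_zero
      by (subst Bochner_Integration.integral_diff) (auto simp: shift int)
    finally show ?thesis .
  qed
  have "(\<lambda>n. \<integral>x. diff_quot j f n x \<partial>lebesgue) \<longlonglongrightarrow> (\<integral>x. partial_deriv j f x \<partial>lebesgue)"
  proof (rule integral_dominated_convergence[where w = "\<lambda>x. K * indicator (cball 0 (R + 1)) x"])
    show "AE x in lebesgue. (\<lambda>n. diff_quot j f n x) \<longlonglongrightarrow> partial_deriv j f x"
      using lipschitz_AE_partially_differentiable[OF lip] by (rule AE_mp) (auto intro!: AE_I2 diff_quot_tendsto)
    show "integrable lebesgue (\<lambda>x::real^'n. K * indicator (cball 0 (R + 1)) x)"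
      by (intro integrable_mult_right integrable_real_indicator) (use emeasure_bounded_finite[of "cball (0::real^'n) (R + 1)"] in auto)
    show "AE x in lebesgue. norm (diff_quot j f n x) \<le> K * indicator (cball 0 (R + 1)) x" for n
    proof (rule AE_I2)
      fix x :: "real^'n"
      define h where "h = inverse (real (Suc n))"
      have h: "0 < h" "h \<le> 1" by (auto simp: h_def field_simps)
      let ?y = "x + h *\<^sub>R axis j 1"
      have "\<bar>f ?y - f x\<bar> \<le> K * h"
        using lipschitz_on_normD[OF lip, of ?y x] h by (simp add: norm_axis_1)
      then have le: "\<bar>diff_quot j f n x\<bar> \<le> K"
        using h unfolding diff_quot_def h_def[symmetric] by (simp add: abs_divide field_simps)
      show "norm (diff_quot j f n x) \<le> K * indicator (cball 0 (R + 1)) x"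
      proof (cases "norm x \<le> R + 1")
        case True then show ?thesis using le by simp
      next
        case False
        (* Outside the ball of radius R + 1 both points of the quotient lie outside the support. *)
        have "norm x \<le> norm ?y + norm (h *\<^sub>R (axis j 1 :: real^'n))"
          using norm_triangle_ineq4[of ?y "h *\<^sub>R axis j 1"] by simp
        then have "norm ?y > R" using False h by (simp add: norm_axis_1)
        then have "f ?y = 0" "f x = 0" using False R[of ?y] R[of x] by auto
        then show ?thesis using K by (simp add: diff_quot_def h_def)
      qed
    qed
  qed (use partial_deriv_measurable[OF lip] diff_quot_borel[OF lip] in \<open>auto intro: measurable_completion\<close>)
  then show ?thesis unfolding zero using LIMSEQ_unique tendsto_const by blast
qed

section \<open>Lipschitz functions with compact support\<close>

lemma Lip_cI:
  assumes "K-lipschitz_on UNIV \<psi>" "compact C" "C \<subseteq> \<Omega>" "\<And>x. x \<notin> C \<Longrightarrow> \<psi> x = 0"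
  shows "\<psi> \<in> Lip_c \<Omega>"
proof -
  have "closure {x. \<psi> x \<noteq> 0} \<subseteq> C"
    using assms by (intro closure_minimal) (auto simp: compact_imp_closed)
  moreover from this have "compact (closure {x. \<psi> x \<noteq> 0})"
    using assms(2) compact_closure bounded_subset compact_imp_bounded closure_subset by (metis subset_trans)
  ultimately show ?thesis using assms by (auto simp: Lip_c_def)
qed

lemma Lip_cE:
  assumes "\<psi> \<in> Lip_c \<Omega>"
  obtains K C where "K-lipschitz_on UNIV \<psi>" "compact C" "C \<subseteq> \<Omega>" "\<forall>x. x \<notin> C \<longrightarrow> \<psi> x = 0"
proof -
  obtain K where K: "K-lipschitz_on UNIV \<psi>" using assms by (auto simp: Lip_c_def)
  have zero: "\<forall>x. x \<notin> closure {x. \<psi> x \<noteq> 0} \<longrightarrow> \<psi> x = 0"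
    using closure_subset[of "{x. \<psi> x \<noteq> 0}"] by blast
  have C: "compact (closure {x. \<psi> x \<noteq> 0})" "closure {x. \<psi> x \<noteq> 0} \<subseteq> \<Omega>"
    using assms by (auto simp: Lip_c_def)
  show ?thesis by (rule that[OF K C zero])
qed

lemma Lip_c_lipschitz: "\<psi> \<in> Lip_c \<Omega> \<Longrightarrow> \<exists>K. K-lipschitz_on UNIV \<psi>"
  by (auto simp: Lip_c_def)

lemma Lip_c_continuous: "\<psi> \<in> Lip_c \<Omega> \<Longrightarrow> continuous_on UNIV \<psi>"
  using Lip_c_lipschitz lipschitz_on_continuous_on by blast

lemma Lip_c_outside: "\<psi> \<in> Lip_c \<Omega> \<Longrightarrow> x \<notin> \<Omega> \<Longrightarrow> \<psi> x = 0"
  by (metis Lip_cE subsetD)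

lemma Lip_c_bounded:
  assumes "\<psi> \<in> Lip_c \<Omega>"
  obtains b where "b \<ge> 0" "\<And>x. \<bar>\<psi> x\<bar> \<le> b"
proof -
  obtain K C where C: "K-lipschitz_on UNIV \<psi>" "compact C" "C \<subseteq> \<Omega>" "\<forall>x. x \<notin> C \<longrightarrow> \<psi> x = 0"
    using assms by (rule Lip_cE)
  have "compact (\<psi> ` C)"
    using continuous_on_subset[OF lipschitz_on_continuous_on[OF C(1)]] C(2)
    by (intro compact_continuous_image) auto
  then obtain b where b: "\<forall>x\<in>C. norm (\<psi> x) \<le> b"
    by (auto dest!: compact_imp_bounded simp: bounded_iff)
  have "\<bar>\<psi> x\<bar> \<le> max 0 b" for x
    using b C(4) by (cases "x \<in> C") force+
  then show ?thesis using that[of "max 0 b"] by simp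
qed

lemma Lip_c_zero: "(\<lambda>x. 0) \<in> Lip_c \<Omega>"
  by (rule Lip_cI[of 0 _ "{}"]) (auto intro: lipschitz_on_constant)

lemma Lip_c_compose:
  fixes g :: "real \<Rightarrow> real"
  assumes "\<psi> \<in> Lip_c \<Omega>" "L-lipschitz_on UNIV g" "g 0 = 0"
  shows "(\<lambda>x. g (\<psi> x)) \<in> Lip_c \<Omega>"
proof -
  obtain K C where C: "K-lipschitz_on UNIV \<psi>" "compact C" "C \<subseteq> \<Omega>" "\<forall>x. x \<notin> C \<longrightarrow> \<psi> x = 0"
    using assms(1) by (rule Lip_cE)
  have "(L * K)-lipschitz_on UNIV (\<lambda>x. g (\<psi> x))"
    using C(1) assms(2) by (intro lipschitz_on_compose2) (auto intro: lipschitz_on_subset)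
  then show ?thesis using C assms(3) by (intro Lip_cI[of _ _ C]) auto
qed

lemma Lip_c_scale: "\<psi> \<in> Lip_c \<Omega> \<Longrightarrow> (\<lambda>x. c * \<psi> x) \<in> Lip_c \<Omega>"
  by (rule Lip_c_compose[of \<psi> _ "\<bar>c\<bar>" "\<lambda>t. c * t"])
    (auto intro!: lipschitz_onI simp: dist_real_def abs_mult simp flip: right_diff_distrib)

lemma Lip_c_add:
  assumes "\<psi> \<in> Lip_c \<Omega>" "\<eta> \<in> Lip_c \<Omega>"
  shows "(\<lambda>x. \<psi> x + \<eta> x) \<in> Lip_c \<Omega>"
proof -
  obtain K C where C: "K-lipschitz_on UNIV \<psi>" "compact C" "C \<subseteq> \<Omega>" "\<forall>x. x \<notin> C \<longrightarrow> \<psi> x = 0"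
    using assms(1) by (rule Lip_cE)
  obtain K' C' where C': "K'-lipschitz_on UNIV \<eta>" "compact C'" "C' \<subseteq> \<Omega>" "\<forall>x. x \<notin> C' \<longrightarrow> \<eta> x = 0"
    using assms(2) by (rule Lip_cE)
  have "(K + K')-lipschitz_on UNIV (\<lambda>x. \<psi> x + \<eta> x)" using C C' by (intro lipschitz_on_add)
  then show ?thesis using C C' by (intro Lip_cI[of _ _ "C \<union> C'"]) auto
qed

lemma Lip_c_diff:
  "\<psi> \<in> Lip_c \<Omega> \<Longrightarrow> \<eta> \<in> Lip_c \<Omega> \<Longrightarrow> (\<lambda>x. \<psi> x - \<eta> x) \<in> Lip_c \<Omega>"
  using Lip_c_add[of \<psi> \<Omega> "\<lambda>x. (-1) * \<eta> x"] Lip_c_scale[of \<eta> \<Omega> "-1"] by simp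

lemma Lip_c_min:
  assumes "k \<ge> 0" "\<psi> \<in> Lip_c \<Omega>"
  shows "(\<lambda>x. min (\<psi> x) k) \<in> Lip_c \<Omega>"
proof (rule Lip_c_compose[OF assms(2), of 1 "\<lambda>t. min t k"])
  show "1-lipschitz_on UNIV (\<lambda>t. min t k)"
    by (rule lipschitz_onI) (auto simp: dist_real_def min_def)
qed (use assms in auto)

lemma Lip_c_max:
  assumes "k \<ge> 0" "\<psi> \<in> Lip_c \<Omega>"
  shows "(\<lambda>x. max 0 (\<psi> x - k)) \<in> Lip_c \<Omega>"
proof (rule Lip_c_compose[OF assms(2), of 1 "\<lambda>t. max 0 (t - k)"])
  show "1-lipschitz_on UNIV (\<lambda>t. max 0 (t - k))"
    by (rule lipschitz_onI) (auto simp: dist_real_def max_def)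
qed (use assms in auto)

text \<open>The factor \<open>a\<close> is only Lipschitz on \<open>\<Omega>\<close>. The compact support of \<open>\<psi>\<close> makes the
  product Lipschitz on the whole space: across \<open>\<partial>\<Omega>\<close> one of the two values is \<open>0\<close>.\<close>
lemma Lip_c_mult_lipschitz_on:
  fixes a :: "real^'n \<Rightarrow> real"
  assumes \<psi>: "\<psi> \<in> Lip_c \<Omega>" and a: "L-lipschitz_on \<Omega> a" and bdd: "\<And>x. x \<in> \<Omega> \<Longrightarrow> \<bar>a x\<bar> \<le> m"
  shows "(\<lambda>x. a x * \<psi> x) \<in> Lip_c \<Omega>"
proof -
  obtain K C where C: "K-lipschitz_on UNIV \<psi>" "compact C" "C \<subseteq> \<Omega>" "\<forall>x. x \<notin> C \<longrightarrow> \<psi> x = 0"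
    using \<psi> by (rule Lip_cE)
  obtain b where b: "b \<ge> 0" "\<And>x. \<bar>\<psi> x\<bar> \<le> b" using \<psi> by (rule Lip_c_bounded) blast
  have K: "K \<ge> 0" and L: "L \<ge> 0" using C(1) a by (auto intro: lipschitz_on_nonneg)
  have \<psi>_lip: "\<bar>\<psi> x - \<psi> y\<bar> \<le> K * norm (x - y)" for x y
    using lipschitz_on_normD[OF C(1), of x y] by simp
  define m' where "m' = max 0 m"
  have m': "m' \<ge> 0" "\<And>x. x \<in> \<Omega> \<Longrightarrow> \<bar>a x\<bar> \<le> m'" using bdd by (force simp: m'_def)+
  have one: "\<bar>a x * \<psi> x - a y * \<psi> y\<bar> \<le> (m' * K + L * b) * norm (x - y)" if x: "x \<in> \<Omega>" for x y
  proof (cases "y \<in> \<Omega>")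
    case True
    (* Only a on \<Omega> is controlled, so both arguments of a must lie there. *)
    have "a x * \<psi> x - a y * \<psi> y = a x * (\<psi> x - \<psi> y) + (a x - a y) * \<psi> y" by (simp add: algebra_simps)
    also have "\<bar>\<dots>\<bar> \<le> \<bar>a x\<bar> * \<bar>\<psi> x - \<psi> y\<bar> + \<bar>a x - a y\<bar> * \<bar>\<psi> y\<bar>"
      by (metis abs_mult abs_triangle_ineq)
    also have "\<dots> \<le> m' * (K * norm (x - y)) + (L * norm (x - y)) * b"
      using m' b L x True \<psi>_lip[of x y] lipschitz_on_normD[OF a x True]
      by (intro add_mono mult_mono) auto
    finally show ?thesis by (simp add: algebra_simps)
  next
    case False
    have "\<psi> y = 0" by (rule Lip_c_outside[OF \<psi> False])
    then have "\<bar>a x * \<psi> x - a y * \<psi> y\<bar> = \<bar>a x\<bar> * \<bar>\<psi> x - \<psi> y\<bar>" by (simp add: abs_mult)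
    also have "\<dots> \<le> m' * (K * norm (x - y))" using m' x \<psi>_lip[of x y] by (intro mult_mono) auto
    also have "\<dots> \<le> (m' * K + L * b) * norm (x - y)" using L b by (simp add: algebra_simps)
    finally show ?thesis .
  qed
  have "(m' * K + L * b)-lipschitz_on UNIV (\<lambda>x. a x * \<psi> x)"
  proof (rule lipschitz_onI)
    fix x y :: "real^'n"
    show "dist (a x * \<psi> x) (a y * \<psi> y) \<le> (m' * K + L * b) * dist x y"
    proof (cases "x \<in> \<Omega> \<or> y \<in> \<Omega>")
      case True
      then show ?thesis
        using one[of x y] one[of y x] by (auto simp: dist_norm norm_minus_commute abs_minus_commute)
    next
      case False
      then have "\<psi> x = 0" "\<psi> y = 0" using Lip_c_outside[OF \<psi>] by auto
      then show ?thesis using m' K L b by simp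
    qed
  qed (use m' K L b in auto)
  then show ?thesis using C by (intro Lip_cI[of _ _ C]) auto
qed

lemma Lip_c_mult:
  assumes "\<psi> \<in> Lip_c \<Omega>" "\<eta> \<in> Lip_c \<Omega>"
  shows "(\<lambda>x. \<psi> x * \<eta> x) \<in> Lip_c \<Omega>"
proof -
  obtain K where "K-lipschitz_on UNIV \<psi>" using assms(1) Lip_c_lipschitz by blast
  then have "K-lipschitz_on \<Omega> \<psi>" by (rule lipschitz_on_subset) simp
  moreover obtain b where "\<And>x. \<bar>\<psi> x\<bar> \<le> b" using assms(1) by (rule Lip_c_bounded) blast
  ultimately show ?thesis using assms(2) Lip_c_mult_lipschitz_on by blast
qed

lemma Lip_c_AE_differentiable:
  "\<psi> \<in> Lip_c \<Omega> \<Longrightarrow> AE x in lebesgue. partially_differentiable_at \<psi> x"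
  using Lip_c_lipschitz lipschitz_AE_partially_differentiable by blast

lemma Lip_c_partial_deriv_measurable:
  "\<psi> \<in> Lip_c \<Omega> \<Longrightarrow> partial_deriv j \<psi> \<in> borel_measurable lebesgue"
  using Lip_c_lipschitz partial_deriv_measurable by blast

lemma Lip_c_partial_deriv_bounded:
  assumes "\<psi> \<in> Lip_c \<Omega>"
  obtains K where "K \<ge> 0" "AE x in lebesgue. \<forall>j. \<bar>partial_deriv j \<psi> x\<bar> \<le> K"
proof -
  obtain K where K: "K-lipschitz_on UNIV \<psi>" using Lip_c_lipschitz[OF assms] by blast
  have "AE x in lebesgue. \<forall>j. \<bar>partial_deriv j \<psi> x\<bar> \<le> K"
    using lipschitz_AE_partially_differentiable[OF K]
    by (rule eventually_mono) (auto intro: partial_deriv_bounded[OF K])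
  then show ?thesis using that lipschitz_on_nonneg[OF K] by blast
qed

text \<open>This lets integrals over \<open>\<Omega>\<close> be computed on the whole space, also at points of \<open>\<partial>\<Omega>\<close>: the support is a
  compact subset of \<open>\<Omega>\<close>, so \<open>\<psi>\<close> vanishes near every such point.\<close>
lemma partial_deriv_outside_support:
  assumes "\<psi> \<in> Lip_c \<Omega>" "x \<notin> \<Omega>"
  shows "partial_deriv j \<psi> x = 0"
proof (rule partial_deriv_eqI)
  let ?U = "- closure {x. \<psi> x \<noteq> 0}"
  have U: "open ?U" "x \<in> ?U" using assms by (auto simp: Lip_c_def)
  have zero: "\<psi> y = 0" if "y \<in> ?U" for y
    using that closure_subset[of "{x. \<psi> x \<noteq> 0}"] by blast
  have "((\<lambda>t. x + t *\<^sub>R axis j 1) \<longlongrightarrow> x + 0 *\<^sub>R axis j 1) (nhds 0)"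
    by (intro tendsto_intros filterlim_ident)
  then have "\<forall>\<^sub>F t in nhds 0. x + t *\<^sub>R axis j 1 \<in> ?U"
    using topological_tendstoD[of _ x "nhds 0" ?U] U by simp
  then have "\<forall>\<^sub>F t in nhds 0. \<psi> (x + t *\<^sub>R axis j 1) = 0"
    by (rule eventually_mono) (rule zero)
  then show "((\<lambda>t. \<psi> (x + t *\<^sub>R axis j 1)) has_real_derivative 0) (at 0)"
    by (subst DERIV_cong_ev[OF refl _ refl, of _ "\<lambda>t. 0"]) auto
qed

lemma partial_deriv_lincomb:
  assumes "partially_differentiable_at \<psi> x" "partially_differentiable_at \<eta> x"
  shows "partial_deriv j (\<lambda>x. a * \<psi> x + b * \<eta> x) x = a * partial_deriv j \<psi> x + b * partial_deriv j \<eta> x"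
  using assms[THEN partially_differentiable_atD, of j]
  by (intro partial_deriv_eqI) (auto intro!: derivative_eq_intros)

lemma partial_deriv_mult:
  assumes "partially_differentiable_at \<psi> x" "partially_differentiable_at \<eta> x"
  shows "partial_deriv j (\<lambda>x. \<psi> x * \<eta> x) x = partial_deriv j \<psi> x * \<eta> x + partial_deriv j \<eta> x * \<psi> x"
  using assms[THEN partially_differentiable_atD, of j]
  by (intro partial_deriv_eqI) (auto intro!: derivative_eq_intros)

text \<open>At a point with \<open>\<psi> \<ge> k\<close> the function \<open>min \<psi> k\<close> is maximal, and at one with
  \<open>\<psi> \<le> k\<close> the function \<open>max 0 (\<psi> - k)\<close> is minimal, so one of the two derivatives vanishes.
  This covers the points with \<open>\<psi> = k\<close>, where both vanish.\<close>
lemma partial_deriv_truncation: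
  assumes \<psi>: "partially_differentiable_at \<psi> x"
    and lo: "partially_differentiable_at (\<lambda>x. min (\<psi> x) k) x"
    and hi: "partially_differentiable_at (\<lambda>x. max 0 (\<psi> x - k)) x"
  shows "partial_deriv j \<psi> x = partial_deriv j (\<lambda>x. min (\<psi> x) k) x + partial_deriv j (\<lambda>x. max 0 (\<psi> x - k)) x"
    and "(\<forall>j. partial_deriv j (\<lambda>x. min (\<psi> x) k) x = 0) \<or> (\<forall>j. partial_deriv j (\<lambda>x. max 0 (\<psi> x - k)) x = 0)"
proof -
  have "\<psi> = (\<lambda>x. 1 * min (\<psi> x) k + 1 * max 0 (\<psi> x - k))" by (auto simp: fun_eq_iff min_def max_def)
  then show "partial_deriv j \<psi> x = partial_deriv j (\<lambda>x. min (\<psi> x) k) x + partial_deriv j (\<lambda>x. max 0 (\<psi> x - k)) x"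
    using partial_deriv_lincomb[OF lo hi, of j 1 1] by simp
next
  show "(\<forall>j. partial_deriv j (\<lambda>x. min (\<psi> x) k) x = 0) \<or> (\<forall>j. partial_deriv j (\<lambda>x. max 0 (\<psi> x - k)) x = 0)"
  proof (cases "\<psi> x \<ge> k")
    case True
    then have "partial_deriv j (\<lambda>x. min (\<psi> x) k) x = 0" for j
      by (intro DERIV_local_max[OF partially_differentiable_atD[OF lo], of 1]) auto
    then show ?thesis by blast
  next
    case False
    then have "partial_deriv j (\<lambda>x. max 0 (\<psi> x - k)) x = 0" for j
      by (intro DERIV_local_min[OF partially_differentiable_atD[OF hi], of 1]) auto
    then show ?thesis by blast
  qed
qed

lemma integral_partial_deriv_Lip_c:
  assumes "\<Omega> \<in> sets lebesgue" "\<psi> \<in> Lip_c \<Omega>"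
  shows "(\<integral>x. partial_deriv j \<psi> x \<partial>lebesgue_on \<Omega>) = 0"
proof -
  obtain K C where C: "K-lipschitz_on UNIV \<psi>" "compact C" "C \<subseteq> \<Omega>" "\<forall>x. x \<notin> C \<longrightarrow> \<psi> x = 0"
    using assms(2) by (rule Lip_cE)
  have "bounded {x. \<psi> x \<noteq> 0}" using C by (intro bounded_subset[OF compact_imp_bounded[OF C(2)]]) auto
  then have "(\<integral>x. partial_deriv j \<psi> x \<partial>lebesgue) = 0" by (rule integral_partial_deriv_eq_0[OF C(1)])
  moreover have "(\<integral>x. partial_deriv j \<psi> x \<partial>lebesgue_on \<Omega>) = (\<integral>x. indicator \<Omega> x *\<^sub>R partial_deriv j \<psi> x \<partial>lebesgue)"
    using assms(1) by (intro integral_restrict_space) auto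
  moreover have "(\<lambda>x. indicator \<Omega> x *\<^sub>R partial_deriv j \<psi> x) = partial_deriv j \<psi>"
    using partial_deriv_outside_support[OF assms(2)] by (auto simp: fun_eq_iff split: split_indicator)
  ultimately show ?thesis by simp
qed

lemma AE_lebesgue_onI:
  assumes "\<Omega> \<in> sets lebesgue" "AE x in lebesgue. P x"
  shows "AE x in lebesgue_on \<Omega>. P x"
  using assms by (subst AE_restrict_space_iff) (auto elim: eventually_mono)

text \<open>Lipschitz functions with compact support separate the integrable functions: they approximate the
  indicator of any compact subset, and the set where \<open>g > 0\<close> is exhausted by compact sets.\<close>
lemma AE_nonpos_of_orthogonal_Lip_c:
  fixes g :: "real^'n \<Rightarrow> real"
  assumes \<Omega>: "open \<Omega>" "bounded \<Omega>" and g: "integrable (lebesgue_on \<Omega>) g"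
    and orth: "\<And>\<psi>. \<psi> \<in> Lip_c \<Omega> \<Longrightarrow> (\<integral>x. g x * \<psi> x \<partial>lebesgue_on \<Omega>) = 0"
  shows "AE x in lebesgue_on \<Omega>. g x \<le> 0"
proof -
  have \<Omega>_sets: "\<Omega> \<in> sets lebesgue" using \<Omega>(1) by simp
  have [measurable]: "g \<in> borel_measurable (lebesgue_on \<Omega>)" using g by auto
  have compact_null: "emeasure lebesgue T = 0" if T: "compact T" "T \<subseteq> \<Omega>" "\<And>x. x \<in> T \<Longrightarrow> g x > 0" for T
  proof (cases "T = {}")
    case False
    have T_sets [measurable]: "T \<in> sets (lebesgue_on \<Omega>)"
      using T \<Omega>_sets by (auto simp: sets_restrict_space_iff compact_imp_closed)
    obtain \<epsilon> where \<epsilon>: "\<epsilon> > 0" "{x. infdist x T \<le> \<epsilon>} \<subseteq> \<Omega>"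
    proof -
      obtain \<epsilon> where \<epsilon>: "\<epsilon> > 0" "(\<Union>x\<in>T. cball x \<epsilon>) \<subseteq> \<Omega>"
        using compact_subset_open_imp_cball_epsilon_subset[OF T(1) \<Omega>(1) T(2)] .
      have "{x. infdist x T \<le> \<epsilon>} \<subseteq> (\<Union>x\<in>T. cball x \<epsilon>)"
      proof
        fix x assume "x \<in> {x. infdist x T \<le> \<epsilon>}"
        moreover obtain y where "y \<in> T" "infdist x T = dist x y"
          using infdist_attains_inf[of T x] T(1) False by (auto simp: compact_imp_closed)
        ultimately show "x \<in> (\<Union>x\<in>T. cball x \<epsilon>)" by (auto simp: dist_commute)
      qed
      then show ?thesis using that \<epsilon> by blast
    qed
    define \<psi> where "\<psi> n x = max 0 (1 - real n * infdist x T)" for n :: nat and x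
    have \<psi>_01: "0 \<le> \<psi> n x" "\<psi> n x \<le> 1" for n x
      by (auto simp: \<psi>_def infdist_nonneg)
    have \<psi>_Lip: "\<psi> n \<in> Lip_c \<Omega>" if n: "real n * \<epsilon> \<ge> 1" for n
    proof (rule Lip_cI)
      show "(real n)-lipschitz_on UNIV (\<psi> n)"
      proof (rule lipschitz_onI)
        fix x y :: "real^'n"
        have "\<bar>max 0 a - max 0 b\<bar> \<le> \<bar>b - a\<bar>" for a b :: real by auto
        then have "\<bar>\<psi> n x - \<psi> n y\<bar> \<le> \<bar>(1 - real n * infdist y T) - (1 - real n * infdist x T)\<bar>"
          unfolding \<psi>_def .
        also have "\<dots> = real n * \<bar>infdist x T - infdist y T\<bar>"
          by (simp add: abs_mult flip: right_diff_distrib)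
        finally have "\<bar>\<psi> n x - \<psi> n y\<bar> \<le> real n * \<bar>infdist x T - infdist y T\<bar>" .
        moreover have "\<dots> \<le> real n * dist x y" by (intro mult_left_mono infdist_triangle_abs) auto
        ultimately show "dist (\<psi> n x) (\<psi> n y) \<le> real n * dist x y" by (simp add: dist_real_def)
      qed simp
      show "compact {x. infdist x T \<le> \<epsilon>}" using T(1) False \<epsilon>(1) by (intro compact_infdist_le) auto
      show "{x. infdist x T \<le> \<epsilon>} \<subseteq> \<Omega>" by (rule \<epsilon>(2))
      fix x assume "x \<notin> {x. infdist x T \<le> \<epsilon>}"
      then have "real n * infdist x T \<ge> real n * \<epsilon>" by (intro mult_left_mono) auto
      then show "\<psi> n x = 0" using n by (simp add: \<psi>_def)
    qed
    have \<psi>_meas: "\<psi> n \<in> borel_measurable (lebesgue_on \<Omega>)" for n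
      unfolding \<psi>_def using \<Omega>_sets
      by (intro continuous_imp_measurable_on_sets_lebesgue continuous_intros) auto
    have \<psi>_lim: "(\<lambda>n. \<psi> n x) \<longlonglongrightarrow> indicator T x" for x
    proof (cases "x \<in> T")
      case True
      then show ?thesis by (simp add: \<psi>_def)
    next
      case False
      then have "infdist x T > 0"
        using T(1) \<open>T \<noteq> {}\<close> in_closed_iff_infdist_zero[of T x] infdist_nonneg[of x T]
        by (auto simp: compact_imp_closed)
      then obtain n0 where "real n0 * infdist x T \<ge> 1"
        using reals_Archimedean3 by (meson less_imp_le)
      moreover have "real n * infdist x T \<ge> real n0 * infdist x T" if "n \<ge> n0" for n
        using that by (intro mult_right_mono infdist_nonneg) auto
      ultimately have "\<psi> n x = 0" if "n \<ge> n0" for n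
        using that by (force simp: \<psi>_def max_def)
      then show ?thesis using False
        by (intro tendsto_eventually) (auto simp: eventually_at_top_linorder)
    qed
    have lim: "(\<lambda>n. \<integral>x. g x * \<psi> n x \<partial>lebesgue_on \<Omega>) \<longlonglongrightarrow> (\<integral>x. g x * indicator T x \<partial>lebesgue_on \<Omega>)"
    proof (rule integral_dominated_convergence[where w = "\<lambda>x. \<bar>g x\<bar>"])
      show "AE x in lebesgue_on \<Omega>. (\<lambda>n. g x * \<psi> n x) \<longlonglongrightarrow> g x * indicator T x"
        by (intro AE_I2 tendsto_intros \<psi>_lim)
      show "AE x in lebesgue_on \<Omega>. norm (g x * \<psi> n x) \<le> \<bar>g x\<bar>" for n
        using \<psi>_01 by (auto simp: abs_mult mult_left_le)
    qed (use g \<psi>_meas in auto)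
    have "\<forall>\<^sub>F n in sequentially. (\<integral>x. g x * \<psi> n x \<partial>lebesgue_on \<Omega>) = 0"
    proof -
      obtain n0 where "real n0 * \<epsilon> \<ge> 1" using reals_Archimedean3[OF \<epsilon>(1)] by (meson less_imp_le)
      moreover have "real n * \<epsilon> \<ge> real n0 * \<epsilon>" if "n \<ge> n0" for n using that \<epsilon> by simp
      ultimately show ?thesis
        by (auto intro!: orth \<psi>_Lip exI[of _ n0] simp: eventually_at_top_linorder) (meson order_trans)
    qed
    then have "(\<lambda>n. \<integral>x. g x * \<psi> n x \<partial>lebesgue_on \<Omega>) \<longlonglongrightarrow> 0"
      by (rule tendsto_eventually)
    then have int0: "(\<integral>x. g x * indicator T x \<partial>lebesgue_on \<Omega>) = 0"
      by (rule LIMSEQ_unique[OF lim])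
    have nonneg: "0 \<le> g x * indicator T x" for x using T(3)[of x] by (auto split: split_indicator)
    have "integrable (lebesgue_on \<Omega>) (\<lambda>x. g x * indicator T x)"
      using g T_sets by (rule integrable_real_mult_indicator[rotated])
    then have "AE x in lebesgue_on \<Omega>. g x * indicator T x = 0"
      using int0 integral_nonneg_eq_0_iff_AE nonneg by blast
    then have "AE x in lebesgue_on \<Omega>. x \<notin> T"
      by (rule eventually_mono) (use T(3) in force)
    then have "AE x in lebesgue. x \<notin> T"
      using T(2) \<Omega>_sets by (subst (asm) AE_restrict_space_iff) (auto elim: eventually_mono)
    moreover have "T \<in> sets lebesgue" using T(1) by (simp add: compact_imp_closed)
    ultimately have "T \<in> null_sets lebesgue" by (simp add: AE_iff_null_sets)
    then show ?thesis by (rule null_setsD1)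
  qed simp
  define P where "P = {x \<in> \<Omega>. g x > 0}"
  have P: "P \<in> sets lebesgue"
  proof -
    have "{x \<in> space (lebesgue_on \<Omega>). g x > 0} \<in> sets (lebesgue_on \<Omega>)" by measurable
    then show ?thesis using \<Omega>_sets by (simp add: P_def sets_restrict_space_iff)
  qed
  have "emeasure lebesgue P \<le> 0"
  proof (rule ennreal_le_epsilon)
    fix e :: real assume e: "e > 0"
    obtain T where T: "closed T" "T \<subseteq> P" "P - T \<in> lmeasurable" "emeasure lebesgue (P - T) < ennreal e"
      using sets_lebesgue_inner_closed[OF P e] .
    have "compact T" using T \<Omega>(2) by (auto simp: P_def compact_eq_bounded_closed intro: bounded_subset)
    then have "emeasure lebesgue T = 0" using T by (intro compact_null) (auto simp: P_def)
    moreover have "emeasure lebesgue P \<le> emeasure lebesgue T + emeasure lebesgue (P - T)"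
      using T P by (subst plus_emeasure) (auto simp: Un_absorb1)
    ultimately show "emeasure lebesgue P \<le> 0 + ennreal e" using T(4) by simp
  qed
  then have "AE x in lebesgue. x \<notin> P" using P by (intro AE_not_in) (simp add: null_sets_def)
  then have "AE x in lebesgue. x \<in> \<Omega> \<longrightarrow> g x \<le> 0" by (rule eventually_mono) (auto simp: P_def)
  then show ?thesis using \<Omega>_sets by (subst AE_restrict_space_iff) auto
qed

lemma AE_eq_0_of_orthogonal_Lip_c:
  fixes g :: "real^'n \<Rightarrow> real"
  assumes \<Omega>: "open \<Omega>" "bounded \<Omega>" and g: "integrable (lebesgue_on \<Omega>) g"
    and orth: "\<And>\<psi>. \<psi> \<in> Lip_c \<Omega> \<Longrightarrow> (\<integral>x. g x * \<psi> x \<partial>lebesgue_on \<Omega>) = 0"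
  shows "AE x in lebesgue_on \<Omega>. g x = 0"
proof -
  have "AE x in lebesgue_on \<Omega>. g x \<le> 0"
    using assms by (rule AE_nonpos_of_orthogonal_Lip_c)
  moreover have "AE x in lebesgue_on \<Omega>. - g x \<le> 0"
    using assms by (intro AE_nonpos_of_orthogonal_Lip_c) auto
  ultimately show ?thesis by (auto elim: eventually_elim2)
qed

section \<open>The degenerate gradient\<close>

locale lipschitz_square_root =
  fixes S :: "real^'n \<Rightarrow> real^'n^'n" and B :: "(real^'n) set"
  assumes open_B: "open B" and bounded_B: "bounded B" and S_lipschitz: "\<exists>K. K-lipschitz_on B S"
begin

abbreviation "M \<equiv> lebesgue_on B"

lemma B_sets: "B \<in> sets lebesgue"
  using open_B by simp

lemma finite_measure_B: "finite_measure M"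
  using bounded_B B_sets by (intro finite_measure_lebesgue_on bounded_set_imp_lmeasurable)

lemma L2_space_iff: "f \<in> L2_space B \<longleftrightarrow> square_integrable M f"
  by (simp add: L2_space_def square_integrable_def)

lemma S_entry_lipschitz: obtains L where "L-lipschitz_on B (\<lambda>x. S x $ i $ j)"
proof -
  obtain L where L: "L-lipschitz_on B S" using S_lipschitz by blast
  have "L-lipschitz_on B (\<lambda>x. S x $ i $ j)"
  proof (rule lipschitz_onI)
    fix x y assume "x \<in> B" "y \<in> B"
    then have "norm (S x - S y) \<le> L * norm (x - y)" by (rule lipschitz_on_normD[OF L])
    moreover have "\<bar>(S x - S y) $ i $ j\<bar> \<le> norm (S x - S y)"
      using component_le_norm_cart[of "(S x - S y) $ i" j] Finite_Cartesian_Product.norm_nth_le[of "S x - S y" i] by linarith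
    ultimately show "dist (S x $ i $ j) (S y $ i $ j) \<le> L * dist x y" by (simp add: dist_norm)
  qed (rule lipschitz_on_nonneg[OF L])
  then show ?thesis by (rule that)
qed

lemma S_entry_bounded: obtains b where "b \<ge> 0" "\<forall>x\<in>B. \<forall>i j. \<bar>S x $ i $ j\<bar> \<le> b"
proof -
  obtain L where L: "L-lipschitz_on B S" using S_lipschitz by blast
  have "bounded (S ` B)"
    using bounded_B L by (intro bounded_uniformly_continuous_image lipschitz_on_uniformly_continuous)
  then obtain b where b: "\<And>x. x \<in> B \<Longrightarrow> norm (S x) \<le> b" by (auto simp: bounded_iff)
  have "\<bar>S x $ i $ j\<bar> \<le> max 0 b" if "x \<in> B" for x i j
    using component_le_norm_cart[of "S x $ i" j] Finite_Cartesian_Product.norm_nth_le[of "S x" i] b[OF that] by linarith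
  then show ?thesis by (intro that[of "max 0 b"]) auto
qed

lemma S_entry_mult_Lip_c:
  assumes "\<psi> \<in> Lip_c B" shows "(\<lambda>x. S x $ i $ j * \<psi> x) \<in> Lip_c B"
proof -
  obtain L where L: "L-lipschitz_on B (\<lambda>x. S x $ i $ j)" by (rule S_entry_lipschitz)
  obtain b where b: "b \<ge> 0" "\<forall>x\<in>B. \<forall>i j. \<bar>S x $ i $ j\<bar> \<le> b" by (rule S_entry_bounded)
  show ?thesis by (rule Lip_c_mult_lipschitz_on[OF assms L, of b]) (use b in blast)
qed

lemma S_entry_measurable: "(\<lambda>x. S x $ i $ j) \<in> borel_measurable M"
proof -
  obtain L where L: "L-lipschitz_on B (\<lambda>x. S x $ i $ j)" by (rule S_entry_lipschitz)
  show ?thesis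
    using lipschitz_on_continuous_on[OF L] B_sets by (rule continuous_imp_measurable_on_sets_lebesgue)
qed

text \<open>The classical \<open>S\<nabla>\<psi>\<close>. For \<open>\<psi> \<in> Lip_c B\<close> it agrees almost everywhere with \<open>A_grad S B \<psi>\<close>, but unlike
  the latter it is given by a formula, which makes truncations computable.\<close>
definition grad_S :: "(real^'n \<Rightarrow> real) \<Rightarrow> real^'n \<Rightarrow> real^'n" where
  "grad_S \<psi> x = S x *v (\<chi> j. partial_deriv j \<psi> x)"

lemma grad_S_nth: "grad_S \<psi> x $ i = (\<Sum>j\<in>UNIV. S x $ i $ j * partial_deriv j \<psi> x)"
  by (simp add: grad_S_def matrix_vector_mult_def)

lemma Lip_c_partial_deriv_measurable_B:
  "\<psi> \<in> Lip_c B \<Longrightarrow> partial_deriv j \<psi> \<in> borel_measurable M"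
  by (rule measurable_restrict_space1[OF Lip_c_partial_deriv_measurable])

lemma Lip_c_AE_differentiable_B:
  "\<psi> \<in> Lip_c B \<Longrightarrow> AE x in M. partially_differentiable_at \<psi> x"
  by (rule AE_lebesgue_onI[OF B_sets Lip_c_AE_differentiable])

lemma Lip_c_L2:
  assumes "\<psi> \<in> Lip_c B" shows "square_integrable M \<psi>"
proof -
  obtain b where "\<And>x. \<bar>\<psi> x\<bar> \<le> b" using assms by (rule Lip_c_bounded) blast
  then show ?thesis
    using continuous_on_subset[OF Lip_c_continuous[OF assms]] B_sets
    by (intro square_integrable_bounded[OF finite_measure_B, where C = b] continuous_imp_measurable_on_sets_lebesgue) auto
qed

lemma Lip_c_partial_deriv_L2:
  assumes "\<psi> \<in> Lip_c B" shows "square_integrable M (partial_deriv j \<psi>)"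
proof -
  obtain K where "AE x in lebesgue. \<forall>j. \<bar>partial_deriv j \<psi> x\<bar> \<le> K"
    using assms by (rule Lip_c_partial_deriv_bounded) blast
  then have "AE x in M. \<forall>j. \<bar>partial_deriv j \<psi> x\<bar> \<le> K"
    by (rule AE_lebesgue_onI[OF B_sets])
  then have "AE x in M. norm (partial_deriv j \<psi> x) \<le> K"
    by (rule eventually_mono) simp
  then show ?thesis
    by (rule square_integrable_bounded[OF finite_measure_B Lip_c_partial_deriv_measurable_B[OF assms]])
qed

lemma square_integrable_S_entry_mult:
  assumes "square_integrable M f"
  shows "square_integrable M (\<lambda>x. S x $ i $ j * f x :: real)"
proof -
  obtain b where b: "b \<ge> 0" "\<forall>x\<in>B. \<forall>i j. \<bar>S x $ i $ j\<bar> \<le> b" by (rule S_entry_bounded)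
  show ?thesis
  proof (rule square_integrableI_bound)
    show "(\<lambda>x. S x $ i $ j * f x) \<in> borel_measurable M"
      using S_entry_measurable assms by (intro borel_measurable_times) (auto simp: square_integrable_def)
    show "integrable M (\<lambda>x. b\<^sup>2 * (norm (f x))\<^sup>2)"
      using integrable_norm_square[OF assms] by simp
    show "AE x in M. (norm (S x $ i $ j * f x))\<^sup>2 \<le> b\<^sup>2 * (norm (f x))\<^sup>2"
    proof (rule AE_I2)
      fix x assume "x \<in> space M"
      then have "\<bar>S x $ i $ j\<bar>\<^sup>2 \<le> b\<^sup>2" using b by (intro power_mono) auto
      then show "(norm (S x $ i $ j * f x))\<^sup>2 \<le> b\<^sup>2 * (norm (f x))\<^sup>2"
        by (simp add: power_mult_distrib mult_right_mono)
    qed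
  qed
qed

lemma grad_S_L2:
  assumes "\<psi> \<in> Lip_c B" shows "square_integrable M (grad_S \<psi>)"
proof (rule square_integrable_vec)
  fix i
  have "square_integrable M (\<lambda>x. \<Sum>j\<in>UNIV. S x $ i $ j * partial_deriv j \<psi> x)"
    by (rule square_integrable_sum[OF finite])
      (rule square_integrable_S_entry_mult[OF Lip_c_partial_deriv_L2[OF assms]])
  then show "square_integrable M (\<lambda>x. grad_S \<psi> x $ i)" by (simp only: grad_S_nth)
qed

lemma grad_S_lincomb:
  assumes "\<psi> \<in> Lip_c B" "\<eta> \<in> Lip_c B"
  shows "AE x in M. grad_S (\<lambda>x. a * \<psi> x + b * \<eta> x) x = a *\<^sub>R grad_S \<psi> x + b *\<^sub>R grad_S \<eta> x"
  using assms[THEN Lip_c_AE_differentiable_B]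
proof eventually_elim
  case (elim x)
  have "(\<chi> j. partial_deriv j (\<lambda>x. a * \<psi> x + b * \<eta> x) x) =
      a *\<^sub>R (\<chi> j. partial_deriv j \<psi> x) + b *\<^sub>R (\<chi> j. partial_deriv j \<eta> x)"
    using partial_deriv_lincomb[OF elim] by (simp add: vec_eq_iff)
  then show ?case by (simp add: grad_S_def matrix_vector_right_distrib matrix_vector_mult_scaleR)
qed

lemma grad_S_diff:
  assumes "\<psi> \<in> Lip_c B" "\<eta> \<in> Lip_c B"
  shows "AE x in M. grad_S (\<lambda>x. \<psi> x - \<eta> x) x = grad_S \<psi> x - grad_S \<eta> x"
  using grad_S_lincomb[OF assms, of 1 "-1"] by simp

text \<open>The gradients of the two parts of \<open>\<psi>\<close> below and above the level \<open>k\<close> have disjoint supports up to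
  a null set.\<close>
lemma grad_S_truncation:
  assumes k: "k \<ge> 0" and \<psi>: "\<psi> \<in> Lip_c B"
  shows "AE x in M. (norm (grad_S \<psi> x))\<^sup>2 =
    (norm (grad_S (\<lambda>x. min (\<psi> x) k) x))\<^sup>2 + (norm (grad_S (\<lambda>x. max 0 (\<psi> x - k)) x))\<^sup>2"
  using Lip_c_AE_differentiable_B[OF \<psi>] Lip_c_AE_differentiable_B[OF Lip_c_min[OF k \<psi>]]
    Lip_c_AE_differentiable_B[OF Lip_c_max[OF k \<psi>]]
proof eventually_elim
  case (elim x)
  have sum: "(\<chi> j. partial_deriv j \<psi> x) = (\<chi> j. partial_deriv j (\<lambda>x. min (\<psi> x) k) x)
      + (\<chi> j. partial_deriv j (\<lambda>x. max 0 (\<psi> x - k)) x)"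
    using partial_deriv_truncation(1)[OF elim] by (simp add: vec_eq_iff)
  from partial_deriv_truncation(2)[OF elim] show ?case
  proof
    assume "\<forall>j. partial_deriv j (\<lambda>x. min (\<psi> x) k) x = 0"
    then have "(\<chi> j. partial_deriv j (\<lambda>x. min (\<psi> x) k) x) = 0" by (simp add: vec_eq_iff)
    then show ?thesis using sum by (simp add: grad_S_def)
  next
    assume "\<forall>j. partial_deriv j (\<lambda>x. max 0 (\<psi> x - k)) x = 0"
    then have "(\<chi> j. partial_deriv j (\<lambda>x. max 0 (\<psi> x - k)) x) = 0" by (simp add: vec_eq_iff)
    then show ?thesis using sum by (simp add: grad_S_def)
  qed
qed

text \<open>The product of the two functions is again Lipschitz with compact support, so its derivative
  integrates to zero.\<close>
lemma integral_by_parts_Lip_c: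
  assumes \<psi>: "\<psi> \<in> Lip_c B" and \<eta>: "\<eta> \<in> Lip_c B"
  shows "(\<integral>x. partial_deriv j \<psi> x * \<eta> x \<partial>M) = - (\<integral>x. \<psi> x * partial_deriv j \<eta> x \<partial>M)"
proof -
  have int: "integrable M (\<lambda>x. partial_deriv j f x * g x)" if "f \<in> Lip_c B" "g \<in> Lip_c B" for f g
    using square_integrable_inner[OF Lip_c_partial_deriv_L2[OF that(1)] Lip_c_L2[OF that(2)]]
    by simp
  have "0 = (\<integral>x. partial_deriv j (\<lambda>x. \<psi> x * \<eta> x) x \<partial>M)"
    using integral_partial_deriv_Lip_c[OF B_sets Lip_c_mult[OF \<psi> \<eta>]] by simp
  also have "\<dots> = (\<integral>x. partial_deriv j \<psi> x * \<eta> x + partial_deriv j \<eta> x * \<psi> x \<partial>M)"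
  proof (rule integral_cong_AE)
    show "AE x in M. partial_deriv j (\<lambda>x. \<psi> x * \<eta> x) x = partial_deriv j \<psi> x * \<eta> x + partial_deriv j \<eta> x * \<psi> x"
      using Lip_c_AE_differentiable_B[OF \<psi>] Lip_c_AE_differentiable_B[OF \<eta>]
      by eventually_elim (rule partial_deriv_mult)
    show "(\<lambda>x. partial_deriv j \<psi> x * \<eta> x + partial_deriv j \<eta> x * \<psi> x) \<in> borel_measurable M"
      using int[OF \<psi> \<eta>] int[OF \<eta> \<psi>] by (intro borel_measurable_add) auto
  qed (rule Lip_c_partial_deriv_measurable_B[OF Lip_c_mult[OF \<psi> \<eta>]])
  also have "\<dots> = (\<integral>x. partial_deriv j \<psi> x * \<eta> x \<partial>M) + (\<integral>x. partial_deriv j \<eta> x * \<psi> x \<partial>M)"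
    using int[OF \<psi> \<eta>] int[OF \<eta> \<psi>] by simp
  finally show ?thesis by (simp add: mult.commute)
qed

text \<open>Integration by parts against the functions \<open>S\<^sub>i\<^sub>j \<psi>\<close>, which are admissible because \<open>S\<close> is
  Lipschitz.\<close>
lemma has_A_gradient_Lip_c:
  assumes v: "v \<in> Lip_c B" shows "has_A_gradient S B v (grad_S v)"
  unfolding has_A_gradient_def L2_space_iff
proof (intro conjI grad_S_L2 v ballI allI)
  fix \<psi> i assume \<psi>: "\<psi> \<in> Lip_c B"
  let ?S\<psi> = "\<lambda>j y. S y $ i $ j * \<psi> y"
  have S\<psi>: "?S\<psi> j \<in> Lip_c B" for j by (rule S_entry_mult_Lip_c[OF \<psi>])
  have int: "integrable M (\<lambda>x. partial_deriv j v x * ?S\<psi> j x)" for j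
    using square_integrable_inner[OF Lip_c_partial_deriv_L2[OF v] Lip_c_L2[OF S\<psi>]]
    by simp
  have int': "integrable M (\<lambda>x. v x * partial_deriv j (?S\<psi> j) x)" for j
    using square_integrable_inner[OF Lip_c_L2[OF v] Lip_c_partial_deriv_L2[OF S\<psi>]]
    by simp
  have "(\<integral>x. grad_S v x $ i * \<psi> x \<partial>M) = (\<integral>x. (\<Sum>j\<in>UNIV. partial_deriv j v x * ?S\<psi> j x) \<partial>M)"
    by (intro Bochner_Integration.integral_cong refl) (simp add: grad_S_nth sum_distrib_left mult_ac)
  also have "\<dots> = (\<Sum>j\<in>UNIV. \<integral>x. partial_deriv j v x * ?S\<psi> j x \<partial>M)"
    using int by (intro Bochner_Integration.integral_sum)
  also have "\<dots> = - (\<Sum>j\<in>UNIV. \<integral>x. v x * partial_deriv j (?S\<psi> j) x \<partial>M)"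
    by (simp only: integral_by_parts_Lip_c[OF v S\<psi>] sum_negf)
  also have "(\<Sum>j\<in>UNIV. \<integral>x. v x * partial_deriv j (?S\<psi> j) x \<partial>M)
      = (\<integral>x. v x * (\<Sum>j\<in>UNIV. partial_deriv j (?S\<psi> j) x) \<partial>M)"
    using int' by (subst Bochner_Integration.integral_sum[symmetric]) (auto simp: sum_distrib_left)
  finally show "(\<integral>x. grad_S v x $ i * \<psi> x \<partial>M)
      = - (\<integral>x. v x * (\<Sum>j\<in>UNIV. partial_deriv j (?S\<psi> j) x) \<partial>M)" .
qed

lemma has_A_gradient_square_integrable:
  "has_A_gradient S B v G \<Longrightarrow> square_integrable M G"
  unfolding has_A_gradient_def L2_space_iff by (rule conjunct1)

lemma has_A_gradient_test:
  "has_A_gradient S B v G \<Longrightarrow> \<psi> \<in> Lip_c B \<Longrightarrow> (\<integral>x. G x $ i * \<psi> x \<partial>M) =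
     - (\<integral>x. v x * (\<Sum>j\<in>UNIV. partial_deriv j (\<lambda>y. S y $ i $ j * \<psi> y) x) \<partial>M)"
  unfolding has_A_gradient_def by blast

lemma has_A_gradient_unique:
  assumes "has_A_gradient S B v G" "has_A_gradient S B v H"
  shows "AE x in M. G x = H x"
proof -
  have GH: "square_integrable M G" "square_integrable M H"
    using assms has_A_gradient_square_integrable by blast+
  have "AE x in M. G x $ i - H x $ i = 0" for i
  proof (rule AE_eq_0_of_orthogonal_Lip_c[OF open_B bounded_B])
    show "integrable M (\<lambda>x. G x $ i - H x $ i)"
      using GH by (intro Bochner_Integration.integrable_diff square_integrable_integrable[OF finite_measure_B] square_integrable_vec_nth)
    fix \<psi> assume \<psi>: "\<psi> \<in> Lip_c B"
    have "integrable M (\<lambda>x. F x $ i * \<psi> x)" if "square_integrable M F" for F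
      using square_integrable_inner[OF square_integrable_vec_nth[OF that, of i] Lip_c_L2[OF \<psi>]] by simp
    then have "(\<integral>x. (G x $ i - H x $ i) * \<psi> x \<partial>M)
        = (\<integral>x. G x $ i * \<psi> x \<partial>M) - (\<integral>x. H x $ i * \<psi> x \<partial>M)"
      using GH by (simp add: left_diff_distrib)
    also have "\<dots> = 0" by (simp only: has_A_gradient_test[OF assms(1) \<psi>] has_A_gradient_test[OF assms(2) \<psi>] diff_self)
    finally show "(\<integral>x. (G x $ i - H x $ i) * \<psi> x \<partial>M) = 0" .
  qed
  then have "AE x in M. \<forall>i. G x $ i - H x $ i = 0"
    by (intro AE_finite_allI[of UNIV, simplified]) auto
  then show ?thesis by (rule eventually_mono) (simp add: vec_eq_iff)
qed

lemma A_grad_eqI: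
  assumes "has_A_gradient S B v G" shows "AE x in M. A_grad S B v x = G x"
  by (rule has_A_gradient_unique[OF _ assms]) (simp add: A_grad_def someI[of "has_A_gradient S B v", OF assms])

lemma has_A_gradient_A_grad:
  assumes "v \<in> W12A S B" shows "has_A_gradient S B v (A_grad S B v)"
proof -
  obtain G where "has_A_gradient S B v G" using assms by (auto simp: W12A_def)
  then show ?thesis unfolding A_grad_def by (rule someI[of "has_A_gradient S B v"])
qed

lemma A_grad_L2:
  "v \<in> W12A S B \<Longrightarrow> square_integrable M (A_grad S B v)"
  by (rule has_A_gradient_square_integrable[OF has_A_gradient_A_grad])

lemma W12A_L2: "v \<in> W12A S B \<Longrightarrow> square_integrable M v"
  by (auto simp: W12A_def L2_space_iff)

lemma test_field_square_integrable:
  assumes "\<psi> \<in> Lip_c B"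
  shows "square_integrable M (\<lambda>x. \<Sum>j\<in>UNIV. partial_deriv j (\<lambda>y. S y $ i $ j * \<psi> y) x)"
  by (rule square_integrable_sum[OF finite])
    (rule Lip_c_partial_deriv_L2[OF S_entry_mult_Lip_c[OF assms]])

lemma has_A_gradient_diff:
  assumes v: "square_integrable M v" "has_A_gradient S B v G"
    and w: "square_integrable M w" "has_A_gradient S B w H"
  shows "has_A_gradient S B (\<lambda>x. v x - w x) (\<lambda>x. G x - H x)"
  unfolding has_A_gradient_def L2_space_iff
proof (intro conjI ballI allI)
  have GH: "square_integrable M G" "square_integrable M H"
    using assms has_A_gradient_square_integrable by blast+
  then show "square_integrable M (\<lambda>x. G x - H x)" by (rule square_integrable_diff)
  fix \<psi> i assume \<psi>: "\<psi> \<in> Lip_c B"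
  let ?d = "\<lambda>x. \<Sum>j\<in>UNIV. partial_deriv j (\<lambda>y. S y $ i $ j * \<psi> y) x"
  have int: "integrable M (\<lambda>x. F x $ i * \<psi> x)" if "square_integrable M F" for F
    using square_integrable_inner[OF square_integrable_vec_nth[OF that, of i] Lip_c_L2[OF \<psi>]] by simp
  have int': "integrable M (\<lambda>x. f x * ?d x)" if "square_integrable M f" for f
    using square_integrable_inner[OF that test_field_square_integrable[OF \<psi>]] by simp
  have "(\<integral>x. (G x - H x) $ i * \<psi> x \<partial>M) = (\<integral>x. G x $ i * \<psi> x \<partial>M) - (\<integral>x. H x $ i * \<psi> x \<partial>M)"
    using int GH by (simp add: left_diff_distrib)
  also have "\<dots> = - ((\<integral>x. v x * ?d x \<partial>M) - (\<integral>x. w x * ?d x \<partial>M))"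
    by (simp only: has_A_gradient_test[OF v(2) \<psi>] has_A_gradient_test[OF w(2) \<psi>] minus_diff_minus)
  also have "\<dots> = - (\<integral>x. v x * ?d x - w x * ?d x \<partial>M)"
    using int'[OF v(1)] int'[OF w(1)] by (simp only: Bochner_Integration.integral_diff)
  also have "\<dots> = - (\<integral>x. (v x - w x) * ?d x \<partial>M)"
    by (simp only: left_diff_distrib)
  finally show "(\<integral>x. (G x - H x) $ i * \<psi> x \<partial>M) = - (\<integral>x. (v x - w x) * ?d x \<partial>M)" .
qed

text \<open>Both sides of the defining identity are inner products in \<open>L\<^sup>2\<close> with fixed functions; for the right-hand
  side this uses that \<open>\<Sum>\<^sub>j \<partial>\<^sub>j (S\<^sub>i\<^sub>j \<psi>)\<close> is square integrable.\<close>
lemma has_A_gradient_limit: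
  assumes grad: "\<And>m. has_A_gradient S B (v m) (G m)"
    and sq: "\<And>m. square_integrable M (v m)" "square_integrable M v'" "square_integrable M G'"
    and lim: "(\<lambda>m. l2_dist M (v m) v') \<longlonglongrightarrow> 0" "(\<lambda>m. l2_dist M (G m) G') \<longlonglongrightarrow> 0"
  shows "has_A_gradient S B v' G'"
  unfolding has_A_gradient_def L2_space_iff
proof (intro conjI ballI allI sq)
  have Gsq: "square_integrable M (G m)" for m
    by (rule has_A_gradient_square_integrable[OF grad])
  fix \<psi> i assume \<psi>: "\<psi> \<in> Lip_c B"
  let ?d = "\<lambda>x. \<Sum>j\<in>UNIV. partial_deriv j (\<lambda>y. S y $ i $ j * \<psi> y) x"
  have \<psi>i: "square_integrable M (\<lambda>x. axis i (\<psi> x) :: real^'n)"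
  proof (rule square_integrable_vec)
    show "square_integrable M (\<lambda>x. axis i (\<psi> x) $ k)" for k
      using Lip_c_L2[OF \<psi>] by (cases "k = i") (simp_all add: axis_def square_integrable_def)
  qed
  have "(\<lambda>m. \<integral>x. G m x \<bullet> axis i (\<psi> x) \<partial>M) \<longlonglongrightarrow> (\<integral>x. G' x \<bullet> axis i (\<psi> x) \<partial>M)"
    by (rule l2_dist_tendsto_inner) (use Gsq sq \<psi>i lim in auto)
  then have L: "(\<lambda>m. \<integral>x. G m x $ i * \<psi> x \<partial>M) \<longlonglongrightarrow> (\<integral>x. G' x $ i * \<psi> x \<partial>M)"
    by (simp add: inner_axis)
  have "(\<lambda>m. \<integral>x. v m x \<bullet> ?d x \<partial>M) \<longlonglongrightarrow> (\<integral>x. v' x \<bullet> ?d x \<partial>M)"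
    by (rule l2_dist_tendsto_inner) (use sq test_field_square_integrable[OF \<psi>] lim in auto)
  then have "(\<lambda>m. - (\<integral>x. v m x * ?d x \<partial>M)) \<longlonglongrightarrow> - (\<integral>x. v' x * ?d x \<partial>M)"
    by (simp add: tendsto_minus)
  moreover have "- (\<integral>x. v m x * ?d x \<partial>M) = (\<integral>x. G m x $ i * \<psi> x \<partial>M)" for m
    by (simp only: has_A_gradient_test[OF grad \<psi>])
  ultimately have "(\<lambda>m. \<integral>x. G m x $ i * \<psi> x \<partial>M) \<longlonglongrightarrow> - (\<integral>x. v' x * ?d x \<partial>M)"
    by simp
  with L show "(\<integral>x. G' x $ i * \<psi> x \<partial>M) = - (\<integral>x. v' x * ?d x \<partial>M)"
    by (rule LIMSEQ_unique)
qed

lemma W12A_I: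
  assumes "square_integrable M v" "has_A_gradient S B v G"
  shows "v \<in> W12A S B"
  using assms by (auto simp: W12A_def L2_space_iff)

lemma Lip_c_W12A: "\<psi> \<in> Lip_c B \<Longrightarrow> \<psi> \<in> W12A S B"
  by (rule W12A_I[OF Lip_c_L2 has_A_gradient_Lip_c])

lemma A_grad_Lip_c:
  "\<psi> \<in> Lip_c B \<Longrightarrow> AE x in M. A_grad S B \<psi> x = grad_S \<psi> x"
  by (intro A_grad_eqI has_A_gradient_Lip_c)

text \<open>The norm is defined by the chosen representative of the gradient of the difference; this expresses it by
  the gradients of the two functions.\<close>
lemma W12A_norm_diff_Lip_c:
  assumes v: "v \<in> W12A S B" and \<psi>: "\<psi> \<in> Lip_c B"
  shows "W12A_norm S B (\<lambda>x. v x - \<psi> x) =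
    sqrt (l2_dist M \<psi> v + l2_dist M (grad_S \<psi>) (A_grad S B v))"
proof -
  note sq = W12A_L2[OF v] Lip_c_L2[OF \<psi>]
    A_grad_L2[OF v] grad_S_L2[OF \<psi>]
  have grad: "has_A_gradient S B (\<lambda>x. v x - \<psi> x) (\<lambda>x. A_grad S B v x - grad_S \<psi> x)"
    by (rule has_A_gradient_diff[OF sq(1) has_A_gradient_A_grad[OF v] sq(2) has_A_gradient_Lip_c[OF \<psi>]])
  have vpsi: "(\<lambda>x. v x - \<psi> x) \<in> W12A S B"
    by (rule W12A_I[OF square_integrable_diff[OF sq(1,2)] grad])
  have int1: "integrable M (\<lambda>x. \<bar>v x - \<psi> x\<bar>\<^sup>2)"
    using integrable_norm_square[OF square_integrable_diff[OF sq(1,2)]] by simp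
  have int2: "integrable M (\<lambda>x. (norm (A_grad S B (\<lambda>x. v x - \<psi> x) x))\<^sup>2)"
    by (rule integrable_norm_square[OF A_grad_L2[OF vpsi]])
  have "(\<integral>x. (norm (A_grad S B (\<lambda>x. v x - \<psi> x) x))\<^sup>2 \<partial>M)
      = (\<integral>x. (norm (grad_S \<psi> x - A_grad S B v x))\<^sup>2 \<partial>M)"
  proof (rule integral_cong_AE)
    show "AE x in M. (norm (A_grad S B (\<lambda>x. v x - \<psi> x) x))\<^sup>2 = (norm (grad_S \<psi> x - A_grad S B v x))\<^sup>2"
      using A_grad_eqI[OF grad] by (rule eventually_mono) (simp add: norm_minus_commute)
    show "(\<lambda>x. (norm (grad_S \<psi> x - A_grad S B v x))\<^sup>2) \<in> borel_measurable M"
      using integrable_norm_square[OF square_integrable_diff[OF sq(4,3)]] by simp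
  qed (use int2 in simp)
  moreover have "(\<integral>x. \<bar>v x - \<psi> x\<bar>\<^sup>2 \<partial>M) = l2_dist M \<psi> v"
    unfolding l2_dist_def by (intro Bochner_Integration.integral_cong refl) (simp add: power2_commute)
  ultimately show ?thesis
    using int1 int2 by (simp add: W12A_norm_def l2_dist_def)
qed

lemma W12A_0_approx:
  assumes "u \<in> W12A_0 S B"
  obtains \<psi> where "\<And>m::nat. \<psi> m \<in> Lip_c B" "(\<lambda>m. l2_dist M (\<psi> m) u) \<longlonglongrightarrow> 0"
    "(\<lambda>m. l2_dist M (grad_S (\<psi> m)) (A_grad S B u)) \<longlonglongrightarrow> 0"
proof -
  have u: "u \<in> W12A S B" and approx: "\<And>e. e > 0 \<Longrightarrow> \<exists>\<psi>\<in>Lip_c B. W12A_norm S B (\<lambda>x. u x - \<psi> x) < e"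
    using assms by (auto simp: W12A_0_def)
  have "\<exists>\<psi>. \<forall>m::nat. \<psi> m \<in> Lip_c B \<and> W12A_norm S B (\<lambda>x. u x - \<psi> m x) < inverse (real (Suc m))"
    using approx[of "inverse (real (Suc m))" for m] by (intro choice) auto
  then obtain \<psi> where \<psi>: "\<And>m::nat. \<psi> m \<in> Lip_c B"
    and small: "\<And>m. W12A_norm S B (\<lambda>x. u x - \<psi> m x) < inverse (real (Suc m))" by blast
  define d where "d m = l2_dist M (\<psi> m) u + l2_dist M (grad_S (\<psi> m)) (A_grad S B u)" for m
  have d0: "d m \<ge> 0" for m by (simp add: d_def l2_dist_nonneg)
  have "(\<lambda>m. sqrt (d m)) \<longlonglongrightarrow> 0"
  proof (rule Lim_null_comparison[OF always_eventually LIMSEQ_inverse_real_of_nat], rule allI)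
    show "norm (sqrt (d m)) \<le> inverse (real (Suc m))" for m
      using small[of m] d0[of m] by (simp add: W12A_norm_diff_Lip_c[OF u \<psi>] d_def)
  qed
  then have "(\<lambda>m. (sqrt (d m))\<^sup>2) \<longlonglongrightarrow> 0\<^sup>2" by (rule tendsto_power)
  then have d_lim: "d \<longlonglongrightarrow> 0" using d0 by simp
  have "(\<lambda>m. l2_dist M (\<psi> m) u) \<longlonglongrightarrow> 0"
    by (rule Lim_null_comparison[OF always_eventually d_lim]) (auto simp: d_def l2_dist_nonneg)
  moreover have "(\<lambda>m. l2_dist M (grad_S (\<psi> m)) (A_grad S B u)) \<longlonglongrightarrow> 0"
    by (rule Lim_null_comparison[OF always_eventually d_lim]) (auto simp: d_def l2_dist_nonneg)
  ultimately show ?thesis using \<psi> by (rule that[rotated])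
qed

text \<open>The converse of \<open>W12A_0_approx\<close>, with the gradient of the limit identified.\<close>
lemma W12A_0_limit:
  assumes \<psi>: "\<And>m::nat. \<psi> m \<in> Lip_c B"
    and sq: "square_integrable M u" "square_integrable M G"
    and lim: "(\<lambda>m. l2_dist M (\<psi> m) u) \<longlonglongrightarrow> 0" "(\<lambda>m. l2_dist M (grad_S (\<psi> m)) G) \<longlonglongrightarrow> 0"
  shows "u \<in> W12A_0 S B" and "AE x in M. A_grad S B u x = G x"
proof -
  have grad: "has_A_gradient S B u G"
    by (rule has_A_gradient_limit[OF has_A_gradient_Lip_c[OF \<psi>] Lip_c_L2[OF \<psi>] sq lim])
  then show ae: "AE x in M. A_grad S B u x = G x" by (rule A_grad_eqI)
  have u: "u \<in> W12A S B" by (rule W12A_I[OF sq(1) grad])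
  have dist: "l2_dist M (grad_S (\<psi> m)) (A_grad S B u) = l2_dist M (grad_S (\<psi> m)) G" for m
    unfolding l2_dist_def
  proof (rule integral_cong_AE)
    show "(\<lambda>x. (norm (grad_S (\<psi> m) x - A_grad S B u x))\<^sup>2) \<in> borel_measurable M"
      using integrable_norm_square[OF square_integrable_diff[OF grad_S_L2[OF \<psi>] A_grad_L2[OF u]]]
      by simp
    show "(\<lambda>x. (norm (grad_S (\<psi> m) x - G x))\<^sup>2) \<in> borel_measurable M"
      using integrable_norm_square[OF square_integrable_diff[OF grad_S_L2[OF \<psi>] sq(2)]] by simp
    show "AE x in M. (norm (grad_S (\<psi> m) x - A_grad S B u x))\<^sup>2 = (norm (grad_S (\<psi> m) x - G x))\<^sup>2"
      using ae by (rule eventually_mono) simp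
  qed
  have "(\<lambda>m. W12A_norm S B (\<lambda>x. u x - \<psi> m x)) \<longlonglongrightarrow> 0"
    using tendsto_real_sqrt[OF tendsto_add[OF lim]] by (simp add: W12A_norm_diff_Lip_c[OF u \<psi>] dist)
  then have small: "\<forall>\<^sub>F m in sequentially. W12A_norm S B (\<lambda>x. u x - \<psi> m x) < e" if "e > 0" for e
    using that by (rule order_tendstoD(2))
  have "\<exists>\<psi>\<in>Lip_c B. W12A_norm S B (\<lambda>x. u x - \<psi> x) < e" if e: "e > 0" for e
  proof -
    obtain m where "W12A_norm S B (\<lambda>x. u x - \<psi> m x) < e"
      using small[OF e] by (auto simp: eventually_at_top_linorder)
    then show ?thesis using \<psi>[of m] by blast
  qed
  then show "u \<in> W12A_0 S B" using u by (simp add: W12A_0_def)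
qed

lemma Lip_c_W12A_0:
  assumes "\<psi> \<in> Lip_c B" shows "\<psi> \<in> W12A_0 S B"
  by (rule W12A_0_limit(1)[of "\<lambda>m. \<psi>" \<psi> "grad_S \<psi>"])
    (simp_all add: assms Lip_c_L2 grad_S_L2)

end

section \<open>Consequences of an Orlicz bump\<close>

text \<open>The infimum defining the norm need not be attained, so a strictly larger bound \<open>K\<close> is required.\<close>
lemma luxemburg_normE:
  assumes "luxemburg_norm M \<phi> w \<le> ennreal L" "0 \<le> L" "L < K"
  obtains k where "0 < k" "k \<le> K" "(\<integral>\<^sup>+x. \<phi> (w x / k) \<partial>M) \<le> 1"
proof -
  have "luxemburg_norm M \<phi> w < ennreal K"
    using assms by (auto intro: le_less_trans ennreal_lessI)
  then obtain k where k: "k > 0" "(\<integral>\<^sup>+x. \<phi> (w x / k) \<partial>M) \<le> 1" "ennreal k < ennreal K"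
    by (auto simp: luxemburg_norm_def Inf_less_iff)
  then have "k \<le> K" by (simp add: ennreal_less_iff)
  then show ?thesis using k that by blast
qed

text \<open>Meant for \<open>g = \<phi>(w / k)\<close>, whose integral \<open>luxemburg_normE\<close> bounds by \<open>1\<close>.\<close>
lemma integral_le_1_of_nn_integral:
  fixes f :: "'a \<Rightarrow> real"
  assumes f: "f \<in> borel_measurable M" "\<And>x. f x \<ge> 0" and le: "\<And>x. ennreal (f x) \<le> g x"
    and g: "(\<integral>\<^sup>+x. g x \<partial>M) \<le> 1"
  shows "integrable M f" "(\<integral>x. f x \<partial>M) \<le> 1"
proof -
  have fin: "(\<integral>\<^sup>+x. ennreal (f x) \<partial>M) \<le> 1"
    using nn_integral_mono[of M "\<lambda>x. ennreal (f x)" g] le g by (auto intro: order_trans)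
  show int: "integrable M f"
    using f fin by (intro integrableI_nonneg) (auto intro: le_less_trans)
  have "ennreal (\<integral>x. f x \<partial>M) \<le> 1"
    using fin nn_integral_eq_integral[OF int] f by simp
  then show "(\<integral>x. f x \<partial>M) \<le> 1" by simp
qed

text \<open>For \<open>t > T\<close> the Young function satisfies \<open>\<phi>(t) \<ge> t T (ln T)\<^sup>N\<close>, so the part of
  \<open>w\<close> above the level \<open>T K\<close> has integral at most \<open>K / (T (ln T)\<^sup>N)\<close>; below that level
  \<open>w \<le> T K\<close>.\<close>
lemma (in prob_space) integral_indicator_le_of_luxemburg_norm:
  fixes w :: "'a \<Rightarrow> real"
  assumes \<phi>: "\<And>t. t \<ge> 1 \<Longrightarrow> ennreal (t\<^sup>2 * ln t powr N) \<le> \<phi> t" and N: "N \<ge> 0"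
    and w: "integrable M w" "\<And>x. w x \<ge> 0"
    and norm: "luxemburg_norm M \<phi> w \<le> ennreal L" "0 \<le> L" "L < K"
    and T: "T > 1" and E: "E \<in> events"
  shows "(\<integral>x. indicator E x * w x \<partial>M) \<le> K * (T * prob E + 1 / (T * ln T powr N))"
proof -
  obtain k where k: "0 < k" "k \<le> K" "(\<integral>\<^sup>+x. \<phi> (w x / k) \<partial>M) \<le> 1"
    using norm by (rule luxemburg_normE)
  define c where "c = T * ln T powr N"
  have c: "c > 0" using T by (simp add: c_def)
  (* The excess of w / k over the level T, so that w / k <= T + g. *)
  define g where "g x = max 0 (w x / k - T)" for x
  have g_meas: "(\<lambda>x. g x * c) \<in> borel_measurable M" unfolding g_def using w by measurable
  have g_le: "ennreal (g x * c) \<le> \<phi> (w x / k)" for x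
  proof (cases "w x / k > T")
    case True
    define t where "t = w x / k"
    have t: "t > T" using True by (simp add: t_def)
    have "(t - T) * (T * ln T powr N) \<le> t * (t * ln t powr N)"
      using t T N by (intro mult_mono powr_mono2) auto
    then have "g x * c \<le> t\<^sup>2 * ln t powr N"
      using t by (simp add: g_def c_def t_def[symmetric] power2_eq_square mult_ac)
    then have "ennreal (g x * c) \<le> ennreal (t\<^sup>2 * ln t powr N)" by (rule ennreal_leI)
    also have "\<dots> \<le> \<phi> t" using t T by (intro \<phi>) simp
    finally show ?thesis by (simp add: t_def)
  next
    case False
    then show ?thesis by (simp add: g_def)
  qed
  have "0 \<le> g x * c" for x using c by (simp add: g_def)
  then have int_gc: "integrable M (\<lambda>x. g x * c)" and "(\<integral>x. g x * c \<partial>M) \<le> 1"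
    using integral_le_1_of_nn_integral[OF g_meas _ g_le k(3)] by auto
  then have int_g: "integrable M g" and g_int: "(\<integral>x. g x \<partial>M) \<le> 1 / c"
    using c by (auto simp: field_simps)
  have int_E: "integrable M (\<lambda>x. T * indicator E x)"
    using E by (intro integrable_mult_right integrable_real_indicator) (auto simp: emeasure_eq_measure)
  have "(\<integral>x. indicator E x * (w x / k) \<partial>M) \<le> (\<integral>x. T * indicator E x + g x \<partial>M)"
  proof (rule integral_mono)
    have "integrable M (\<lambda>x. w x / k)" using w by simp
    then show "integrable M (\<lambda>x. indicator E x * (w x / k))"
      using E integrable_real_mult_indicator[of E M "\<lambda>x. w x / k"] by (simp add: mult.commute)
    show "integrable M (\<lambda>x. T * indicator E x + g x)" using int_E int_g by simp
    show "indicator E x * (w x / k) \<le> T * indicator E x + g x" for x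
      by (auto simp: g_def split: split_indicator)
  qed
  also have "\<dots> = T * prob E + (\<integral>x. g x \<partial>M)"
    using E int_E int_g by simp
  also have "\<dots> \<le> T * prob E + 1 / c" using g_int by simp
  finally have *: "(\<integral>x. indicator E x * (w x / k) \<partial>M) \<le> T * prob E + 1 / c" .
  have "(\<integral>x. indicator E x * w x \<partial>M) = k * (\<integral>x. indicator E x * (w x / k) \<partial>M)"
    using k by (subst integral_mult_right_zero[symmetric]) (simp add: field_simps)
  also have "\<dots> \<le> k * (T * prob E + 1 / c)" using * k by (intro mult_left_mono) auto
  also have "\<dots> \<le> K * (T * prob E + 1 / c)"
    using k T c by (intro mult_right_mono) auto
  finally show ?thesis by (simp add: c_def)
qed

lemma integral_square_le_of_luxemburg_norm:
  fixes w :: "'a \<Rightarrow> real"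
  assumes \<phi>: "\<And>t. ennreal (t\<^sup>2) \<le> \<phi> t" and w: "w \<in> borel_measurable M"
    and norm: "luxemburg_norm M \<phi> w \<le> ennreal L" "0 \<le> L"
  shows "(\<integral>x. (w x)\<^sup>2 \<partial>M) \<le> L\<^sup>2"
proof -
  have le: "(\<integral>x. (w x)\<^sup>2 \<partial>M) \<le> K\<^sup>2" if K: "K > L" for K
  proof -
    obtain k where k: "0 < k" "k \<le> K" "(\<integral>\<^sup>+x. \<phi> (w x / k) \<partial>M) \<le> 1"
      using norm K by (rule luxemburg_normE)
    have "(\<integral>x. (w x / k)\<^sup>2 \<partial>M) \<le> 1"
      by (rule integral_le_1_of_nn_integral(2)[OF _ _ \<phi> k(3)]) (use w in auto)
    then have "(\<integral>x. (w x)\<^sup>2 \<partial>M) \<le> k\<^sup>2" using k by (simp add: power_divide field_simps)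
    also have "\<dots> \<le> K\<^sup>2" using k by (intro power_mono) auto
    finally show ?thesis .
  qed
  have "((\<lambda>K. K\<^sup>2) \<longlongrightarrow> L\<^sup>2) (at_right L)" by (intro tendsto_intros)
  moreover have "\<forall>\<^sub>F K in at_right L. (\<integral>x. (w x)\<^sup>2 \<partial>M) \<le> K\<^sup>2"
    using le by (auto simp: eventually_at_right[of L "L + 1"] intro!: exI[of _ "L + 1"])
  ultimately show ?thesis by (rule tendsto_lowerbound) simp
qed

text \<open>De Giorgi iteration over levels \<open>k\<^sub>j\<close> with \<open>prob {u > k\<^sub>j} \<le> exp (- s)\<close> for \<open>s = j + s\<^sub>0\<close>. The choice
  \<open>T = exp (s / 2) s\<^sup>-\<^sup>N\<^sup>/\<^sup>2\<close> balances the two terms of the hypothesis, and \<open>\<integral> (u - k\<^sub>j)\<^sub>+\<close> is then at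
  most a constant times \<open>\<Lambda> exp (- s) s\<^sup>-\<^sup>N\<close>. By Chebyshev a step of length
  \<open>const \<cdot> \<Lambda> s\<^sup>-\<^sup>N\<close> gains a factor \<open>e\<close> in the measure, and these steps are summable precisely
  because \<open>N > 1\<close>.\<close>
lemma (in prob_space) log_bump_truncations_imp_bounded:
  fixes N :: real
  assumes N: "N > 1"
  shows "\<exists>C\<ge>0. \<forall>\<Lambda> u. \<Lambda> > 0 \<longrightarrow> integrable M u \<longrightarrow>
    (\<forall>k\<ge>0. \<forall>T>1. (\<integral>x. max 0 (u x - k) \<partial>M) \<le>
       \<Lambda> * (T * prob {x \<in> space M. u x > k} + 1 / (T * ln T powr N))\<^sup>2) \<longrightarrow>
    (AE x in M. u x \<le> C * \<Lambda>)"
proof -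
  have "eventually (\<lambda>s. 2 * N * ln s \<le> s) at_top"
    by real_asymp
  moreover have "eventually (\<lambda>s::real. 1 \<le> s) at_top" by (rule eventually_ge_at_top)
  (* For s >= s0 the level T satisfies ln T >= s / 4, so its logarithm is comparable to s. *)
  ultimately obtain s0 where s0: "\<And>s. s \<ge> s0 \<Longrightarrow> 2 * N * ln s \<le> s \<and> 1 \<le> s"
    using eventually_conj[THEN iffD1[OF eventually_at_top_linorder]] by (metis (no_types, lifting))
  define A where "A = (1 + 4 powr N)\<^sup>2"
  (* Step lengths and starting level, both in units of \<Lambda>. *)
  define H where "H i = A * exp 1 * (real i + s0) powr (- N)" for i :: nat
  define k0 where "k0 = (exp 1 + 1 / exp 1)\<^sup>2 * exp s0"
  have A: "A > 0" unfolding A_def by (intro zero_less_power add_pos_nonneg) auto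
  have s1: "s0 \<ge> 1" using s0[of s0] by simp
  have H_nonneg: "H i > 0" for i using A s1 by (simp add: H_def)
  have k0: "k0 > 0" unfolding k0_def by (intro mult_pos_pos zero_less_power add_pos_pos) auto
  have "summable (\<lambda>i. (real i + s0) powr (- N))"
  proof (rule summable_comparison_test_ev)
    show "summable (\<lambda>i. real i powr (- N))" using N by (simp add: summable_real_powr_iff)
    show "\<forall>\<^sub>F i in sequentially. norm ((real i + s0) powr - N) \<le> real i powr - N"
      using eventually_gt_at_top[of 0] by (rule eventually_mono) (use N s1 in \<open>auto intro!: powr_mono2'\<close>)
  qed
  then have H_sum: "summable H" unfolding H_def by (intro summable_mult)
  define C where "C = k0 + suminf H"
  have C: "C \<ge> 0" using k0 suminf_nonneg[OF H_sum] H_nonneg by (simp add: C_def less_imp_le)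
  have main: "AE x in M. u x \<le> C * \<Lambda>" if \<Lambda>: "\<Lambda> > 0" and u: "integrable M u"
    and est: "\<And>k T. k \<ge> 0 \<Longrightarrow> T > 1 \<Longrightarrow> (\<integral>x. max 0 (u x - k) \<partial>M) \<le>
       \<Lambda> * (T * prob {x \<in> space M. u x > k} + 1 / (T * ln T powr N))\<^sup>2" for \<Lambda> u
  proof -
    have [measurable]: "u \<in> borel_measurable M" using u by auto
    define m where "m k = prob {x \<in> space M. u x > k}" for k
    have m0: "m k \<ge> 0" "m k \<le> 1" for k by (auto simp: m_def)
    have chebyshev: "h * m (k + h) \<le> (\<integral>x. max 0 (u x - k) \<partial>M)" if "h > 0" for h k
    proof -
      have "h * m (k + h) = (\<integral>x. h * indicator {x \<in> space M. u x > k + h} x \<partial>M)"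
        by (simp add: m_def)
      also have "\<dots> \<le> (\<integral>x. max 0 (u x - k) \<partial>M)"
      proof (rule integral_mono)
        show "integrable M (\<lambda>x. h * indicator {x \<in> space M. u x > k + h} x)"
          by (intro integrable_mult_right integrable_real_indicator) (auto simp: emeasure_eq_measure)
        show "integrable M (\<lambda>x. max 0 (u x - k))"
          using u by (intro integrable_max Bochner_Integration.integrable_diff) auto
        show "h * indicator {x \<in> space M. u x > k + h} x \<le> max 0 (u x - k)" for x
          using that by (auto split: split_indicator)
      qed
      finally show ?thesis .
    qed
    define k where "k j = \<Lambda> * (k0 + (\<Sum>i<j. H i))" for j :: nat
    have k_nonneg: "k j \<ge> 0" for j
    proof -
      have "0 \<le> (\<Sum>i<j. H i)" by (intro sum_nonneg less_imp_le[OF H_nonneg])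
      then show ?thesis using \<Lambda> k0 by (simp add: k_def)
    qed
    have decay: "m (k j) \<le> exp (- (real j + s0))" for j
    proof (induction j)
      case 0
      (* The hypothesis at level 0 with T = e and the trivial bound m 0 <= 1. *)
      have "\<Lambda> * k0 * m (k 0) \<le> (\<integral>x. max 0 (u x - 0) \<partial>M)"
        using chebyshev[of "\<Lambda> * k0" 0] \<Lambda> k0 by (simp add: k_def)
      also have "\<dots> \<le> \<Lambda> * (exp 1 * m 0 + 1 / exp 1)\<^sup>2"
        using est[of 0 "exp 1"] by (simp add: m_def)
      also have "\<dots> \<le> \<Lambda> * (exp 1 + 1 / exp 1)\<^sup>2"
        using m0[of 0] \<Lambda> by (intro mult_left_mono power_mono add_mono) auto
      finally have "k0 * m (k 0) \<le> (exp 1 + 1 / exp 1)\<^sup>2"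
        using \<Lambda> by (simp add: mult.assoc)
      then have "(exp 1 + 1 / exp 1)\<^sup>2 * (exp s0 * m (k 0)) \<le> (exp 1 + 1 / exp 1)\<^sup>2 * 1"
        by (simp add: k0_def mult.assoc)
      moreover have "(exp 1 + 1 / exp (1::real))\<^sup>2 > 0" by (intro zero_less_power add_pos_pos) auto
      ultimately have "exp s0 * m (k 0) \<le> 1" by (simp only: mult_le_cancel_left_pos)
      then show ?case by (simp add: exp_minus field_simps)
    next
      case (Suc j)
      define s where "s = real j + s0"
      have s: "2 * N * ln s \<le> s" "1 \<le> s" using s0[of s] by (auto simp: s_def)
      define T where "T = exp (s / 2 - N / 2 * ln s)"
      have lnT: "ln T \<ge> s / 4" using s by (simp add: T_def)
      then have T: "T > 1" using s by (simp add: T_def)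
      define E where "E = exp (- s / 2 - N / 2 * ln s)"
      have Tm: "T * m (k j) \<le> E"
      proof -
        have "T * m (k j) \<le> T * exp (- s)" using Suc.IH T by (intro mult_left_mono) (auto simp: s_def)
        also have "\<dots> = exp (s / 2 - N / 2 * ln s + - s)" by (simp only: T_def exp_add)
        also have "\<dots> = E" by (simp add: E_def algebra_simps)
        finally show ?thesis .
      qed
      have tail: "1 / (T * ln T powr N) \<le> 4 powr N * E"
      proof -
        have "(s / 4) powr N \<le> ln T powr N" using lnT s N by (intro powr_mono2) auto
        then have "1 / (T * ln T powr N) \<le> 1 / (T * (s / 4) powr N)"
          using T s by (intro divide_left_mono mult_left_mono mult_pos_pos) auto
        also have "(s / 4) powr N = exp (N * ln s) / 4 powr N"
          using s by (simp add: powr_divide powr_def[of s])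
        also have "1 / (T * (exp (N * ln s) / 4 powr N)) = 4 powr N * (1 / (T * exp (N * ln s)))"
          by simp
        also have "1 / (T * exp (N * ln s)) = E"
        proof -
          have "T * exp (N * ln s) * E = exp (s / 2 - N / 2 * ln s + N * ln s + (- s / 2 - N / 2 * ln s))"
            by (simp only: T_def E_def exp_add)
          also have "s / 2 - N / 2 * ln s + N * ln s + (- s / 2 - N / 2 * ln s) = 0"
            by (simp add: field_simps)
          finally have "E * (T * exp (N * ln s)) = 1" by (simp add: ac_simps)
          moreover have "T * exp (N * ln s) \<noteq> 0" using T by simp
          ultimately show ?thesis by (metis nonzero_eq_divide_eq)
        qed
        finally show ?thesis .
      qed
      have h: "\<Lambda> * H j > 0" using \<Lambda> H_nonneg by simp
      have "\<Lambda> * H j * m (k j + \<Lambda> * H j) \<le> \<Lambda> * (T * m (k j) + 1 / (T * ln T powr N))\<^sup>2"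
        using order_trans[OF chebyshev[OF h] est[OF k_nonneg T]] by (simp add: m_def)
      also have "\<dots> \<le> \<Lambda> * (E + 4 powr N * E)\<^sup>2"
        using Tm tail T lnT s m0 \<Lambda> by (intro mult_left_mono power_mono add_mono) auto
      also have "\<dots> = \<Lambda> * (A * E\<^sup>2)" by (simp add: A_def algebra_simps power2_eq_square)
      finally have "H j * m (k j + \<Lambda> * H j) \<le> A * E\<^sup>2"
        using \<Lambda> by (simp add: mult.assoc)
      moreover have "A * E\<^sup>2 = H j * exp (- (s + 1))"
      proof -
        have "H j = A * (exp 1 * exp (- N * ln s))"
          using s by (simp add: H_def powr_def s_def[symmetric])
        moreover have "exp 1 * exp (- N * ln s) * exp (- (s + 1)) = exp (1 + - N * ln s + - (s + 1))"
          by (simp only: exp_add)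
        moreover have "1 + - N * ln s + - (s + 1) = 2 * (- s / 2 - N / 2 * ln s)"
          by (simp add: algebra_simps)
        moreover have "E\<^sup>2 = exp (2 * (- s / 2 - N / 2 * ln s))" by (simp only: E_def exp_double)
        ultimately show ?thesis by (simp only: mult.assoc)
      qed
      ultimately have "m (k j + \<Lambda> * H j) \<le> exp (- (s + 1))"
        using H_nonneg[of j] by (simp add: mult_le_cancel_left_pos)
      moreover have "k (Suc j) = k j + \<Lambda> * H j" by (simp add: k_def algebra_simps)
      ultimately show ?case by (simp add: s_def add_ac)
    qed
    have "m (C * \<Lambda>) \<le> exp (- (real j + s0))" for j
    proof -
      have "(\<Sum>i<j. H i) \<le> suminf H" using H_sum H_nonneg by (intro sum_le_suminf) (auto simp: less_imp_le)
      then have "k j \<le> C * \<Lambda>" using \<Lambda> by (simp add: k_def C_def mult.commute)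
      then have "m (C * \<Lambda>) \<le> m (k j)" unfolding m_def by (intro finite_measure_mono) auto
      then show ?thesis using decay[of j] by linarith
    qed
    moreover have "(\<lambda>j. exp (- (real j + s0))) \<longlonglongrightarrow> 0" by real_asymp
    ultimately have "m (C * \<Lambda>) \<le> 0"
      by (intro tendsto_lowerbound[of "\<lambda>j. exp (- (real j + s0))"]) auto
    then have "m (C * \<Lambda>) = 0" using m0[of "C * \<Lambda>"] by simp
    then have "AE x in M. \<not> u x > C * \<Lambda>" by (simp add: m_def prob_eq_0)
    then show ?thesis by (simp add: not_less)
  qed
  show ?thesis
    by (intro exI[of _ C] conjI C allI impI, rule main) auto
qed

section \<open>The Dirichlet problem\<close>

locale orlicz_sobolev_domain = lipschitz_square_root S B
  for S :: "real^'n \<Rightarrow> real^'n^'n" and B :: "(real^'n) set" +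
  fixes \<phi> :: "real \<Rightarrow> ennreal" and N C0 :: real
  assumes B_nonempty: "B \<noteq> {}" and N_gt_1: "N > 1"
    and \<phi>_even: "\<And>t. \<phi> (- t) = \<phi> t"
    and \<phi>_square: "\<And>t. t \<ge> 0 \<Longrightarrow> ennreal (t\<^sup>2) \<le> \<phi> t"
    and \<phi>_log: "\<And>t. t \<ge> 1 \<Longrightarrow> ennreal (t\<^sup>2 * ln t powr N) \<le> \<phi> t"
    and orlicz_sobolev: "\<And>w. w \<in> W12A_0 S B \<Longrightarrow>
      luxemburg_norm (normalized_lebesgue_on B) \<phi> w \<le>
        ennreal (C0 * sqrt (\<integral>x. (norm (A_grad S B w x))\<^sup>2 \<partial>normalized_lebesgue_on B))"
begin

abbreviation "\<mu> \<equiv> normalized_lebesgue_on B"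

definition vol :: real where "vol = measure lebesgue B"
text \<open>The summand \<open>1\<close> keeps the constant positive; \<open>C0\<close> itself may have any sign.\<close>
definition \<kappa> :: real where "\<kappa> = \<bar>C0\<bar> + 1"

lemma kappa_pos: "\<kappa> > 0" by (simp add: \<kappa>_def)

lemma B_lmeasurable: "B \<in> lmeasurable"
  using bounded_B B_sets by (intro bounded_set_imp_lmeasurable)

lemma vol_pos: "vol > 0"
proof -
  have "\<not> negligible B" using open_B B_nonempty by (rule open_not_negligible)
  then have "vol \<noteq> 0" using B_lmeasurable by (simp add: vol_def negligible_iff_measure0)
  then show ?thesis by (simp add: vol_def less_le)
qed

lemma emeasure_B: "emeasure M B = ennreal vol"
  using B_sets B_lmeasurable by (simp add: emeasure_restrict_space emeasure_eq_measure2 vol_def)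

lemma mu_eq_density: "\<mu> = density M (\<lambda>x. ennreal (1 / vol))"
  unfolding normalized_lebesgue_on_def uniform_measure_def emeasure_B
proof (rule density_cong)
  show "(\<lambda>x. indicator B x / ennreal vol) \<in> borel_measurable M"
    by (subst measurable_cong[of _ _ "\<lambda>x. 1 / ennreal vol"]) auto
  show "AE x in M. indicator B x / ennreal vol = ennreal (1 / vol)"
    using vol_pos by (auto simp: divide_ennreal ennreal_1[symmetric] simp del: ennreal_1)
qed simp

lemma sets_mu [simp]: "sets \<mu> = sets M" and space_mu [simp]: "space \<mu> = B"
  by (simp_all add: mu_eq_density)

lemma borel_measurable_mu [simp]: "borel_measurable \<mu> = borel_measurable M"
  by (rule measurable_cong_sets) simp_all

lemma prob_space_mu: "prob_space \<mu>"
  unfolding normalized_lebesgue_on_def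
  by (rule prob_space_uniform_measure) (use vol_pos in \<open>auto simp: emeasure_B\<close>)

lemma AE_mu_iff: "(AE x in \<mu>. P x) \<longleftrightarrow> (AE x in M. P x)"
  unfolding mu_eq_density using vol_pos by (subst AE_density) auto

lemma integral_mu:
  fixes f :: "real^'n \<Rightarrow> real"
  assumes "f \<in> borel_measurable M" shows "(\<integral>x. f x \<partial>\<mu>) = (\<integral>x. f x \<partial>M) / vol"
  using assms vol_pos by (simp add: mu_eq_density integral_density)

lemma integrable_mu:
  fixes f :: "real^'n \<Rightarrow> real"
  assumes "integrable M f" shows "integrable \<mu> f"
  using assms vol_pos by (simp add: mu_eq_density integrable_density)

definition energy :: "(real^'n \<Rightarrow> real) \<Rightarrow> real" where
  "energy \<psi> = (\<integral>x. (norm (grad_S \<psi> x))\<^sup>2 \<partial>M)"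

lemma energy_nonneg: "energy \<psi> \<ge> 0" by (simp add: energy_def)

lemma luxemburg_norm_le:
  assumes "u \<in> W12A_0 S B"
  shows "luxemburg_norm \<mu> \<phi> u \<le> ennreal (\<kappa> * sqrt ((\<integral>x. (norm (A_grad S B u x))\<^sup>2 \<partial>M) / vol))"
proof -
  have u: "u \<in> W12A S B" using assms by (simp add: W12A_0_def)
  have "(\<lambda>x. (norm (A_grad S B u x))\<^sup>2) \<in> borel_measurable M"
    using integrable_norm_square[OF A_grad_L2[OF u]] by simp
  then have "luxemburg_norm \<mu> \<phi> u \<le> ennreal (C0 * sqrt ((\<integral>x. (norm (A_grad S B u x))\<^sup>2 \<partial>M) / vol))"
    using orlicz_sobolev[OF assms] by (simp only: integral_mu)
  also have "\<dots> \<le> ennreal (\<kappa> * sqrt ((\<integral>x. (norm (A_grad S B u x))\<^sup>2 \<partial>M) / vol))"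
    using vol_pos by (intro ennreal_leI mult_right_mono) (auto simp: \<kappa>_def)
  finally show ?thesis .
qed

text \<open>The part \<open>\<phi>(t) \<ge> t\<^sup>2\<close> of the Orlicz--Sobolev inequality. Both integrals carry the same factor
  \<open>1 / |B|\<close>, so the constant does not depend on the volume.\<close>
lemma poincare_W12A_0:
  assumes "u \<in> W12A_0 S B"
  shows "(\<integral>x. (u x)\<^sup>2 \<partial>M) \<le> \<kappa>\<^sup>2 * (\<integral>x. (norm (A_grad S B u x))\<^sup>2 \<partial>M)"
proof -
  define e where "e = (\<integral>x. (norm (A_grad S B u x))\<^sup>2 \<partial>M)"
  have e: "e \<ge> 0" by (simp add: e_def)
  have "u \<in> W12A S B" using assms by (simp add: W12A_0_def)
  then have u: "square_integrable M u" by (rule W12A_L2)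
  then have [measurable]: "u \<in> borel_measurable M" by (rule square_integrable_measurable)
  have "ennreal (t\<^sup>2) \<le> \<phi> t" for t
    using \<phi>_square[of t] \<phi>_square[of "- t"] \<phi>_even[of t] by (cases "t \<ge> 0") auto
  then have "(\<integral>x. (u x)\<^sup>2 \<partial>\<mu>) \<le> (\<kappa> * sqrt (e / vol))\<^sup>2"
    using luxemburg_norm_le[OF assms] kappa_pos vol_pos e
    by (intro integral_square_le_of_luxemburg_norm[where \<phi> = \<phi>]) (auto simp: e_def)
  then have "(\<integral>x. (u x)\<^sup>2 \<partial>M) / vol \<le> \<kappa>\<^sup>2 * (e / vol)"
    using e vol_pos by (simp add: integral_mu power_mult_distrib)
  then show ?thesis using vol_pos by (simp add: e_def field_simps)
qed

lemma integral_A_grad_Lip_c: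
  assumes "\<psi> \<in> Lip_c B"
  shows "(\<integral>x. (norm (A_grad S B \<psi> x))\<^sup>2 \<partial>M) = energy \<psi>"
  unfolding energy_def
proof (rule integral_cong_AE)
  show "AE x in M. (norm (A_grad S B \<psi> x))\<^sup>2 = (norm (grad_S \<psi> x))\<^sup>2"
    using A_grad_Lip_c[OF assms] by (rule eventually_mono) simp
  show "(\<lambda>x. (norm (A_grad S B \<psi> x))\<^sup>2) \<in> borel_measurable M"
    using integrable_norm_square[OF A_grad_L2[OF Lip_c_W12A[OF assms]]] by simp
  show "(\<lambda>x. (norm (grad_S \<psi> x))\<^sup>2) \<in> borel_measurable M"
    using integrable_norm_square[OF grad_S_L2[OF assms]] by simp
qed

lemma poincare_Lip_c:
  "\<psi> \<in> Lip_c B \<Longrightarrow> (\<integral>x. (\<psi> x)\<^sup>2 \<partial>M) \<le> \<kappa>\<^sup>2 * energy \<psi>"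
  using poincare_W12A_0[OF Lip_c_W12A_0] by (simp add: integral_A_grad_Lip_c)

lemma log_bump_Lip_c:
  assumes w: "w \<in> Lip_c B" "\<And>x. w x \<ge> 0" and e: "energy w \<le> e" and K: "K > \<kappa> * sqrt (e / vol)"
    and T: "T > 1" and E: "E \<in> sets M"
  shows "(\<integral>x. indicator E x * w x \<partial>\<mu>) \<le> K * (T * measure \<mu> E + 1 / (T * ln T powr N))"
proof (rule prob_space.integral_indicator_le_of_luxemburg_norm[OF prob_space_mu \<phi>_log, where L = "\<kappa> * sqrt (energy w / vol)"])
  show "integrable \<mu> w"
    by (intro integrable_mu square_integrable_integrable[OF finite_measure_B] Lip_c_L2 w)
  show "luxemburg_norm \<mu> \<phi> w \<le> ennreal (\<kappa> * sqrt (energy w / vol))"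
    using luxemburg_norm_le[OF Lip_c_W12A_0[OF w(1)]] by (simp add: integral_A_grad_Lip_c[OF w(1)])
  have "\<kappa> * sqrt (energy w / vol) \<le> \<kappa> * sqrt (e / vol)"
    using e kappa_pos vol_pos by (intro mult_left_mono) (auto simp: divide_right_mono)
  then show "\<kappa> * sqrt (energy w / vol) < K" using K by simp
  show "0 \<le> \<kappa> * sqrt (energy w / vol)" using kappa_pos vol_pos energy_nonneg by simp
qed (use w T E N_gt_1 in auto)

text \<open>Its Euler--Lagrange equation is the weak form of \<open>\<nabla>\<cdot>A\<nabla>u = f\<close>.\<close>
definition J :: "(real^'n \<Rightarrow> real) \<Rightarrow> (real^'n \<Rightarrow> real) \<Rightarrow> real" where
  "J f \<psi> = energy \<psi> / 2 + (\<integral>x. f x * \<psi> x \<partial>M)"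

text \<open>Almost minimizers within \<open>Lip_c B\<close> always exist, whereas the minimizer itself need not be Lipschitz.\<close>
definition almost_minimizer :: "(real^'n \<Rightarrow> real) \<Rightarrow> real \<Rightarrow> (real^'n \<Rightarrow> real) \<Rightarrow> bool" where
  "almost_minimizer f \<epsilon> \<psi> \<longleftrightarrow> \<psi> \<in> Lip_c B \<and> (\<forall>\<eta>\<in>Lip_c B. J f \<psi> \<le> J f \<eta> + \<epsilon>)"

lemma almost_minimizerD:
  "almost_minimizer f \<epsilon> \<psi> \<Longrightarrow> \<psi> \<in> Lip_c B"
  "almost_minimizer f \<epsilon> \<psi> \<Longrightarrow> \<eta> \<in> Lip_c B \<Longrightarrow> J f \<psi> \<le> J f \<eta> + \<epsilon>"
  by (auto simp: almost_minimizer_def)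

lemma integrable_mult_Lip_c:
  "square_integrable M f \<Longrightarrow> \<psi> \<in> Lip_c B \<Longrightarrow> integrable M (\<lambda>x. f x * \<psi> x)"
  using square_integrable_inner[OF _ Lip_c_L2, of f \<psi>] by simp

lemma Lip_c_lincomb:
  "\<psi> \<in> Lip_c B \<Longrightarrow> \<eta> \<in> Lip_c B \<Longrightarrow> (\<lambda>x. a * \<psi> x + b * \<eta> x) \<in> Lip_c B"
  by (intro Lip_c_add Lip_c_scale)

lemma energy_lincomb:
  assumes \<psi>: "\<psi> \<in> Lip_c B" and \<eta>: "\<eta> \<in> Lip_c B"
  shows "energy (\<lambda>x. a * \<psi> x + b * \<eta> x) =
    a\<^sup>2 * energy \<psi> + 2 * a * b * (\<integral>x. grad_S \<psi> x \<bullet> grad_S \<eta> x \<partial>M) + b\<^sup>2 * energy \<eta>"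
proof -
  note sq = grad_S_L2[OF \<psi>] grad_S_L2[OF \<eta>]
  note int = integrable_norm_square[OF sq(1)] integrable_norm_square[OF sq(2)]
    square_integrable_inner[OF sq]
  have "energy (\<lambda>x. a * \<psi> x + b * \<eta> x) = (\<integral>x. a\<^sup>2 * (norm (grad_S \<psi> x))\<^sup>2 +
      2 * a * b * (grad_S \<psi> x \<bullet> grad_S \<eta> x) + b\<^sup>2 * (norm (grad_S \<eta> x))\<^sup>2 \<partial>M)"
    unfolding energy_def
  proof (rule integral_cong_AE)
    show "AE x in M. (norm (grad_S (\<lambda>x. a * \<psi> x + b * \<eta> x) x))\<^sup>2 = a\<^sup>2 * (norm (grad_S \<psi> x))\<^sup>2 +
      2 * a * b * (grad_S \<psi> x \<bullet> grad_S \<eta> x) + b\<^sup>2 * (norm (grad_S \<eta> x))\<^sup>2"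
      using grad_S_lincomb[OF \<psi> \<eta>, of a b]
    proof eventually_elim
      case (elim x)
      show ?case unfolding elim power2_norm_eq_inner
        by (simp add: inner_add_left inner_add_right inner_commute power2_eq_square algebra_simps)
    qed
    show "(\<lambda>x. (norm (grad_S (\<lambda>x. a * \<psi> x + b * \<eta> x) x))\<^sup>2) \<in> borel_measurable M"
      using integrable_norm_square[OF grad_S_L2[OF Lip_c_lincomb[OF \<psi> \<eta>]]] by simp
  qed (use int in measurable)
  also have "\<dots> = a\<^sup>2 * energy \<psi> + 2 * a * b * (\<integral>x. grad_S \<psi> x \<bullet> grad_S \<eta> x \<partial>M) + b\<^sup>2 * energy \<eta>"
    using int by (simp add: energy_def)
  finally show ?thesis .
qed

lemma J_lincomb:
  assumes f: "square_integrable M f" and \<psi>: "\<psi> \<in> Lip_c B" and \<eta>: "\<eta> \<in> Lip_c B"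
  shows "J f (\<lambda>x. a * \<psi> x + b * \<eta> x) =
    (a\<^sup>2 * energy \<psi> + 2 * a * b * (\<integral>x. grad_S \<psi> x \<bullet> grad_S \<eta> x \<partial>M) + b\<^sup>2 * energy \<eta>) / 2
      + a * (\<integral>x. f x * \<psi> x \<partial>M) + b * (\<integral>x. f x * \<eta> x \<partial>M)"
proof -
  have "(\<integral>x. f x * (a * \<psi> x + b * \<eta> x) \<partial>M) = (\<integral>x. a * (f x * \<psi> x) + b * (f x * \<eta> x) \<partial>M)"
    by (intro Bochner_Integration.integral_cong refl) (simp add: algebra_simps)
  also have "\<dots> = a * (\<integral>x. f x * \<psi> x \<partial>M) + b * (\<integral>x. f x * \<eta> x \<partial>M)"
    using integrable_mult_Lip_c[OF f \<psi>] integrable_mult_Lip_c[OF f \<eta>] by simp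
  finally show ?thesis unfolding J_def energy_lincomb[OF \<psi> \<eta>] by simp
qed

text \<open>Cauchy--Schwarz and the Poincare inequality bound the linear term by \<open>\<kappa> \<parallel>f\<parallel>\<^sub>2 (energy \<psi>)\<^sup>1\<^sup>/\<^sup>2\<close>,
  which the term \<open>energy \<psi> / 2\<close> absorbs.\<close>
lemma J_bounded_below:
  assumes f: "square_integrable M f" and \<psi>: "\<psi> \<in> Lip_c B"
  shows "J f \<psi> \<ge> - (\<kappa>\<^sup>2 * (\<integral>x. (f x)\<^sup>2 \<partial>M)) / 2"
proof -
  define F e where "F = (\<integral>x. (f x)\<^sup>2 \<partial>M)" and "e = energy \<psi>"
  have nn: "F \<ge> 0" "e \<ge> 0" by (auto simp: F_def e_def energy_nonneg)
  have "\<bar>\<integral>x. f x * \<psi> x \<partial>M\<bar> \<le> sqrt F * sqrt (\<integral>x. (\<psi> x)\<^sup>2 \<partial>M)"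
    using abs_integral_inner_le[OF f Lip_c_L2[OF \<psi>]] by (simp add: F_def)
  also have "\<dots> \<le> sqrt F * sqrt (\<kappa>\<^sup>2 * e)"
    using poincare_Lip_c[OF \<psi>] nn by (intro mult_left_mono) (auto simp: e_def)
  also have "\<dots> = (\<kappa> * sqrt F) * sqrt e" using kappa_pos by (simp add: real_sqrt_mult)
  also have "\<dots> \<le> ((\<kappa> * sqrt F)\<^sup>2 + (sqrt e)\<^sup>2) / 2"
    using sum_squares_bound[of "\<kappa> * sqrt F" "sqrt e"] by simp
  also have "\<dots> = (\<kappa>\<^sup>2 * F + e) / 2" using nn by (simp add: power_mult_distrib)
  finally show ?thesis unfolding J_def F_def[symmetric] e_def[symmetric] by (simp add: field_simps abs_le_iff)
qed

lemma almost_minimizer_exists: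
  assumes f: "square_integrable M f" and \<epsilon>: "\<epsilon> > 0"
  shows "\<exists>\<psi>. almost_minimizer f \<epsilon> \<psi>"
proof -
  define I where "I = Inf (J f ` Lip_c B)"
  have bdd: "bdd_below (J f ` Lip_c B)"
    using J_bounded_below[OF f] by (intro bdd_belowI2)
  have ne: "J f ` Lip_c B \<noteq> {}" using Lip_c_zero by blast
  obtain \<psi> where \<psi>: "\<psi> \<in> Lip_c B" "J f \<psi> < I + \<epsilon>"
    using cInf_lessD[OF ne, of "I + \<epsilon>"] \<epsilon> by (auto simp: I_def)
  have "I \<le> J f \<eta>" if "\<eta> \<in> Lip_c B" for \<eta>
    unfolding I_def using that bdd by (intro cInf_lower) auto
  then show ?thesis using \<psi> by (intro exI[of _ \<psi>]) (force simp: almost_minimizer_def)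
qed

text \<open>The parallelogram law: the midpoint of two functions undercuts the mean of their functionals by
  an eighth of the energy of their difference.\<close>
lemma almost_minimizers_close:
  assumes f: "square_integrable M f" and \<psi>: "almost_minimizer f \<epsilon> \<psi>" and \<eta>: "almost_minimizer f \<delta> \<eta>"
  shows "energy (\<lambda>x. \<psi> x - \<eta> x) \<le> 4 * (\<epsilon> + \<delta>)"
proof -
  note L = almost_minimizerD(1)[OF \<psi>] almost_minimizerD(1)[OF \<eta>]
  define mid where "mid = (\<lambda>x. 1/2 * \<psi> x + 1/2 * \<eta> x)"
  have mid: "mid \<in> Lip_c B" unfolding mid_def by (rule Lip_c_lincomb[OF L])
  have "energy (\<lambda>x. \<psi> x - \<eta> x) = energy \<psi> - 2 * (\<integral>x. grad_S \<psi> x \<bullet> grad_S \<eta> x \<partial>M) + energy \<eta>"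
    using energy_lincomb[OF L, of 1 "-1"] by simp
  moreover have "J f mid = (energy \<psi> / 4 + (\<integral>x. grad_S \<psi> x \<bullet> grad_S \<eta> x \<partial>M) / 2 + energy \<eta> / 4) / 2
      + (\<integral>x. f x * \<psi> x \<partial>M) / 2 + (\<integral>x. f x * \<eta> x \<partial>M) / 2"
    unfolding mid_def J_lincomb[OF f L] by (simp add: power2_eq_square)
  ultimately show ?thesis
    using almost_minimizerD(2)[OF \<psi> mid] almost_minimizerD(2)[OF \<eta> mid] unfolding J_def[of f \<psi>] J_def[of f \<eta>]
    by argo
qed

text \<open>The comparison function \<open>\<psi> + t \<eta>\<close>; dividing by small \<open>t\<close> of either sign, once \<open>\<epsilon>\<close> has tended
  to zero, yields the weak equation.\<close>
lemma almost_minimizer_variation: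
  assumes f: "square_integrable M f" and \<psi>: "almost_minimizer f \<epsilon> \<psi>" and \<eta>: "\<eta> \<in> Lip_c B"
  shows "t * ((\<integral>x. grad_S \<psi> x \<bullet> grad_S \<eta> x \<partial>M) + (\<integral>x. f x * \<eta> x \<partial>M)) + t\<^sup>2 / 2 * energy \<eta> \<ge> - \<epsilon>"
proof -
  note L = almost_minimizerD(1)[OF \<psi>] \<eta>
  have "J f \<psi> \<le> J f (\<lambda>x. 1 * \<psi> x + t * \<eta> x) + \<epsilon>"
    by (rule almost_minimizerD(2)[OF \<psi> Lip_c_lincomb[OF L]])
  then show ?thesis unfolding J_lincomb[OF f L] J_def[of f \<psi>] by (simp add: algebra_simps add_divide_distrib)
qed

lemma energy_truncation:
  assumes k: "k \<ge> 0" and \<psi>: "\<psi> \<in> Lip_c B"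
  shows "energy \<psi> = energy (\<lambda>x. min (\<psi> x) k) + energy (\<lambda>x. max 0 (\<psi> x - k))"
proof -
  note L = Lip_c_min[OF k \<psi>] Lip_c_max[OF k \<psi>]
  note int = integrable_norm_square[OF grad_S_L2[OF L(1)]]
    integrable_norm_square[OF grad_S_L2[OF L(2)]]
  have "energy \<psi> = (\<integral>x. (norm (grad_S (\<lambda>x. min (\<psi> x) k) x))\<^sup>2 + (norm (grad_S (\<lambda>x. max 0 (\<psi> x - k)) x))\<^sup>2 \<partial>M)"
    unfolding energy_def
    using grad_S_truncation[OF k \<psi>] integrable_norm_square[OF grad_S_L2[OF \<psi>]] int
    by (intro integral_cong_AE) auto
  then show ?thesis using int by (simp add: energy_def)
qed

text \<open>Comparison with \<open>min \<psi> k\<close>: both parts of the functional are additive over the two pieces of \<open>\<psi>\<close>.\<close>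
lemma almost_minimizer_truncation:
  assumes f: "square_integrable M f" and \<psi>: "almost_minimizer f \<epsilon> \<psi>" and k: "k \<ge> 0"
  shows "energy (\<lambda>x. max 0 (\<psi> x - k)) / 2 + (\<integral>x. f x * max 0 (\<psi> x - k) \<partial>M) \<le> \<epsilon>"
proof -
  note \<psi>L = almost_minimizerD(1)[OF \<psi>]
  note L = Lip_c_min[OF k \<psi>L] Lip_c_max[OF k \<psi>L]
  have "(\<integral>x. f x * \<psi> x \<partial>M) = (\<integral>x. f x * min (\<psi> x) k + f x * max 0 (\<psi> x - k) \<partial>M)"
    by (intro Bochner_Integration.integral_cong refl) (simp add: min_def max_def algebra_simps)
  also have "\<dots> = (\<integral>x. f x * min (\<psi> x) k \<partial>M) + (\<integral>x. f x * max 0 (\<psi> x - k) \<partial>M)"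
    by (intro Bochner_Integration.integral_add integrable_mult_Lip_c[OF f] L)
  finally have "(\<integral>x. f x * \<psi> x \<partial>M) = (\<integral>x. f x * min (\<psi> x) k \<partial>M) + (\<integral>x. f x * max 0 (\<psi> x - k) \<partial>M)" .
  then show ?thesis
    using almost_minimizerD(2)[OF \<psi> L(1)] energy_truncation[OF k \<psi>L] unfolding J_def by (simp add: field_simps)
qed

lemma almost_minimizer_uminus:
  assumes f: "square_integrable M f" and \<psi>: "almost_minimizer f \<epsilon> \<psi>"
  shows "almost_minimizer (\<lambda>x. - f x) \<epsilon> (\<lambda>x. - \<psi> x)"
proof -
  have neg: "(\<lambda>x. - \<eta> x) \<in> Lip_c B" if "\<eta> \<in> Lip_c B" for \<eta>
    using Lip_c_scale[OF that, of "-1"] by simp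
  have "energy (\<lambda>x. - \<eta> x) = energy \<eta>" if "\<eta> \<in> Lip_c B" for \<eta>
    using energy_lincomb[OF that that, of "-1" 0] by simp
  then have J: "J (\<lambda>x. - f x) (\<lambda>x. - \<eta> x) = J f \<eta>" if "\<eta> \<in> Lip_c B" for \<eta>
    using that by (simp add: J_def)
  have "J (\<lambda>x. - f x) (\<lambda>x. - \<psi> x) \<le> J (\<lambda>x. - f x) \<eta> + \<epsilon>" if "\<eta> \<in> Lip_c B" for \<eta>
    using J[OF neg[OF that]] J[OF almost_minimizerD(1)[OF \<psi>]] almost_minimizerD(2)[OF \<psi> neg[OF that]] by simp
  then show ?thesis using neg[OF almost_minimizerD(1)[OF \<psi>]] by (simp add: almost_minimizer_def)
qed

lemma W12A_0_W12A: "u \<in> W12A_0 S B \<Longrightarrow> u \<in> W12A S B"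
  by (simp add: W12A_0_def)

lemma weak_solution_iff:
  assumes u: "u \<in> W12A_0 S B"
  shows "weak_Dirichlet_solution S B f u \<longleftrightarrow>
    (\<forall>\<psi>\<in>Lip_c B. (\<integral>x. A_grad S B u x \<bullet> grad_S \<psi> x \<partial>M) = - (\<integral>x. f x * \<psi> x \<partial>M))"
proof -
  have "(\<integral>x. A_grad S B u x \<bullet> A_grad S B \<psi> x \<partial>M) = (\<integral>x. A_grad S B u x \<bullet> grad_S \<psi> x \<partial>M)"
    if \<psi>: "\<psi> \<in> Lip_c B" for \<psi>
  proof (rule integral_cong_AE)
    note sq = A_grad_L2[OF W12A_0_W12A[OF u]] A_grad_L2[OF Lip_c_W12A[OF \<psi>]]
      grad_S_L2[OF \<psi>]
    show "(\<lambda>x. A_grad S B u x \<bullet> A_grad S B \<psi> x) \<in> borel_measurable M"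
      using square_integrable_inner[OF sq(1,2)] by simp
    show "(\<lambda>x. A_grad S B u x \<bullet> grad_S \<psi> x) \<in> borel_measurable M"
      using square_integrable_inner[OF sq(1,3)] by simp
    show "AE x in M. A_grad S B u x \<bullet> A_grad S B \<psi> x = A_grad S B u x \<bullet> grad_S \<psi> x"
      using A_grad_Lip_c[OF \<psi>] by (rule eventually_mono) simp
  qed
  then show ?thesis using u by (simp add: weak_Dirichlet_solution_def)
qed

text \<open>The difference \<open>w\<close> of two solutions is orthogonal to the gradients of all test functions, hence to
  those approximating \<open>w\<close> itself. So its energy is zero, and the Poincare inequality gives \<open>w = 0\<close>.\<close>
lemma weak_solution_unique:
  assumes u: "weak_Dirichlet_solution S B f u" and v: "weak_Dirichlet_solution S B f v"
  shows "AE x in M. v x = u x"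
proof -
  have u0: "u \<in> W12A_0 S B" and v0: "v \<in> W12A_0 S B"
    using u v by (auto simp: weak_Dirichlet_solution_def)
  obtain \<psi> where \<psi>: "\<And>m::nat. \<psi> m \<in> Lip_c B" "(\<lambda>m. l2_dist M (\<psi> m) u) \<longlonglongrightarrow> 0"
    "(\<lambda>m. l2_dist M (grad_S (\<psi> m)) (A_grad S B u)) \<longlonglongrightarrow> 0"
    by (rule W12A_0_approx[OF u0]) (rule that)
  obtain \<eta> where \<eta>: "\<And>m::nat. \<eta> m \<in> Lip_c B" "(\<lambda>m. l2_dist M (\<eta> m) v) \<longlonglongrightarrow> 0"
    "(\<lambda>m. l2_dist M (grad_S (\<eta> m)) (A_grad S B v)) \<longlonglongrightarrow> 0"
    by (rule W12A_0_approx[OF v0]) (rule that)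
  note sq = W12A_L2[OF W12A_0_W12A[OF u0]] W12A_L2[OF W12A_0_W12A[OF v0]]
    A_grad_L2[OF W12A_0_W12A[OF u0]] A_grad_L2[OF W12A_0_W12A[OF v0]]
  define \<zeta> where "\<zeta> m x = \<psi> m x - \<eta> m x" for m x
  define w where "w x = u x - v x" for x
  define G where "G x = A_grad S B u x - A_grad S B v x" for x
  have \<zeta>: "\<zeta> m \<in> Lip_c B" for m unfolding \<zeta>_def by (rule Lip_c_diff[OF \<psi>(1) \<eta>(1)])
  have w: "square_integrable M w" and G: "square_integrable M G"
    unfolding w_def G_def using sq by (auto intro: square_integrable_diff)
  have lim_w: "(\<lambda>m. l2_dist M (\<zeta> m) w) \<longlonglongrightarrow> 0"
  proof (rule Lim_null_comparison[OF always_eventually], rule allI)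
    show "norm (l2_dist M (\<zeta> m) w) \<le> 2 * l2_dist M (\<psi> m) u + 2 * l2_dist M (\<eta> m) v" for m
      using l2_dist_diff_le[OF Lip_c_L2[OF \<psi>(1)[of m]] sq(1) Lip_c_L2[OF \<eta>(1)[of m]] sq(2)]
      unfolding \<zeta>_def w_def by (simp add: l2_dist_nonneg)
    show "(\<lambda>m. 2 * l2_dist M (\<psi> m) u + 2 * l2_dist M (\<eta> m) v) \<longlonglongrightarrow> 0"
      using tendsto_add[OF tendsto_mult_left[OF \<psi>(2), of 2] tendsto_mult_left[OF \<eta>(2), of 2]] by simp
  qed
  have lim_G: "(\<lambda>m. l2_dist M (grad_S (\<zeta> m)) G) \<longlonglongrightarrow> 0"
  proof (rule Lim_null_comparison[OF always_eventually], rule allI)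
    fix m
    note sqm = grad_S_L2[OF \<psi>(1)[of m]] grad_S_L2[OF \<eta>(1)[of m]]
    have "l2_dist M (grad_S (\<zeta> m)) G = l2_dist M (\<lambda>x. grad_S (\<psi> m) x - grad_S (\<eta> m) x) G"
      unfolding l2_dist_def
    proof (rule integral_cong_AE)
      show "AE x in M. (norm (grad_S (\<zeta> m) x - G x))\<^sup>2 = (norm (grad_S (\<psi> m) x - grad_S (\<eta> m) x - G x))\<^sup>2"
        using grad_S_diff[OF \<psi>(1)[of m] \<eta>(1)[of m]] unfolding \<zeta>_def by (rule eventually_mono) simp
      show "(\<lambda>x. (norm (grad_S (\<zeta> m) x - G x))\<^sup>2) \<in> borel_measurable M"
        using integrable_norm_square[OF square_integrable_diff[OF grad_S_L2[OF \<zeta>] G]] by simp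
      show "(\<lambda>x. (norm (grad_S (\<psi> m) x - grad_S (\<eta> m) x - G x))\<^sup>2) \<in> borel_measurable M"
        using integrable_norm_square[OF square_integrable_diff[OF square_integrable_diff[OF sqm] G]] by simp
    qed
    then show "norm (l2_dist M (grad_S (\<zeta> m)) G) \<le>
        2 * l2_dist M (grad_S (\<psi> m)) (A_grad S B u) + 2 * l2_dist M (grad_S (\<eta> m)) (A_grad S B v)"
      using l2_dist_diff_le[OF sqm(1) sq(3) sqm(2) sq(4)] unfolding G_def by (simp add: l2_dist_nonneg)
  next
    show "(\<lambda>m. 2 * l2_dist M (grad_S (\<psi> m)) (A_grad S B u) + 2 * l2_dist M (grad_S (\<eta> m)) (A_grad S B v)) \<longlonglongrightarrow> 0"
      using tendsto_add[OF tendsto_mult_left[OF \<psi>(3), of 2] tendsto_mult_left[OF \<eta>(3), of 2]] by simp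
  qed
  have w0: "w \<in> W12A_0 S B" and Aw: "AE x in M. A_grad S B w x = G x"
    by (rule W12A_0_limit[OF \<zeta> w G lim_w lim_G])+
  have orth: "(\<integral>x. G x \<bullet> grad_S (\<zeta> m) x \<partial>M) = 0" for m
  proof -
    have "(\<integral>x. G x \<bullet> grad_S (\<zeta> m) x \<partial>M) =
        (\<integral>x. A_grad S B u x \<bullet> grad_S (\<zeta> m) x \<partial>M) - (\<integral>x. A_grad S B v x \<bullet> grad_S (\<zeta> m) x \<partial>M)"
      unfolding G_def inner_diff_left
      by (intro Bochner_Integration.integral_diff square_integrable_inner grad_S_L2 \<zeta> sq)
    also have "\<dots> = 0"
      using u v \<zeta>[of m] by (simp add: weak_solution_iff u0 v0)
    finally show ?thesis .
  qed
  have "(\<lambda>m. \<integral>x. G x \<bullet> grad_S (\<zeta> m) x \<partial>M) \<longlonglongrightarrow> (\<integral>x. G x \<bullet> G x \<partial>M)"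
    by (rule l2_dist_tendsto_inner[OF G G grad_S_L2[OF \<zeta>] G _ lim_G]) simp
  then have "(\<lambda>m::nat. 0::real) \<longlonglongrightarrow> (\<integral>x. (norm (G x))\<^sup>2 \<partial>M)"
    by (simp add: orth power2_norm_eq_inner)
  then have "(\<integral>x. (norm (G x))\<^sup>2 \<partial>M) = 0" using LIMSEQ_unique tendsto_const by metis
  moreover have "(\<integral>x. (norm (A_grad S B w x))\<^sup>2 \<partial>M) = (\<integral>x. (norm (G x))\<^sup>2 \<partial>M)"
    using Aw integrable_norm_square[OF A_grad_L2[OF W12A_0_W12A[OF w0]]]
      integrable_norm_square[OF G]
    by (intro integral_cong_AE) (auto elim: eventually_mono)
  ultimately have "(\<integral>x. (w x)\<^sup>2 \<partial>M) \<le> 0" using poincare_W12A_0[OF w0] by simp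
  moreover have "integrable M (\<lambda>x. (w x)\<^sup>2)" using integrable_norm_square[OF w] by simp
  ultimately have "AE x in M. (w x)\<^sup>2 = 0"
    using integral_nonneg_eq_0_iff_AE[of M "\<lambda>x. (w x)\<^sup>2"] by (simp add: antisym integral_nonneg_AE)
  then show ?thesis by (rule eventually_mono) (simp add: w_def)
qed

text \<open>Convergence of the gradients comes from \<open>almost_minimizers_close\<close>, that of the functions from the
  Poincare inequality, and the equation from the first variation.\<close>
lemma minimizing_sequence_converges:
  assumes f: "square_integrable M f" and \<psi>: "\<And>m::nat. almost_minimizer f (inverse (real (Suc m))) (\<psi> m)"
  obtains u where "square_integrable M u" "(\<lambda>m. l2_dist M (\<psi> m) u) \<longlonglongrightarrow> 0" "weak_Dirichlet_solution S B f u"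
proof -
  note L = almost_minimizerD(1)[OF \<psi>]
  have close: "energy (\<lambda>x. \<psi> m x - \<psi> n x) \<le> 8 * inverse (real (Suc k))" if "m \<ge> k" "n \<ge> k" for m n k
  proof -
    have "inverse (real (Suc m)) \<le> inverse (real (Suc k))" "inverse (real (Suc n)) \<le> inverse (real (Suc k))"
      using that by (simp_all add: le_imp_inverse_le)
    moreover have "e \<le> 8 * c" if "a \<le> c" "b \<le> c" "e \<le> 4 * (a + b)" for a b c e :: real
      using that by argo
    ultimately show ?thesis using almost_minimizers_close[OF f \<psi>[of m] \<psi>[of n]] by blast
  qed
  have dist_grad: "l2_dist M (grad_S (\<psi> m)) (grad_S (\<psi> n)) = energy (\<lambda>x. \<psi> m x - \<psi> n x)" for m n
    unfolding l2_dist_def energy_def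
  proof (rule integral_cong_AE)
    show "AE x in M. (norm (grad_S (\<psi> m) x - grad_S (\<psi> n) x))\<^sup>2 = (norm (grad_S (\<lambda>x. \<psi> m x - \<psi> n x) x))\<^sup>2"
      using grad_S_diff[OF L[of m] L[of n]] by (rule eventually_mono) simp
    show "(\<lambda>x. (norm (grad_S (\<psi> m) x - grad_S (\<psi> n) x))\<^sup>2) \<in> borel_measurable M"
      using integrable_norm_square[OF square_integrable_diff[OF grad_S_L2[OF L[of m]] grad_S_L2[OF L[of n]]]]
      by simp
    show "(\<lambda>x. (norm (grad_S (\<lambda>x. \<psi> m x - \<psi> n x) x))\<^sup>2) \<in> borel_measurable M"
      using integrable_norm_square[OF grad_S_L2[OF Lip_c_diff[OF L[of m] L[of n]]]] by simp
  qed
  have dist: "l2_dist M (\<psi> m) (\<psi> n) \<le> \<kappa>\<^sup>2 * energy (\<lambda>x. \<psi> m x - \<psi> n x)" for m n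
    using poincare_Lip_c[OF Lip_c_diff[OF L[of m] L[of n]]] by (simp add: l2_dist_def)
  have archimedean: "\<exists>k. c * (8 * inverse (real (Suc k))) < e" if "c > 0" "e > 0" for c e :: real
  proof -
    obtain k where "inverse (real (Suc k)) < e / (8 * c)"
      using reals_Archimedean[of "e / (8 * c)"] \<open>c > 0\<close> \<open>e > 0\<close> by auto
    then show ?thesis using \<open>c > 0\<close> by (intro exI[of _ k]) (simp add: field_simps)
  qed
  have k2: "\<kappa>\<^sup>2 > 0" using kappa_pos by simp
  have cauchy: "\<exists>k. \<forall>m\<ge>k. \<forall>n\<ge>k. l2_dist M (\<psi> m) (\<psi> n) < e" if e: "e > 0" for e
  proof -
    obtain k where k: "\<kappa>\<^sup>2 * (8 * inverse (real (Suc k))) < e" using archimedean[OF k2 e] by blast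
    have "l2_dist M (\<psi> m) (\<psi> n) < e" if "m \<ge> k" "n \<ge> k" for m n
      using dist[of m n] mult_left_mono[OF close[OF that], of "\<kappa>\<^sup>2"] k k2 by linarith
    then show ?thesis by blast
  qed
  have cauchy_grad: "\<exists>k. \<forall>m\<ge>k. \<forall>n\<ge>k. l2_dist M (grad_S (\<psi> m)) (grad_S (\<psi> n)) < e" if e: "e > 0" for e
  proof -
    obtain k where k: "1 * (8 * inverse (real (Suc k))) < e" using archimedean[OF zero_less_one e] by blast
    have "l2_dist M (grad_S (\<psi> m)) (grad_S (\<psi> n)) < e" if "m \<ge> k" "n \<ge> k" for m n
      unfolding dist_grad using close[OF that] k by linarith
    then show ?thesis by blast
  qed
  obtain u where u: "square_integrable M u" "(\<lambda>m. l2_dist M (\<psi> m) u) \<longlonglongrightarrow> 0"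
    by (rule l2_complete[OF Lip_c_L2[OF L]], erule cauchy, rule that)
  obtain G where G: "square_integrable M G" "(\<lambda>m. l2_dist M (grad_S (\<psi> m)) G) \<longlonglongrightarrow> 0"
    by (rule l2_complete[OF grad_S_L2[OF L]], erule cauchy_grad, rule that)
  have u0: "u \<in> W12A_0 S B" and Au: "AE x in M. A_grad S B u x = G x"
    by (rule W12A_0_limit[OF L u(1) G(1) u(2) G(2)])+
  have "(\<integral>x. A_grad S B u x \<bullet> grad_S \<eta> x \<partial>M) = - (\<integral>x. f x * \<eta> x \<partial>M)" if \<eta>: "\<eta> \<in> Lip_c B" for \<eta>
  proof -
    define q where "q = (\<integral>x. G x \<bullet> grad_S \<eta> x \<partial>M) + (\<integral>x. f x * \<eta> x \<partial>M)"
    define e where "e = energy \<eta>"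
    have "(\<lambda>m. \<integral>x. grad_S (\<psi> m) x \<bullet> grad_S \<eta> x \<partial>M) \<longlonglongrightarrow> (\<integral>x. G x \<bullet> grad_S \<eta> x \<partial>M)"
      by (rule l2_dist_tendsto_inner[OF grad_S_L2[OF L] G(1) grad_S_L2[OF \<eta>]
            grad_S_L2[OF \<eta>] G(2)]) simp
    then have lim: "(\<lambda>m. t * ((\<integral>x. grad_S (\<psi> m) x \<bullet> grad_S \<eta> x \<partial>M) + (\<integral>x. f x * \<eta> x \<partial>M)) + t\<^sup>2 / 2 * e)
        \<longlonglongrightarrow> t * q + t\<^sup>2 / 2 * e" for t
      unfolding q_def by (intro tendsto_intros)
    have "(\<lambda>m. - inverse (real (Suc m))) \<longlonglongrightarrow> - 0"
      by (intro tendsto_minus LIMSEQ_inverse_real_of_nat)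
    then have ge: "- 0 \<le> t * q + t\<^sup>2 / 2 * e" for t
      by (rule tendsto_le[OF sequentially_bot lim])
        (unfold e_def, intro always_eventually allI, rule almost_minimizer_variation[OF f \<psi> \<eta>])
    have e: "e \<ge> 0" by (simp add: e_def energy_nonneg)
    have "q = 0"
    proof (rule ccontr)
      assume q: "q \<noteq> 0"
      (* The variation at t = - q s would be negative, to first order - q^2 s. *)
      define s where "s = 1 / (e + 1)"
      have s: "s > 0" "s * e < 1" using e by (auto simp: s_def field_simps)
      have "0 \<le> (- q * s) * q + (- q * s)\<^sup>2 / 2 * e" using ge[of "- q * s"] by simp
      also have "\<dots> = q\<^sup>2 * s * (s * e / 2 - 1)"
        by (simp add: algebra_simps power2_eq_square)
      also have "\<dots> < 0" using q s by (intro mult_pos_neg mult_pos_pos) auto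
      finally show False by simp
    qed
    moreover have "(\<integral>x. A_grad S B u x \<bullet> grad_S \<eta> x \<partial>M) = (\<integral>x. G x \<bullet> grad_S \<eta> x \<partial>M)"
    proof (rule integral_cong_AE)
      show "AE x in M. A_grad S B u x \<bullet> grad_S \<eta> x = G x \<bullet> grad_S \<eta> x"
        using Au by (rule eventually_mono) simp
      show "(\<lambda>x. A_grad S B u x \<bullet> grad_S \<eta> x) \<in> borel_measurable M"
        using square_integrable_inner[OF A_grad_L2[OF W12A_0_W12A[OF u0]] grad_S_L2[OF \<eta>]] by simp
      show "(\<lambda>x. G x \<bullet> grad_S \<eta> x) \<in> borel_measurable M"
        using square_integrable_inner[OF G(1) grad_S_L2[OF \<eta>]] by simp
    qed
    ultimately show ?thesis by (simp add: q_def)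
  qed
  then have "weak_Dirichlet_solution S B f u" by (simp add: weak_solution_iff[OF u0])
  then show ?thesis using u that by blast
qed

text \<open>For almost minimizers the energy of \<open>(\<psi>\<^sub>m - k)\<^sub>+\<close> is at most
  \<open>2 \<epsilon>\<^sub>m + 2 F \<integral> (\<psi>\<^sub>m - k)\<^sub>+\<close>, and \<open>log_bump_Lip_c\<close> bounds the integral of \<open>(\<psi>\<^sub>m - k)\<^sub>+\<close> over a set by
  the square root of that energy. The set is taken to be \<open>{u > k}\<close> for every \<open>m\<close>, so that only the integrals have to
  converge. In the limit \<open>a \<le> (\<kappa>\<^sup>2 2 F a)\<^sup>1\<^sup>/\<^sup>2 R\<close>, which is solved for \<open>a\<close>.\<close>
lemma truncation_estimate:
  assumes f: "square_integrable M f" and F: "F \<ge> 0" "AE x in M. \<bar>f x\<bar> \<le> F"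
    and \<psi>: "\<And>m::nat. almost_minimizer f (inverse (real (Suc m))) (\<psi> m)"
    and u: "square_integrable M u" "(\<lambda>m. l2_dist M (\<psi> m) u) \<longlonglongrightarrow> 0"
    and k: "k \<ge> 0" and T: "T > 1"
  shows "(\<integral>x. max 0 (u x - k) \<partial>\<mu>) \<le>
    2 * \<kappa>\<^sup>2 * F * (T * measure \<mu> {x \<in> space \<mu>. u x > k} + 1 / (T * ln T powr N))\<^sup>2"
proof -
  note L = almost_minimizerD(1)[OF \<psi>]
  define \<epsilon> where "\<epsilon> m = inverse (real (Suc m))" for m
  have \<epsilon>: "\<epsilon> \<longlonglongrightarrow> 0" "\<And>m. \<epsilon> m > 0"
    unfolding \<epsilon>_def by (rule LIMSEQ_inverse_real_of_nat) simp
  define w where "w m x = max 0 (\<psi> m x - k)" for m x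
  define w' where "w' x = max 0 (u x - k)" for x
  have wL: "w m \<in> Lip_c B" for m unfolding w_def by (rule Lip_c_max[OF k L])
  have w_int: "integrable M (w m)" for m
    by (rule square_integrable_integrable[OF finite_measure_B Lip_c_L2[OF wL]])
  have u_int: "integrable M u" by (rule square_integrable_integrable[OF finite_measure_B u(1)])
  have \<psi>_int: "integrable M (\<psi> m)" for m
    by (rule square_integrable_integrable[OF finite_measure_B Lip_c_L2[OF L]])
  have w'_int: "integrable M w'"
    unfolding w'_def using u_int finite_measure.integrable_const[OF finite_measure_B, of k]
    by (intro integrable_max Bochner_Integration.integrable_diff) auto
  have [measurable]: "u \<in> borel_measurable M" using u(1) by (rule square_integrable_measurable)
  have int_E: "integrable M (\<lambda>x. indicator E x * g x)" if "E \<in> sets M" "integrable M g" for E and g :: "_ \<Rightarrow> real"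
    using integrable_real_mult_indicator[OF that] by (simp add: mult.commute)
  have conv: "(\<lambda>m. \<integral>x. indicator E x * w m x \<partial>\<mu>) \<longlonglongrightarrow> (\<integral>x. indicator E x * w' x \<partial>\<mu>)" if E: "E \<in> sets M" for E
  proof -
    have "(\<lambda>m. (\<integral>x. indicator E x * w m x \<partial>M) - (\<integral>x. indicator E x * w' x \<partial>M)) \<longlonglongrightarrow> 0"
    proof (rule Lim_null_comparison[OF always_eventually], rule allI)
      show "(\<lambda>m. \<integral>x. \<bar>\<psi> m x - u x\<bar> \<partial>M) \<longlonglongrightarrow> 0"
        by (rule l2_dist_tendsto_integral_abs[OF finite_measure_B Lip_c_L2[OF L] u])
      fix m
      have "\<bar>(\<integral>x. indicator E x * w m x \<partial>M) - (\<integral>x. indicator E x * w' x \<partial>M)\<bar>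
          = \<bar>\<integral>x. indicator E x * w m x - indicator E x * w' x \<partial>M\<bar>"
        using int_E[OF E w_int] int_E[OF E w'_int] by simp
      also have "\<dots> \<le> (\<integral>x. \<bar>\<psi> m x - u x\<bar> \<partial>M)"
      proof (rule order_trans[OF integral_abs_bound integral_mono])
        show "integrable M (\<lambda>x. \<bar>indicator E x * w m x - indicator E x * w' x\<bar>)"
          using int_E[OF E w_int] int_E[OF E w'_int] by (intro integrable_abs Bochner_Integration.integrable_diff)
        show "integrable M (\<lambda>x. \<bar>\<psi> m x - u x\<bar>)"
          using \<psi>_int u_int by (intro integrable_abs Bochner_Integration.integrable_diff)
        show "\<bar>indicator E x * w m x - indicator E x * w' x\<bar> \<le> \<bar>\<psi> m x - u x\<bar>" for x
          by (auto simp: w_def w'_def split: split_indicator)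
      qed
      finally show "norm ((\<integral>x. indicator E x * w m x \<partial>M) - (\<integral>x. indicator E x * w' x \<partial>M)) \<le> (\<integral>x. \<bar>\<psi> m x - u x\<bar> \<partial>M)"
        by simp
    qed
    then have "(\<lambda>m. \<integral>x. indicator E x * w m x \<partial>M) \<longlonglongrightarrow> (\<integral>x. indicator E x * w' x \<partial>M)"
      by (rule LIM_zero_cancel)
    moreover have "(\<integral>x. indicator E x * g x \<partial>\<mu>) = (\<integral>x. indicator E x * g x \<partial>M) / vol"
      if "integrable M g" for g :: "_ \<Rightarrow> real"
      by (rule integral_mu[OF borel_measurable_integrable[OF int_E[OF E that]]])
    ultimately show ?thesis
      using w_int w'_int vol_pos by (auto intro!: tendsto_divide)
  qed
  define a where "a = (\<integral>x. w' x \<partial>\<mu>)"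
  have ind_B: "(\<integral>x. indicator B x * g x \<partial>\<mu>) = (\<integral>x. g x \<partial>\<mu>)" for g :: "_ \<Rightarrow> real"
    by (intro Bochner_Integration.integral_cong) auto
  have a_lim: "(\<lambda>m. \<integral>x. w m x \<partial>\<mu>) \<longlonglongrightarrow> a"
    using conv[of B] by (simp add: ind_B a_def)
  define E where "E = {x \<in> space \<mu>. u x > k}"
  have E: "E \<in> sets M"
  proof -
    have "{x \<in> space M. u x > k} \<in> sets M" by measurable
    then show ?thesis by (simp add: E_def)
  qed
  have "(\<integral>x. indicator E x * w' x \<partial>\<mu>) = a"
    unfolding a_def by (intro Bochner_Integration.integral_cong) (auto simp: E_def w'_def split: split_indicator)
  then have E_lim: "(\<lambda>m. \<integral>x. indicator E x * w m x \<partial>\<mu>) \<longlonglongrightarrow> a"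
    using conv[OF E] by simp
  define e where "e m = 2 * \<epsilon> m + 2 * F * (vol * (\<integral>x. w m x \<partial>\<mu>))" for m
  have energy_le: "energy (w m) \<le> e m" for m
  proof -
    have "energy (w m) / 2 + (\<integral>x. f x * w m x \<partial>M) \<le> \<epsilon> m"
      using almost_minimizer_truncation[OF f \<psi> k] unfolding w_def \<epsilon>_def by simp
    moreover have "- F * (\<integral>x. w m x \<partial>M) \<le> (\<integral>x. f x * w m x \<partial>M)"
    proof -
      have "(\<integral>x. - F * w m x \<partial>M) \<le> (\<integral>x. f x * w m x \<partial>M)"
      proof (rule integral_mono_AE)
        show "AE x in M. - F * w m x \<le> f x * w m x"
          using F(2)
        proof eventually_elim
          case (elim x)
          have "- F \<le> f x" using elim by linarith
          then show ?case by (rule mult_right_mono) (simp add: w_def)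
        qed
        show "integrable M (\<lambda>x. - F * w m x)" using w_int by simp
        show "integrable M (\<lambda>x. f x * w m x)" by (rule integrable_mult_Lip_c[OF f wL])
      qed
      then show ?thesis by simp
    qed
    moreover have "vol * (\<integral>x. w m x \<partial>\<mu>) = (\<integral>x. w m x \<partial>M)"
      using integral_mu[OF borel_measurable_integrable[OF w_int]] vol_pos by simp
    ultimately show ?thesis by (simp add: e_def)
  qed
  define R where "R = T * measure \<mu> E + 1 / (T * ln T powr N)"
  have bump: "(\<integral>x. indicator E x * w m x \<partial>\<mu>) \<le> (\<kappa> * sqrt (e m / vol) + \<epsilon> m) * R" for m
    unfolding R_def
    by (rule log_bump_Lip_c[OF wL _ energy_le _ T E]) (auto simp: w_def \<epsilon>(2))
  have "e \<longlonglongrightarrow> 2 * 0 + 2 * F * (vol * a)"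
    unfolding e_def by (intro tendsto_intros \<epsilon> a_lim)
  then have "(\<lambda>m. (\<kappa> * sqrt (e m / vol) + \<epsilon> m) * R) \<longlonglongrightarrow> (\<kappa> * sqrt ((2 * 0 + 2 * F * (vol * a)) / vol) + 0) * R"
    using vol_pos by (intro tendsto_intros \<epsilon>) auto
  then have "a \<le> (\<kappa> * sqrt ((2 * 0 + 2 * F * (vol * a)) / vol) + 0) * R"
    by (rule tendsto_le[OF sequentially_bot _ E_lim]) (auto intro!: always_eventually bump)
  then have a_le: "a \<le> \<kappa> * sqrt (2 * F * a) * R" using vol_pos by (simp add: mult.assoc)
  have a0: "a \<ge> 0" unfolding a_def by (intro integral_nonneg_AE) (auto simp: w'_def)
  have "a \<le> 2 * \<kappa>\<^sup>2 * F * R\<^sup>2"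
  proof (cases "a = 0")
    case True then show ?thesis using F by simp
  next
    case False
    have "a * a \<le> (\<kappa> * sqrt (2 * F * a) * R)\<^sup>2"
      using power_mono[OF a_le a0, of 2] by (simp add: power2_eq_square)
    also have "\<dots> = a * (2 * \<kappa>\<^sup>2 * F * R\<^sup>2)"
      using F a0 by (simp add: power_mult_distrib)
    finally show ?thesis using False a0 by (simp add: mult_le_cancel_left)
  qed
  then show ?thesis unfolding a_def w'_def R_def E_def .
qed

lemma minimizing_limit_bounded_above:
  "\<exists>C\<ge>0. \<forall>f F \<psi> u. square_integrable M f \<longrightarrow> F > 0 \<longrightarrow> (AE x in M. \<bar>f x\<bar> \<le> F) \<longrightarrow>
    (\<forall>m::nat. almost_minimizer f (inverse (real (Suc m))) (\<psi> m)) \<longrightarrow>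
    square_integrable M u \<longrightarrow> (\<lambda>m. l2_dist M (\<psi> m) u) \<longlonglongrightarrow> 0 \<longrightarrow> (AE x in M. u x \<le> C * F)"
proof -
  obtain C where C: "C \<ge> 0" and bound: "\<And>\<Lambda> u. \<Lambda> > 0 \<Longrightarrow> integrable \<mu> u \<Longrightarrow>
    (\<forall>k\<ge>0. \<forall>T>1. (\<integral>x. max 0 (u x - k) \<partial>\<mu>) \<le>
       \<Lambda> * (T * measure \<mu> {x \<in> space \<mu>. u x > k} + 1 / (T * ln T powr N))\<^sup>2) \<Longrightarrow>
    (AE x in \<mu>. u x \<le> C * \<Lambda>)"
    using prob_space.log_bump_truncations_imp_bounded[OF prob_space_mu N_gt_1] by meson
  have "AE x in M. u x \<le> C * (2 * \<kappa>\<^sup>2) * F"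
    if f: "square_integrable M f" "F > 0" "AE x in M. \<bar>f x\<bar> \<le> F"
      and \<psi>: "\<forall>m::nat. almost_minimizer f (inverse (real (Suc m))) (\<psi> m)"
      and u: "square_integrable M u" "(\<lambda>m. l2_dist M (\<psi> m) u) \<longlonglongrightarrow> 0" for f F \<psi> u
  proof -
    have "AE x in \<mu>. u x \<le> C * (2 * \<kappa>\<^sup>2 * F)"
    proof (rule bound)
      show "2 * \<kappa>\<^sup>2 * F > 0" using f kappa_pos by simp
      show "integrable \<mu> u"
        by (rule integrable_mu[OF square_integrable_integrable[OF finite_measure_B u(1)]])
    qed (use truncation_estimate[OF f(1) less_imp_le[OF f(2)] f(3) _ u] \<psi> in blast)
    then show ?thesis by (simp add: AE_mu_iff mult.assoc)
  qed
  then show ?thesis using C kappa_pos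
    by (intro exI[of _ "C * (2 * \<kappa>\<^sup>2)"] conjI allI impI) simp_all
qed

text \<open>The upper bound applies to \<open>u\<close> and, with the data \<open>- f\<close>, to \<open>- u\<close>. It requires a positive bound for
  \<open>|f|\<close>, so it is used with every \<open>F' > F\<close>; this covers \<open>f = 0\<close> too.\<close>
theorem bounded_weak_solution_exists:
  "\<exists>C::real. \<forall>f\<in>Linf_space B.
      \<exists>u. weak_Dirichlet_solution S B f u \<and>
          (\<forall>v. weak_Dirichlet_solution S B f v \<longrightarrow> (AE x in M. v x = u x)) \<and>
          Linf_norm B u \<le> ereal C * Linf_norm B f"
proof -
  obtain C where C: "C \<ge> 0" and bound: "\<And>f F \<psi> u. square_integrable M f \<Longrightarrow> F > 0 \<Longrightarrow> (AE x in M. \<bar>f x\<bar> \<le> F) \<Longrightarrow>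
    (\<And>m::nat. almost_minimizer f (inverse (real (Suc m))) (\<psi> m)) \<Longrightarrow>
    square_integrable M u \<Longrightarrow> (\<lambda>m. l2_dist M (\<psi> m) u) \<longlonglongrightarrow> 0 \<Longrightarrow> (AE x in M. u x \<le> C * F)"
    using minimizing_limit_bounded_above by meson
  have "\<exists>u. weak_Dirichlet_solution S B f u \<and>
          (\<forall>v. weak_Dirichlet_solution S B f v \<longrightarrow> (AE x in M. v x = u x)) \<and>
          Linf_norm B u \<le> ereal C * Linf_norm B f" if f_Linf: "f \<in> Linf_space B" for f
  proof -
    have f_meas: "f \<in> borel_measurable M" and f_fin: "Linf_norm B f < \<infinity>"
      using f_Linf by (auto simp: Linf_space_def)
    have f_ae: "AE x in M. ereal \<bar>f x\<bar> \<le> Linf_norm B f"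
      unfolding Linf_norm_def by (rule esssup_AE)
    have "Linf_norm B f \<ge> 0"
    proof (rule ccontr)
      assume neg: "\<not> Linf_norm B f \<ge> 0"
      have "AE x in M. False"
        using f_ae
      proof eventually_elim
        case (elim x)
        have "0 \<le> ereal \<bar>f x\<bar>" by simp
        then show ?case using elim neg by (metis order_trans)
      qed
      then show False using prob_space.AE_False[OF prob_space_mu] AE_mu_iff[of "\<lambda>x. False"] by blast
    qed
    then obtain F where F: "Linf_norm B f = ereal F" "F \<ge> 0"
      using f_fin by (cases "Linf_norm B f") auto
    have f_le: "AE x in M. \<bar>f x\<bar> \<le> F" using f_ae by (simp add: F(1))
    have f: "square_integrable M f"
      by (rule square_integrable_bounded[OF finite_measure_B f_meas]) (use f_le in simp)
    obtain \<psi> where \<psi>: "\<And>m::nat. almost_minimizer f (inverse (real (Suc m))) (\<psi> m)"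
      using almost_minimizer_exists[OF f, of "inverse (real (Suc m))" for m] by (metis inverse_positive_iff_positive of_nat_0_less_iff zero_less_Suc)
    obtain u where u: "square_integrable M u" "(\<lambda>m. l2_dist M (\<psi> m) u) \<longlonglongrightarrow> 0" "weak_Dirichlet_solution S B f u"
      by (rule minimizing_sequence_converges[OF f \<psi>]) (rule that)
    have abs_u: "AE x in M. \<bar>u x\<bar> \<le> C * F'" if F': "F' > F" for F'
    proof -
      have F'_pos: "F' > 0" using F F' by linarith
      have f_le': "AE x in M. \<bar>f x\<bar> \<le> F'" using f_le by (rule eventually_mono) (use F' in linarith)
      have "AE x in M. u x \<le> C * F'"
        by (rule bound[OF f F'_pos f_le' \<psi> u(1,2)])
      moreover have "AE x in M. - u x \<le> C * F'"
      proof (rule bound[OF _ F'_pos _ almost_minimizer_uminus[OF f \<psi>]])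
        show "square_integrable M (\<lambda>x. - f x)" using square_integrable_scaleR[OF f, of "-1"] by simp
        show "AE x in M. \<bar>- f x\<bar> \<le> F'" using f_le' by simp
        show "square_integrable M (\<lambda>x. - u x)" using square_integrable_scaleR[OF u(1), of "-1"] by simp
        show "(\<lambda>m. l2_dist M (\<lambda>x. - \<psi> m x) (\<lambda>x. - u x)) \<longlonglongrightarrow> 0"
          using u(2) by (simp add: l2_dist_def power2_commute)
      qed
      ultimately show ?thesis by eventually_elim linarith
    qed
    have "AE x in M. \<forall>n. \<bar>u x\<bar> \<le> C * (F + inverse (real (Suc n)))"
      by (subst AE_all_countable) (intro allI abs_u, simp)
    then have u_le: "AE x in M. \<bar>u x\<bar> \<le> C * F"
    proof eventually_elim
      case (elim x)
      have "(\<lambda>n. C * (F + inverse (real (Suc n)))) \<longlonglongrightarrow> C * (F + 0)"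
        by (intro tendsto_intros LIMSEQ_inverse_real_of_nat)
      then show ?case using elim by (intro tendsto_lowerbound[of _ "C * F" sequentially]) auto
    qed
    have "Linf_norm B u \<le> ereal (C * F)"
      unfolding Linf_norm_def
    proof (rule esssup_I)
      show "(\<lambda>x. ereal \<bar>u x\<bar>) \<in> borel_measurable M"
        using u(1) by (intro borel_measurable_ereal borel_measurable_abs square_integrable_measurable)
      show "AE x in M. ereal \<bar>u x\<bar> \<le> ereal (C * F)" using u_le by simp
    qed
    then have "Linf_norm B u \<le> ereal C * Linf_norm B f" by (simp add: F(1))
    then show ?thesis using u(3) weak_solution_unique by blast
  qed
  then show ?thesis by blast
qed

end

section \<open>Bounded solutions of the Dirichlet problem\<close>

theorem theorem1:
  fixes d :: "real^'n \<Rightarrow> real^'n \<Rightarrow> real"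
    and x0 :: "real^'n" and r :: real
    and B :: "(real^'n) set"
    and A S :: "real^'n \<Rightarrow> real^'n^'n"
    and N C0 :: real
    and \<phi> :: "real \<Rightarrow> ennreal"
  assumes d_metric: "Metric_space UNIV d"
    and B_ball: "0 < r" "B = Metric_space.mball UNIV d x0 r"
    and B_bounded_domain: "open B" "connected B" "bounded B"
    and A_measurable: "A \<in> borel_measurable (lebesgue_on B)"
    and A_bounded: "bounded (A ` B)"
    and A_nonneg_semidefinite:
      "\<And>x. x \<in> B \<Longrightarrow> transpose (A x) = A x \<and> (\<forall>\<xi>. 0 \<le> \<xi> \<bullet> (A x *v \<xi>))"
    and S_Lipschitz: "\<exists>K. K-lipschitz_on B S"
    and A_factorization: "\<And>x. x \<in> B \<Longrightarrow> A x = transpose (S x) ** S x"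
    and N_gt_1: "N > 1"
    and phi_young: "young_function \<phi>"
    and phi_ge_square: "\<And>t. t \<ge> 0 \<Longrightarrow> \<phi> t \<ge> ennreal (t\<^sup>2)"
    and phi_ge_square_log: "\<And>t. t \<ge> 1 \<Longrightarrow> \<phi> t \<ge> ennreal (t\<^sup>2 * (ln t) powr N)"
    and Orlicz_Sobolev: "\<And>w. w \<in> W12A_0 S B \<Longrightarrow>
      luxemburg_norm (normalized_lebesgue_on B) \<phi> w \<le>
        ennreal (C0 * sqrt (\<integral>x. (norm (A_grad S B w x))\<^sup>2 \<partial>normalized_lebesgue_on B))"
  shows "\<exists>C::real. \<forall>f\<in>Linf_space B.
      \<exists>u. weak_Dirichlet_solution S B f u \<and>
          (\<forall>v. weak_Dirichlet_solution S B f v \<longrightarrow> (AE x in lebesgue_on B. v x = u x)) \<and>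
          Linf_norm B u \<le> ereal C * Linf_norm B f"
proof -
  have "x0 \<in> B"
    using B_ball Metric_space.centre_in_mball_iff[OF d_metric] by simp
  then interpret orlicz_sobolev_domain S B \<phi> N C0
    using B_bounded_domain S_Lipschitz N_gt_1 phi_young phi_ge_square phi_ge_square_log Orlicz_Sobolev
    by unfold_locales (auto simp: young_function_def)
  show ?thesis by (rule bounded_weak_solution_exists)
qed

end
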